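(* Let $T_{\mathfrak{sl}_4} \in \mathfrak{sl}_4^* \otimes \mathfrak{sl}_4^* \otimes \mathfrak{sl}_4$ be the structure tensor of the complex Lie algebra $\mathfrak{sl}_4$. Then its border rank satisfies $\underline{\mathbf{R}}(T_{\mathfrak{sl}_4}) \geq 28$.
   Context: $\mathfrak{sl}_n$ denotes the Lie algebra of traceless $n\times n$ complex matrices with bracket $[x,y]=xy-yx$. Its structure tensor $T_{\mathfrak{sl}_n}\in \mathfrak{sl}_n^*\otimes\mathfrak{sl}_n^*\otimes\mathfrak{sl}_n$ is the tensor corresponding to the bilinear map $(x,y)\mapsto [x,y]$; in a basis $\{a_i\}$ with dual basis $\{\alpha^i\}$ and $[a_i,a_j]=\sum_k A_{ij}^k a_k$, it is $\sum_{i,j,k} A_{ij}^k\,\alpha^i\otimes\alpha^j\otimes a_k$. For a tensor $T\in A\otimes B\otimes C$ over $\mathbb{C}$, the rank of $T$ is the minimal $r$ with $T=\sum_{i=1}^r a_i\otimes b_i\otimes c_i$, and the border rank $\underline{\mathbf{R}}(T)$ is the minimal $r$ such that $T=\lim_{\epsilon\to 0}T_\epsilon$ with each $T_\epsilon$ of rank at most $r$. *)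

theory Defs
  imports "HOL-Analysis.Analysis"
begin

text \<open>Square matrices of size n are represented as functions nat => nat => complex,
  only the entries with indices < n being relevant.\<close>

definition mat_mult :: "nat \<Rightarrow> (nat \<Rightarrow> nat \<Rightarrow> complex) \<Rightarrow> (nat \<Rightarrow> nat \<Rightarrow> complex) \<Rightarrow> (nat \<Rightarrow> nat \<Rightarrow> complex)" where
  "mat_mult n M N = (\<lambda>a b. \<Sum>l<n. M a l * N l b)"

definition lie_bracket :: "nat \<Rightarrow> (nat \<Rightarrow> nat \<Rightarrow> complex) \<Rightarrow> (nat \<Rightarrow> nat \<Rightarrow> complex) \<Rightarrow> (nat \<Rightarrow> nat \<Rightarrow> complex)" where
  "lie_bracket n x y = (\<lambda>a b. mat_mult n x y a b - mat_mult n y x a b)"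

definition elem_mat :: "nat \<Rightarrow> nat \<Rightarrow> (nat \<Rightarrow> nat \<Rightarrow> complex)" where
  "elem_mat i j = (\<lambda>a b. if a = i \<and> b = j then 1 else 0)"

definition sl_basis :: "nat \<Rightarrow> (nat \<Rightarrow> nat \<Rightarrow> complex) list" where
  "sl_basis n =
     concat (map (\<lambda>i. map (\<lambda>j. elem_mat i j) (filter (\<lambda>j. j \<noteq> i) [0..<n])) [0..<n])
     @ map (\<lambda>i. (\<lambda>a b. elem_mat i i a b - elem_mat (Suc i) (Suc i) a b)) [0..<n - 1]"

definition sl_dim :: "nat \<Rightarrow> nat" where
  "sl_dim n = length (sl_basis n)"

definition sl_coords :: "nat \<Rightarrow> (nat \<Rightarrow> nat \<Rightarrow> complex) \<Rightarrow> (nat \<Rightarrow> complex)" where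
  "sl_coords n M = (THE c. (\<forall>k. k \<ge> sl_dim n \<longrightarrow> c k = 0) \<and>
      (\<forall>a<n. \<forall>b<n. M a b = (\<Sum>k<sl_dim n. c k * (sl_basis n ! k) a b)))"

definition sl_structure_tensor :: "nat \<Rightarrow> (nat \<Rightarrow> nat \<Rightarrow> nat \<Rightarrow> complex)" where
  "sl_structure_tensor n = (\<lambda>i j k.
      sl_coords n (lie_bracket n (sl_basis n ! i) (sl_basis n ! j)) k)"

text \<open>Tensors in C^d1 (x) C^d2 (x) C^d3 as functions, entries with indices in range.\<close>

definition tensor_rank_le :: "nat \<Rightarrow> nat \<Rightarrow> nat \<Rightarrow> (nat \<Rightarrow> nat \<Rightarrow> nat \<Rightarrow> complex) \<Rightarrow> nat \<Rightarrow> bool" where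
  "tensor_rank_le d1 d2 d3 T r \<longleftrightarrow>
     (\<exists>u v w :: nat \<Rightarrow> nat \<Rightarrow> complex.
        \<forall>i<d1. \<forall>j<d2. \<forall>k<d3. T i j k = (\<Sum>l<r. u l i * v l j * w l k))"

definition border_rank_le :: "nat \<Rightarrow> nat \<Rightarrow> nat \<Rightarrow> (nat \<Rightarrow> nat \<Rightarrow> nat \<Rightarrow> complex) \<Rightarrow> nat \<Rightarrow> bool" where
  "border_rank_le d1 d2 d3 T r \<longleftrightarrow>
     (\<exists>S :: nat \<Rightarrow> nat \<Rightarrow> nat \<Rightarrow> nat \<Rightarrow> complex.
        (\<forall>m. tensor_rank_le d1 d2 d3 (S m) r) \<and>
        (\<forall>i<d1. \<forall>j<d2. \<forall>k<d3. (\<lambda>m. S m i j k) \<longlonglongrightarrow> T i j k))"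

definition border_rank :: "nat \<Rightarrow> nat \<Rightarrow> nat \<Rightarrow> (nat \<Rightarrow> nat \<Rightarrow> nat \<Rightarrow> complex) \<Rightarrow> nat" where
  "border_rank d1 d2 d3 T = (LEAST r. border_rank_le d1 d2 d3 T r)"

end

theory Submission
  imports Defs "HOL-Library.Tree" "HOL-Computational_Algebra.Polynomial"
begin

text \<open>
  The structure tensor is equivalent to the invariant form \<open>tr ([a, b] c)\<close>. If it had border rank at
  most 27, restricting each of the three arguments to a hyperplane would remove one rank-one summand
  per argument (border substitution) and leave border rank at most 24. The group \<open>GL\<^sub>4\<close> preserves the form,
  and a generic conjugation followed by a one-parameter subgroup degenerates any three hyperplanes to
  the hyperplane of matrices without \<open>E\<^sub>0\<^sub>1\<close>-component. So the form restricted to this hyperplane in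
  all three arguments would have border rank at most 24.

  This is excluded by a Koszul flattening: on a 7-dimensional space of first arguments a rank-one tensor
  contributes rank at most \<open>6 choose 3 = 20\<close>, so the \<open>490 \<times> 490\<close> flattening would have rank at
  most \<open>24 \<cdot> 20 = 480\<close>. For a suitable 7-dimensional space its rank is at least 481: an explicit
  triangular system of row combinations shows that 481 of the unknowns are determined.
\<close>

section \<open>Linear systems and compactness\<close>

text \<open>On the full form the flattening over seven directions is a 525 x 525 matrix (35 * 15
  rows and columns), so with 20 per rank-one summand it can never prove more than 27. Substitution
  goes beyond this: it gains three while the matrix only shrinks to 490 x 490, still larger than 20
  * 24. Its price is that nothing is known about the hyperplanes, and an explicit computation needs
  known ones; hence the degeneration to one fixed triple.

  The trilinear form is used instead of the structure tensor because its three arguments are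
  interchangeable under rotation and transform alike under conjugation, so one argument treats all
  three hyperplanes.

  Matrix rank itself never occurs. The upper bound reads: any set of more than \<open>20 * r\<close>
  unknowns supports a non-zero kernel vector, and after normalisation this survives the limit. The
  lower bound reads: a kernel vector supported on 481 chosen unknowns is zero. The restricted
  support sets the other nine unknowns to zero, so elimination may start from them.\<close>

lemma underdetermined_system_nontrivial:
  fixes A :: "'e \<Rightarrow> 'x \<Rightarrow> 'k::field"
  assumes "finite E" "finite X" "card E < card X"
  shows "\<exists>c. (\<exists>x\<in>X. c x \<noteq> 0) \<and> (\<forall>e\<in>E. (\<Sum>x\<in>X. A e x * c x) = 0)"
  using assms
proof (induction E arbitrary: X A rule: finite_induct)
  case empty
  then obtain x where "x \<in> X" by fastforce
  then show ?case by (intro exI[of _ "\<lambda>_. 1"]) auto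
next
  case (insert e E)
  show ?case
  proof (cases "\<forall>x\<in>X. A e x = 0")
    case True
    have "card E < card X" using insert by simp
    from insert.IH[OF insert.prems(1) this, of A] True show ?thesis by auto
  next
    case False
    then obtain x0 where x0: "x0 \<in> X" "A e x0 \<noteq> 0" by blast
    define Y where "Y = X - {x0}"
    have Y: "finite Y" "x0 \<notin> Y" "X = insert x0 Y" "card E < card Y"
      using insert x0 by (auto simp: Y_def)
    define A' where "A' = (\<lambda>e' x. A e' x - A e' x0 / A e x0 * A e x)"
    obtain c where c: "\<exists>x\<in>Y. c x \<noteq> 0" "\<forall>e\<in>E. (\<Sum>x\<in>Y. A' e x * c x) = 0"
      using insert.IH[OF Y(1) Y(4), of A'] by blast
    define s where "s = (\<Sum>x\<in>Y. A e x * c x)"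
    define c' where "c' = c(x0 := - s / A e x0)"
    have split: "(\<Sum>x\<in>X. A f x * c' x) = - A f x0 * s / A e x0 + (\<Sum>x\<in>Y. A f x * c x)" for f
    proof -
      have "(\<Sum>x\<in>Y. A f x * c' x) = (\<Sum>x\<in>Y. A f x * c x)"
        using Y(2) by (intro sum.cong) (auto simp: c'_def)
      then show ?thesis unfolding Y(3) using Y(1,2) by (simp add: c'_def)
    qed
    have "(\<Sum>x\<in>X. A f x * c' x) = 0" if "f \<in> insert e E" for f
    proof (cases "f = e")
      case True
      then show ?thesis using x0 split[of e] by (simp add: s_def)
    next
      case False
      then have "(\<Sum>x\<in>Y. A' f x * c x) = 0" using c that by auto
      moreover have "(\<Sum>x\<in>Y. A' f x * c x) = (\<Sum>x\<in>Y. A f x * c x) - A f x0 / A e x0 * s"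
        by (simp add: A'_def s_def sum_subtractf sum_distrib_left left_diff_distrib mult.assoc)
      ultimately show ?thesis using split[of f] by simp
    qed
    moreover have "\<exists>x\<in>X. c' x \<noteq> 0" using c(1) Y by (auto simp: c'_def)
    ultimately show ?thesis by blast
  qed
qed

text \<open>Bolzano-Weierstrass for finitely many coordinates at once, by nested subsequences. It
  serves both limit arguments: for the functionals in border substitution and for the kernel vectors
  of the flattening.\<close>

lemma bounded_family_convergent_subseq:
  fixes c :: "nat \<Rightarrow> 'x \<Rightarrow> 'b::heine_borel"
  assumes "finite X" and "\<And>x. x \<in> X \<Longrightarrow> bounded (range (\<lambda>m. c m x))"
  shows "\<exists>\<sigma> l. strict_mono (\<sigma>::nat \<Rightarrow> nat) \<and> (\<forall>x\<in>X. (\<lambda>m. c (\<sigma> m) x) \<longlonglongrightarrow> l x)"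
  using assms
proof (induction X rule: finite_induct)
  case empty
  show ?case by (intro exI[of _ id]) (auto simp: strict_mono_def)
next
  case (insert x X)
  then obtain \<sigma> l where \<sigma>: "strict_mono (\<sigma>::nat \<Rightarrow> nat)" "\<forall>x\<in>X. (\<lambda>m. c (\<sigma> m) x) \<longlonglongrightarrow> l x"
    by auto
  have "bounded (range (\<lambda>m. c (\<sigma> m) x))"
    by (rule bounded_subset[OF insert.prems[of x]]) auto
  then obtain a \<tau> where \<tau>: "strict_mono (\<tau>::nat \<Rightarrow> nat)" "((\<lambda>m. c (\<sigma> m) x) \<circ> \<tau>) \<longlonglongrightarrow> a"
    using bounded_imp_convergent_subsequence by blast
  have "\<forall>z\<in>insert x X. (\<lambda>m. c ((\<sigma> \<circ> \<tau>) m) z) \<longlonglongrightarrow> (l(x := a)) z"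
    using \<sigma>(2) \<tau> LIMSEQ_subseq_LIMSEQ[OF _ \<tau>(1)] insert.hyps by (auto simp: o_def)
  then show ?case using strict_mono_o[OF \<sigma>(1) \<tau>(1)] by blast
qed

section \<open>Border rank and border substitution\<close>

lemma tensor_rank_le_mono:
  assumes "tensor_rank_le d1 d2 d3 t r" "r \<le> s"
  shows "tensor_rank_le d1 d2 d3 t s"
proof -
  obtain u v w where t: "\<forall>i<d1. \<forall>j<d2. \<forall>k<d3. t i j k = (\<Sum>l<r. u l i * v l j * w l k)"
    using assms(1) unfolding tensor_rank_le_def by blast
  define u' where "u' = (\<lambda>l i. if l < r then u l i else 0)"
  have "(\<Sum>l<s. u' l i * v l j * w l k) = (\<Sum>l<r. u l i * v l j * w l k)" for i j k
    by (rule sum.mono_neutral_cong_right) (use assms(2) in \<open>auto simp: u'_def\<close>)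
  with t show ?thesis unfolding tensor_rank_le_def
    by (intro exI[of _ u'] exI[of _ v] exI[of _ w]) simp
qed

lemma border_rank_le_mono:
  "border_rank_le d1 d2 d3 t r \<Longrightarrow> r \<le> s \<Longrightarrow> border_rank_le d1 d2 d3 t s"
  unfolding border_rank_le_def using tensor_rank_le_mono by blast

text \<open>With sequences replaced by approximations, closedness under limits becomes an
  \<open>\<epsilon>/2\<close> estimate instead of a diagonal argument.\<close>

lemma border_rank_le_approx:
  "border_rank_le d1 d2 d3 t r \<longleftrightarrow>
    (\<forall>\<epsilon>>0. \<exists>s. tensor_rank_le d1 d2 d3 s r \<and>
      (\<forall>i<d1. \<forall>j<d2. \<forall>k<d3. dist (s i j k) (t i j k) < \<epsilon>))" (is "?L \<longleftrightarrow> ?R")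
proof
  assume ?L
  then obtain S where S: "\<And>m. tensor_rank_le d1 d2 d3 (S m) r"
    "\<And>i j k. i < d1 \<Longrightarrow> j < d2 \<Longrightarrow> k < d3 \<Longrightarrow> (\<lambda>m. S m i j k) \<longlonglongrightarrow> t i j k"
    unfolding border_rank_le_def by blast
  show ?R
  proof (intro allI impI)
    fix \<epsilon> :: real assume "\<epsilon> > 0"
    have "\<forall>\<^sub>F m in sequentially. \<forall>i\<in>{..<d1}. \<forall>j\<in>{..<d2}. \<forall>k\<in>{..<d3}. dist (S m i j k) (t i j k) < \<epsilon>"
      using S(2) \<open>\<epsilon> > 0\<close> by (auto simp: eventually_ball_finite_distrib intro!: tendstoD)
    then obtain m where "\<forall>i\<in>{..<d1}. \<forall>j\<in>{..<d2}. \<forall>k\<in>{..<d3}. dist (S m i j k) (t i j k) < \<epsilon>"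
      by (auto simp: eventually_sequentially)
    with S(1)[of m] show "\<exists>s. tensor_rank_le d1 d2 d3 s r \<and>
      (\<forall>i<d1. \<forall>j<d2. \<forall>k<d3. dist (s i j k) (t i j k) < \<epsilon>)" by auto
  qed
next
  assume R: ?R
  have "\<exists>s. tensor_rank_le d1 d2 d3 s r \<and>
      (\<forall>i<d1. \<forall>j<d2. \<forall>k<d3. dist (s i j k) (t i j k) < inverse (real (Suc m)))" for m
    using R by simp
  then obtain S where S: "\<And>m. tensor_rank_le d1 d2 d3 (S m) r"
    "\<And>m i j k. i < d1 \<Longrightarrow> j < d2 \<Longrightarrow> k < d3 \<Longrightarrow> dist (S m i j k) (t i j k) < inverse (real (Suc m))"
    by metis
  have "(\<lambda>m. S m i j k) \<longlonglongrightarrow> t i j k" if "i < d1" "j < d2" "k < d3" for i j k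
  proof -
    have "(\<lambda>m. dist (S m i j k) (t i j k)) \<longlonglongrightarrow> 0"
      by (rule tendsto_sandwich[OF _ _ tendsto_const LIMSEQ_inverse_real_of_nat])
        (simp_all add: less_imp_le[OF S(2)[OF that]] del: of_nat_Suc)
    then show ?thesis by (rule iffD2[OF tendsto_dist_iff])
  qed
  with S(1) show ?L unfolding border_rank_le_def by blast
qed

lemma border_rank_le_limit:
  assumes "\<And>m::nat. border_rank_le d1 d2 d3 (t m) r"
    and "\<And>i j k. i < d1 \<Longrightarrow> j < d2 \<Longrightarrow> k < d3 \<Longrightarrow> (\<lambda>m. t m i j k) \<longlonglongrightarrow> t' i j k"
  shows "border_rank_le d1 d2 d3 t' r"
  unfolding border_rank_le_approx
proof (intro allI impI)
  fix \<epsilon> :: real assume "\<epsilon> > 0"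
  have "\<forall>\<^sub>F m in sequentially. \<forall>i\<in>{..<d1}. \<forall>j\<in>{..<d2}. \<forall>k\<in>{..<d3}. dist (t m i j k) (t' i j k) < \<epsilon>/2"
    using assms(2) \<open>\<epsilon> > 0\<close>
    by (auto simp: eventually_ball_finite_distrib simp del: less_divide_eq_numeral1 intro!: tendstoD)
  then obtain m where m: "\<forall>i\<in>{..<d1}. \<forall>j\<in>{..<d2}. \<forall>k\<in>{..<d3}. dist (t m i j k) (t' i j k) < \<epsilon>/2"
    by (auto simp: eventually_sequentially)
  obtain s where s: "tensor_rank_le d1 d2 d3 s r"
    "\<And>i j k. i<d1 \<Longrightarrow> j<d2 \<Longrightarrow> k<d3 \<Longrightarrow> dist (s i j k) (t m i j k) < \<epsilon>/2"
    using assms(1)[of m, unfolded border_rank_le_approx, rule_format, of "\<epsilon>/2"] \<open>\<epsilon> > 0\<close> by auto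
  have "dist (s i j k) (t' i j k) < \<epsilon>" if "i<d1" "j<d2" "k<d3" for i j k
    using dist_triangle_half_r[of "t m i j k" "s i j k" \<epsilon> "t' i j k"] s(2)[OF that] m that
    by (auto simp: dist_commute)
  with s(1) show "\<exists>s. tensor_rank_le d1 d2 d3 s r \<and>
      (\<forall>i<d1. \<forall>j<d2. \<forall>k<d3. dist (s i j k) (t' i j k) < \<epsilon>)" by blast
qed

text \<open>Substitution results are proved for the first argument only and reach the other two by
  rotation.\<close>

lemma border_rank_le_rotate:
  assumes "border_rank_le d1 d2 d3 t r"
  shows "border_rank_le d2 d3 d1 (\<lambda>j k i. t i j k) r"
proof -
  have rot: "tensor_rank_le d2 d3 d1 (\<lambda>j k i. s i j k) r" if s: "tensor_rank_le d1 d2 d3 s r" for s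
  proof -
    obtain u v w where "\<forall>i<d1. \<forall>j<d2. \<forall>k<d3. s i j k = (\<Sum>l<r. u l i * v l j * w l k)"
      using s unfolding tensor_rank_le_def by blast
    then show ?thesis unfolding tensor_rank_le_def
      by (intro exI[of _ v] exI[of _ w] exI[of _ u]) (simp add: mult_ac)
  qed
  obtain S where "\<And>m. tensor_rank_le d1 d2 d3 (S m) r"
    "\<And>i j k. i < d1 \<Longrightarrow> j < d2 \<Longrightarrow> k < d3 \<Longrightarrow> (\<lambda>m. S m i j k) \<longlonglongrightarrow> t i j k"
    using assms unfolding border_rank_le_def by blast
  with rot show ?thesis unfolding border_rank_le_def
    by (intro exI[of _ "\<lambda>m j k i. S m i j k"]) blast
qed

lemma border_rank_le_subst:
  assumes "border_rank_le d1 d2 d3 t r"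
  shows "border_rank_le d d2 d3 (\<lambda>i j k. \<Sum>a<d1. L a i * t a j k) r"
proof -
  have sub: "tensor_rank_le d d2 d3 (\<lambda>i j k. \<Sum>a<d1. L a i * s a j k) r"
    if s: "tensor_rank_le d1 d2 d3 s r" for s
  proof -
    obtain u v w where *: "\<forall>i<d1. \<forall>j<d2. \<forall>k<d3. s i j k = (\<Sum>l<r. u l i * v l j * w l k)"
      using s unfolding tensor_rank_le_def by blast
    have "(\<Sum>a<d1. L a i * s a j k) = (\<Sum>l<r. (\<Sum>a<d1. L a i * u l a) * v l j * w l k)"
      if "j < d2" "k < d3" for i j k
    proof -
      have "(\<Sum>a<d1. L a i * s a j k) = (\<Sum>a<d1. \<Sum>l<r. L a i * u l a * v l j * w l k)"
        using * that by (intro sum.cong) (auto simp: sum_distrib_left mult_ac)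
      also have "\<dots> = (\<Sum>l<r. (\<Sum>a<d1. L a i * u l a) * v l j * w l k)"
        by (subst sum.swap) (simp add: sum_distrib_right)
      finally show ?thesis .
    qed
    then show ?thesis unfolding tensor_rank_le_def
      by (intro exI[of _ "\<lambda>l i. \<Sum>a<d1. L a i * u l a"] exI[of _ v] exI[of _ w]) simp
  qed
  obtain S where "\<And>m. tensor_rank_le d1 d2 d3 (S m) r"
    "\<And>i j k. i < d1 \<Longrightarrow> j < d2 \<Longrightarrow> k < d3 \<Longrightarrow> (\<lambda>m. S m i j k) \<longlonglongrightarrow> t i j k"
    using assms unfolding border_rank_le_def by blast
  with sub show ?thesis unfolding border_rank_le_def
    by (intro exI[of _ "\<lambda>m i j k. \<Sum>a<d1. L a i * S m a j k"])
      (auto intro!: tendsto_sum tendsto_mult_left)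
qed

section \<open>Linear substitution in each of the three arguments\<close>

definition sub1 :: "nat \<Rightarrow> (nat \<Rightarrow> nat \<Rightarrow> complex) \<Rightarrow> (nat \<Rightarrow> nat \<Rightarrow> nat \<Rightarrow> complex) \<Rightarrow> nat \<Rightarrow> nat \<Rightarrow> nat \<Rightarrow> complex" where
  "sub1 d L t = (\<lambda>i j k. \<Sum>a<d. L a i * t a j k)"

definition sub2 :: "nat \<Rightarrow> (nat \<Rightarrow> nat \<Rightarrow> complex) \<Rightarrow> (nat \<Rightarrow> nat \<Rightarrow> nat \<Rightarrow> complex) \<Rightarrow> nat \<Rightarrow> nat \<Rightarrow> nat \<Rightarrow> complex" where
  "sub2 d L t = (\<lambda>i j k. \<Sum>b<d. L b j * t i b k)"

definition sub3 :: "nat \<Rightarrow> (nat \<Rightarrow> nat \<Rightarrow> complex) \<Rightarrow> (nat \<Rightarrow> nat \<Rightarrow> nat \<Rightarrow> complex) \<Rightarrow> nat \<Rightarrow> nat \<Rightarrow> nat \<Rightarrow> complex" where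
  "sub3 d L t = (\<lambda>i j k. \<Sum>c<d. L c k * t i j c)"

lemma border_rank_le_sub1:
  "border_rank_le d1 d2 d3 t r \<Longrightarrow> border_rank_le d d2 d3 (sub1 d1 L t) r"
  unfolding sub1_def by (rule border_rank_le_subst)

lemma border_rank_le_sub2:
  "border_rank_le d1 d2 d3 t r \<Longrightarrow> border_rank_le d1 d d3 (sub2 d2 L t) r"
  unfolding sub2_def
  by (rule border_rank_le_rotate[OF border_rank_le_rotate[OF border_rank_le_subst[OF border_rank_le_rotate]]])

lemma border_rank_le_sub3:
  "border_rank_le d1 d2 d3 t r \<Longrightarrow> border_rank_le d1 d2 d (sub3 d3 L t) r"
  unfolding sub3_def
  by (rule border_rank_le_rotate[OF border_rank_le_subst[OF border_rank_le_rotate[OF border_rank_le_rotate]]])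

lemma sub_commute:
  "sub2 d' M (sub1 d L t) = sub1 d L (sub2 d' M t)"
  "sub3 d' M (sub1 d L t) = sub1 d L (sub3 d' M t)"
  "sub3 d' M (sub2 d L t) = sub2 d L (sub3 d' M t)"
  unfolding sub1_def sub2_def sub3_def sum_distrib_left
  by (intro ext, subst sum.swap, simp add: mult.left_commute)+

text \<open>The hypothesis says that \<open>P\<close> fixes the columns of \<open>L\<close>. For a
  projection \<open>P\<close> onto a hyperplane these may be any vectors of the hyperplane, so a
  bound for the projected tensor passes to every restriction to the hyperplane.\<close>

lemma sub_absorb:
  assumes "\<And>i a. a < d \<Longrightarrow> (\<Sum>b<d. P a b * L b i) = L a i"
  shows "sub1 d L (sub1 d P t) = sub1 d L t" "sub2 d L (sub2 d P t) = sub2 d L t"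
    "sub3 d L (sub3 d P t) = sub3 d L t"
proof -
  have *: "(\<Sum>b<d. L b i * (\<Sum>a<d. P a b * f a)) = (\<Sum>a<d. L a i * f a)" for i f
  proof -
    have "(\<Sum>b<d. L b i * (\<Sum>a<d. P a b * f a)) = (\<Sum>a<d. (\<Sum>b<d. P a b * L b i) * f a)"
      unfolding sum_distrib_left sum_distrib_right by (subst sum.swap) (simp add: mult_ac)
    also have "\<dots> = (\<Sum>a<d. L a i * f a)" using assms by (intro sum.cong) auto
    finally show ?thesis .
  qed
  show "sub1 d L (sub1 d P t) = sub1 d L t" "sub2 d L (sub2 d P t) = sub2 d L t"
    "sub3 d L (sub3 d P t) = sub3 d L t"
    unfolding sub1_def sub2_def sub3_def * by (rule refl)+
qed

text \<open>Restricting the first argument to the kernel of the first factor of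
  one rank-one summand removes that summand; along the approximating sequence the (normalised)
  kernels accumulate. Orthogonal projections with respect to the Hermitian form depend
  continuously on the hyperplane, which is why they appear here.\<close>

lemma border_substitution:
  assumes "border_rank_le d1 d2 d3 t (Suc r)" and "d1 > 0"
  shows "\<exists>y P. (\<exists>i<d1. y i \<noteq> 0) \<and>
    (\<forall>L. (\<Sum>a<d1. y a * L a) = 0 \<longrightarrow> (\<forall>a<d1. (\<Sum>b<d1. P a b * L b) = L a)) \<and>
    border_rank_le d1 d2 d3 (\<lambda>i j k. \<Sum>a<d1. P a i * t a j k) r"
proof -
  obtain S where S: "\<And>m. tensor_rank_le d1 d2 d3 (S m) (Suc r)"
    "\<And>i j k. i < d1 \<Longrightarrow> j < d2 \<Longrightarrow> k < d3 \<Longrightarrow> (\<lambda>m. S m i j k) \<longlonglongrightarrow> t i j k"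
    using assms(1) unfolding border_rank_le_def by blast
  have "\<forall>m. \<exists>u v w. \<forall>i<d1. \<forall>j<d2. \<forall>k<d3. S m i j k = (\<Sum>l<Suc r. u l i * v l j * w l k)"
    using S(1) unfolding tensor_rank_le_def by blast
  then obtain u v w where uvw: "\<And>m i j k. i<d1 \<Longrightarrow> j<d2 \<Longrightarrow> k<d3 \<Longrightarrow>
      S m i j k = (\<Sum>l<Suc r. u m l i * v m l j * w m l k)"
    unfolding choice_iff by blast
  have "\<exists>y c. (\<Sum>i<d1. y i * cnj (y i)) = 1 \<and> (\<forall>i<d1. u m r i = c * y i)" for m
  proof (cases "\<forall>i<d1. u m r i = 0")
    \<comment> \<open>A zero factor determines no direction; the first unit vector with
      \<open>c = 0\<close> serves, and it exists because \<open>d1 > 0\<close>.\<close>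
    case True
    have "(\<Sum>i<d1. (if i = 0 then 1 else 0) * cnj (if i = 0 then 1 else 0)) = (\<Sum>i<d1. if i = 0 then 1 else (0::complex))"
      by (rule sum.cong) auto
    also have "\<dots> = 1" using assms(2) by simp
    finally show ?thesis using True
      by (intro exI[of _ "\<lambda>i. if i = 0 then 1 else 0"] exI[of _ 0]) auto
  next
    case False
    define N where "N = (\<Sum>i<d1. (cmod (u m r i))\<^sup>2)"
    have "N > 0" using False unfolding N_def by (force intro!: sum_pos2)
    have "(\<Sum>i<d1. u m r i * cnj (u m r i)) = of_real N"
      unfolding N_def of_real_sum complex_norm_square ..
    moreover have "(\<Sum>i<d1. u m r i / sqrt N * cnj (u m r i / sqrt N)) = (\<Sum>i<d1. u m r i * cnj (u m r i)) / of_real N"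
      using \<open>N > 0\<close> by (simp add: sum_divide_distrib flip: of_real_mult)
    ultimately have "(\<Sum>i<d1. u m r i / sqrt N * cnj (u m r i / sqrt N)) = 1" using \<open>N > 0\<close> by simp
    moreover have "\<forall>i<d1. u m r i = of_real (sqrt N) * (u m r i / sqrt N)" using \<open>N > 0\<close> by simp
    ultimately show ?thesis
      by (intro exI[of _ "\<lambda>i. u m r i / sqrt N"] exI[of _ "of_real (sqrt N)"] conjI)
  qed
  then obtain y c where y: "\<And>m. (\<Sum>i<d1. y m i * cnj (y m i)) = 1"
    "\<And>m i. i < d1 \<Longrightarrow> u m r i = c m * y m i" by metis
  have bd: "norm (y m i) \<le> 1" if "i < d1" for m i
  proof -
    have "of_real (\<Sum>i<d1. (cmod (y m i))\<^sup>2) = (\<Sum>i<d1. y m i * cnj (y m i))"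
      unfolding of_real_sum complex_norm_square ..
    then have "(\<Sum>i<d1. (cmod (y m i))\<^sup>2) = 1" using y(1) by (metis of_real_eq_1_iff)
    then have "(cmod (y m i))\<^sup>2 \<le> 1"
      using member_le_sum[of i "{..<d1}" "\<lambda>i. (cmod (y m i))\<^sup>2"] that by simp
    then show ?thesis by (simp add: power_le_one_iff abs_square_le_1)
  qed
  have "bounded (range (\<lambda>m. y m i))" if "i \<in> {..<d1}" for i
    using bd that by (auto simp: bounded_iff intro!: exI[of _ 1])
  then obtain \<sigma> z where \<sigma>: "strict_mono (\<sigma>::nat \<Rightarrow> nat)" "\<And>i. i < d1 \<Longrightarrow> (\<lambda>m. y (\<sigma> m) i) \<longlonglongrightarrow> z i"
    using bounded_family_convergent_subseq[of "{..<d1}" y] by auto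
  \<comment> \<open>Norm one passes to the limit, so the limiting functional \<open>z\<close> still
    defines a hyperplane; this is the purpose of the normalisation.\<close>
  have "(\<lambda>m. \<Sum>i<d1. y (\<sigma> m) i * cnj (y (\<sigma> m) i)) \<longlonglongrightarrow> (\<Sum>i<d1. z i * cnj (z i))"
    by (intro tendsto_intros \<sigma>(2)) auto
  then have z1: "(\<Sum>i<d1. z i * cnj (z i)) = 1" using y(1) by (simp add: LIMSEQ_const_iff)
  \<comment> \<open>For \<open>z\<close> of norm one, \<open>P z\<close> fixes every vector killed
    by the functional \<open>z\<close>, while its transpose kills \<open>z\<close> itself. The first
    property yields the claim about \<open>L\<close>, the second deletes the last summand, whose
    first factor is a multiple of \<open>y m\<close>.\<close>
  define P where "P = (\<lambda>(z::nat\<Rightarrow>complex) a b. (if a = b then 1 else 0) - cnj (z a) * z b)"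
  have Psum: "(\<Sum>a<d1. P z a i * f a) = f i - z i * (\<Sum>a<d1. cnj (z a) * f a)" if "i < d1" for z f i
  proof -
    have "(\<Sum>a<d1. P z a i * f a) = (\<Sum>a<d1. (if a = i then f a else 0) - z i * (cnj (z a) * f a))"
      by (rule sum.cong) (auto simp: P_def algebra_simps)
    also have "\<dots> = f i - z i * (\<Sum>a<d1. cnj (z a) * f a)"
      using that by (simp add: sum_subtractf sum_distrib_left)
    finally show ?thesis .
  qed
  have "\<exists>i<d1. z i \<noteq> 0" using z1 by (metis (no_types, lifting) lessThan_iff mult_zero_left sum.neutral zero_neq_one)
  moreover have "(\<Sum>b<d1. P z a b * L b) = L a" if "(\<Sum>a<d1. z a * L a) = 0" "a < d1" for L a
  proof -
    have "(\<Sum>b<d1. P z a b * L b) = (\<Sum>b<d1. (if b = a then L b else 0) - cnj (z a) * (z b * L b))"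
      by (rule sum.cong) (auto simp: P_def algebra_simps)
    also have "\<dots> = L a" using that by (simp add: sum_subtractf flip: sum_distrib_left)
    finally show ?thesis .
  qed
  moreover have "border_rank_le d1 d2 d3 (\<lambda>i j k. \<Sum>a<d1. P z a i * t a j k) r"
    unfolding border_rank_le_def
  proof (intro exI conjI allI impI)
    fix m
    show "tensor_rank_le d1 d2 d3 (\<lambda>i j k. \<Sum>a<d1. P (y (\<sigma> m)) a i * S (\<sigma> m) a j k) r"
      unfolding tensor_rank_le_def
    proof (intro exI allI impI)
      fix i j k assume ijk: "i < d1" "j < d2" "k < d3"
      let ?m = "\<sigma> m"
      have "(\<Sum>a<d1. P (y ?m) a i * S ?m a j k) =
          (\<Sum>a<d1. \<Sum>l<Suc r. (P (y ?m) a i * u ?m l a) * v ?m l j * w ?m l k)"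
        using uvw ijk by (intro sum.cong) (auto simp: sum_distrib_left mult_ac distrib_left simp del: sum.lessThan_Suc)
      also have "\<dots> = (\<Sum>l<Suc r. (\<Sum>a<d1. P (y ?m) a i * u ?m l a) * v ?m l j * w ?m l k)"
        by (subst sum.swap) (simp add: sum_distrib_right)
      also have "(\<Sum>a<d1. P (y ?m) a i * u ?m r a) = 0"
      proof -
        have "(\<Sum>a<d1. cnj (y ?m a) * u ?m r a) = c ?m * (\<Sum>a<d1. y ?m a * cnj (y ?m a))"
          unfolding sum_distrib_left by (rule sum.cong) (auto simp: y(2))
        then show ?thesis using ijk y by (simp add: Psum)
      qed
      then have "(\<Sum>l<Suc r. (\<Sum>a<d1. P (y ?m) a i * u ?m l a) * v ?m l j * w ?m l k) =
         (\<Sum>l<r. (\<Sum>a<d1. P (y ?m) a i * u ?m l a) * v ?m l j * w ?m l k)" by simp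
      finally show "(\<Sum>a<d1. P (y ?m) a i * S ?m a j k) =
         (\<Sum>l<r. (\<Sum>a<d1. P (y ?m) a i * u ?m l a) * v ?m l j * w ?m l k)" .
    qed
  next
    fix i j k assume ijk: "i < d1" "j < d2" "k < d3"
    have "(\<lambda>m. S (\<sigma> m) a j k) \<longlonglongrightarrow> t a j k" if "a < d1" for a
      using LIMSEQ_subseq_LIMSEQ[OF S(2) \<sigma>(1)] that ijk by (simp add: o_def)
    then show "(\<lambda>m. \<Sum>a<d1. P (y (\<sigma> m)) a i * S (\<sigma> m) a j k) \<longlonglongrightarrow> (\<Sum>a<d1. P z a i * t a j k)"
      unfolding P_def using ijk by (intro tendsto_intros \<sigma>(2)) auto
  qed
  ultimately show ?thesis by blast
qed

text \<open>The three functionals are not controlled, and each depends on the choices before it. The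
  quantification over all \<open>L1\<close>, \<open>L2\<close>, \<open>L3\<close> with columns in
  the hyperplanes leaves the later proof free to choose its own parametrisations.\<close>

lemma border_substitution3:
  assumes "border_rank_le d d d t (r + 3)" and "d > 0"
  shows "\<exists>y1 y2 y3. (\<exists>i<d. y1 i \<noteq> 0) \<and> (\<exists>i<d. y2 i \<noteq> 0) \<and> (\<exists>i<d. y3 i \<noteq> 0) \<and>
    (\<forall>L1 L2 L3. (\<forall>i. (\<Sum>a<d. y1 a * L1 a i) = 0) \<and> (\<forall>i. (\<Sum>a<d. y2 a * L2 a i) = 0) \<and>
      (\<forall>i. (\<Sum>a<d. y3 a * L3 a i) = 0) \<longrightarrow>
      border_rank_le d d d (sub1 d L1 (sub2 d L2 (sub3 d L3 t))) r)"
proof -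
  have "border_rank_le d d d t (Suc (Suc (Suc r)))" using assms(1) by (simp add: eval_nat_numeral)
  then obtain y1 P1 where 1: "\<exists>i<d. y1 i \<noteq> 0"
    "\<forall>L. (\<Sum>a<d. y1 a * L a) = 0 \<longrightarrow> (\<forall>a<d. (\<Sum>b<d. P1 a b * L b) = L a)"
    "border_rank_le d d d (sub1 d P1 t) (Suc (Suc r))"
    using border_substitution[OF _ assms(2)] unfolding sub1_def by blast
  obtain y2 P2 where 2: "\<exists>i<d. y2 i \<noteq> 0"
    "\<forall>L. (\<Sum>a<d. y2 a * L a) = 0 \<longrightarrow> (\<forall>a<d. (\<Sum>b<d. P2 a b * L b) = L a)"
    "border_rank_le d d d (\<lambda>j k i. \<Sum>b<d. P2 b j * sub1 d P1 t i b k) (Suc r)"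
    using border_substitution[OF border_rank_le_rotate[OF 1(3)] assms(2)] by blast
  obtain y3 P3 where 3: "\<exists>i<d. y3 i \<noteq> 0"
    "\<forall>L. (\<Sum>a<d. y3 a * L a) = 0 \<longrightarrow> (\<forall>a<d. (\<Sum>b<d. P3 a b * L b) = L a)"
    "border_rank_le d d d (\<lambda>k i j. \<Sum>c<d. P3 c k * (\<Sum>b<d. P2 b j * sub1 d P1 t i b c)) r"
    using border_substitution[OF border_rank_le_rotate[OF 2(3)] assms(2)] by blast
  have br: "border_rank_le d d d (sub3 d P3 (sub2 d P2 (sub1 d P1 t))) r"
    using border_rank_le_rotate[OF 3(3)] unfolding sub2_def sub3_def .
  have "border_rank_le d d d (sub1 d L1 (sub2 d L2 (sub3 d L3 t))) r"
    if "\<And>i. (\<Sum>a<d. y1 a * L1 a i) = 0" "\<And>i. (\<Sum>a<d. y2 a * L2 a i) = 0"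
      "\<And>i. (\<Sum>a<d. y3 a * L3 a i) = 0" for L1 L2 L3
  proof -
    have "sub1 d L1 (sub2 d L2 (sub3 d L3 (sub3 d P3 (sub2 d P2 (sub1 d P1 t))))) =
        sub1 d L1 (sub2 d L2 (sub3 d L3 t))"
      using 1(2)[rule_format, OF that(1)] 2(2)[rule_format, OF that(2)] 3(2)[rule_format, OF that(3)]
      by (simp add: sub_absorb sub_commute)
    then show ?thesis
      using border_rank_le_sub1[OF border_rank_le_sub2[OF border_rank_le_sub3[OF br]]] by metis
  qed
  with 1(1) 2(1) 3(1) show ?thesis by (intro exI[of _ y1] exI[of _ y2] exI[of _ y3]) simp
qed

text \<open>One summand per pair \<open>(i, j)\<close>, coded as \<open>i * d2 + j\<close>. This
  makes the \<open>LEAST\<close> in \<open>border_rank\<close> an attained minimum.\<close>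

lemma tensor_rank_le_trivial: "tensor_rank_le d1 d2 d3 t (d1 * d2)"
  unfolding tensor_rank_le_def
proof (intro exI allI impI)
  fix i j k assume ijk: "i < d1" "j < d2" "k < d3"
  have lt: "i * d2 + j < d1 * d2"
  proof -
    have "i * d2 + j < Suc i * d2" using ijk by simp
    also have "\<dots> \<le> d1 * d2" using ijk by (intro mult_le_mono1) simp
    finally show ?thesis .
  qed
  have "(\<Sum>l<d1 * d2. (if l div d2 = i then 1 else 0) * (if l mod d2 = j then 1 else 0) * t (l div d2) (l mod d2) k)
      = (\<Sum>l<d1 * d2. if l = i * d2 + j then t i j k else 0)"
  proof (rule sum.cong[OF refl])
    fix l
    have "l = i * d2 + j \<longleftrightarrow> l div d2 = i \<and> l mod d2 = j"
      using ijk by (auto simp: div_mult_mod_eq)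
    then show "(if l div d2 = i then 1 else 0) * (if l mod d2 = j then 1 else 0) * t (l div d2) (l mod d2) k =
      (if l = i * d2 + j then t i j k else 0)" by auto
  qed
  also have "\<dots> = t i j k" using lt by simp
  finally show "t i j k = (\<Sum>l<d1 * d2. (if l div d2 = i then 1 else 0) * (if l mod d2 = j then 1 else 0) *
      t (l div d2) (l mod d2) k)" ..
qed

lemma border_rank_le_border_rank: "border_rank_le d1 d2 d3 t (border_rank d1 d2 d3 t)"
  unfolding border_rank_def
proof (rule LeastI)
  show "border_rank_le d1 d2 d3 t (d1 * d2)"
    unfolding border_rank_le_def using tensor_rank_le_trivial
    by (intro exI[of _ "\<lambda>_. t"]) auto
qed

section \<open>Koszul flattenings\<close>

text \<open>The alternating extension of the values on increasing triples, zero on repeated indices.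
  It turns the coordinates of a trivector into a function for which the sign rules hold without case
  distinctions on the order.\<close>

definition alt3 :: "(nat \<Rightarrow> nat \<Rightarrow> nat \<Rightarrow> complex) \<Rightarrow> nat \<Rightarrow> nat \<Rightarrow> nat \<Rightarrow> complex" where
  "alt3 f a b c =
    (if a < b \<and> b < c then f a b c else if a < c \<and> c < b then - f a c b
     else if b < a \<and> a < c then - f b a c else if b < c \<and> c < a then f b c a
     else if c < a \<and> a < b then f c a b else if c < b \<and> b < a then - f c b a else 0)"

text \<open>The coordinate of \<open>u \<and> f\<close> at \<open>a, b, c, d\<close>, for a vector
  \<open>u\<close> and a trivector \<open>f\<close>.\<close>

definition wedge3 :: "(nat \<Rightarrow> complex) \<Rightarrow> (nat \<Rightarrow> nat \<Rightarrow> nat \<Rightarrow> complex) \<Rightarrow> nat \<Rightarrow> nat \<Rightarrow> nat \<Rightarrow> nat \<Rightarrow> complex" where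
  "wedge3 u f a b c d = u a * f b c d - u b * f a c d + u c * f a b d - u d * f a b c"

definition triples_avoiding :: "nat \<Rightarrow> (nat \<times> nat \<times> nat) set" where
  "triples_avoiding i = {(b, c, d). b < c \<and> c < d \<and> d < 7 \<and> b \<noteq> i \<and> c \<noteq> i \<and> d \<noteq> i}"

lemma alt3_sorted: "a < b \<Longrightarrow> b < c \<Longrightarrow> alt3 f a b c = f a b c"
  by (simp add: alt3_def)

lemma alt3_swap12: "alt3 f b a c = - alt3 f a b c"
  by (cases a b rule: linorder_cases; cases b c rule: linorder_cases; cases a c rule: linorder_cases)
    (auto simp: alt3_def)

lemma alt3_swap23: "alt3 f a c b = - alt3 f a b c"
  by (cases a b rule: linorder_cases; cases b c rule: linorder_cases; cases a c rule: linorder_cases)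
    (auto simp: alt3_def)

lemma alt3_linear:
  "alt3 (\<lambda>b c d. \<Sum>\<kappa>\<in>X. x \<kappa> * g \<kappa> b c d) b c d = (\<Sum>\<kappa>\<in>X. x \<kappa> * alt3 (g \<kappa>) b c d)"
  by (auto simp: alt3_def sum_negf)

lemma wedge3_sum_left:
  "wedge3 (\<lambda>a. \<Sum>l\<in>I. c l * u l a) f a b e d = (\<Sum>l\<in>I. c l * wedge3 (u l) f a b e d)"
  by (simp add: wedge3_def sum_distrib_right sum.distrib sum_subtractf right_diff_distrib
      distrib_left mult.assoc)

lemma wedge3_sum_right:
  "wedge3 u (\<lambda>b e d. \<Sum>l\<in>I. c l * f l b e d) a b e d = (\<Sum>l\<in>I. c l * wedge3 u (f l) a b e d)"
  by (simp add: wedge3_def sum_distrib_left sum.distrib sum_subtractf right_diff_distrib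
      distrib_left mult.left_commute)

lemma wedge3_linear:
  "wedge3 u (alt3 (\<lambda>b c d. \<Sum>\<kappa>\<in>X. x \<kappa> * g \<kappa> b c d)) a b c d =
    (\<Sum>\<kappa>\<in>X. wedge3 u (alt3 (g \<kappa>)) a b c d * x \<kappa>)"
  by (simp add: alt3_linear[abs_def] wedge3_sum_right mult.commute)

lemma wedge3_swap12: "wedge3 u (alt3 f) b a c d = - wedge3 u (alt3 f) a b c d"
  unfolding wedge3_def using alt3_swap12[of f b a] by simp

lemma wedge3_swap23: "wedge3 u (alt3 f) a c b d = - wedge3 u (alt3 f) a b c d"
  unfolding wedge3_def using alt3_swap12[of f c b d] alt3_swap23[of f a c b] by simp

lemma wedge3_swap34: "wedge3 u (alt3 f) a b d c = - wedge3 u (alt3 f) a b c d"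
  unfolding wedge3_def using alt3_swap23[of f a c d] alt3_swap23[of f b c d] by simp

text \<open>The kernel of \<open>u \<and> _\<close> on third exterior powers of a 7-dimensional space is cut out by
  only 20 of the 35 coordinates, because \<open>u \<and> u = 0\<close>.\<close>

lemma wedge3_eq_0:
  assumes "u i \<noteq> 0" and 0: "\<And>b c d. (b, c, d) \<in> triples_avoiding i \<Longrightarrow> wedge3 u (alt3 f) i b c d = 0"
    and abcd: "a < b" "b < c" "c < d" "d < 7"
  shows "wedge3 u (alt3 f) a b c d = 0"
proof -
  consider "i = a" | "i = b" | "i = c" | "i = d" | "i \<notin> {a,b,c,d}" by blast
  then show ?thesis
  proof cases
    case 1
    then show ?thesis using 0[of b c d] abcd by (simp add: triples_avoiding_def)
  next
    case 2
    then show ?thesis using 0[of a c d] abcd wedge3_swap12[of u f a b c d]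
      by (simp add: triples_avoiding_def)
  next
    case 3
    then show ?thesis
      using 0[of a b d] abcd wedge3_swap23[of u f a b c d] wedge3_swap12[of u f a c b d]
      by (simp add: triples_avoiding_def)
  next
    case 4
    then show ?thesis
      using 0[of a b c] abcd wedge3_swap34[of u f a b c d] wedge3_swap23[of u f a b d c]
        wedge3_swap12[of u f a d b c]
      by (simp add: triples_avoiding_def)
  next
    case 5
    \<comment> \<open>This is the coordinate at \<open>i, a, b, c, d\<close> of the identity
      \<open>u \<and> (u \<and> f) = 0\<close>.\<close>
    have "u i * wedge3 u (alt3 f) a b c d = u a * wedge3 u (alt3 f) i b c d
        - u b * wedge3 u (alt3 f) i a c d + u c * wedge3 u (alt3 f) i a b d - u d * wedge3 u (alt3 f) i a b c"
      unfolding wedge3_def by (simp add: algebra_simps)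
    also have "\<dots> = 0"
      using 0[of b c d] 0[of a c d] 0[of a b d] 0[of a b c] 5 abcd by (simp add: triples_avoiding_def)
    finally show ?thesis using \<open>u i \<noteq> 0\<close> by simp
  qed
qed

lemma card_triples_avoiding:
  assumes "i < 7"
  shows "finite (triples_avoiding i)" "card (triples_avoiding i) = 20"
proof -
  let ?l = "filter (\<lambda>(b, c, d). b < c \<and> c < d \<and> b \<noteq> i \<and> c \<noteq> i \<and> d \<noteq> i)
    (List.product [0..<7] (List.product [0..<7] [0..<7]))"
  have s: "triples_avoiding i = set ?l"
    by (auto simp: triples_avoiding_def)
  show "finite (triples_avoiding i)" unfolding s by simp
  have "\<forall>i\<in>set [0..<7]. length (filter (\<lambda>(b, c, d). b < c \<and> c < d \<and> b \<noteq> i \<and> c \<noteq> i \<and> d \<noteq> i)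
    (List.product [0..<7] (List.product [0..<7] [0..<7]))) = 20" by code_simp
  then have "length ?l = 20" using assms by simp
  moreover have "distinct ?l" by (intro distinct_filter distinct_product) simp_all
  ultimately show "card (triples_avoiding i) = 20" unfolding s by (simp only: distinct_card)
qed

text \<open>For a summand \<open>u \<otimes> v \<otimes> w\<close> the flattening contracts the
  unknown with \<open>v\<close>, wedges the resulting trivector with the restriction of
  \<open>u\<close> to the seven directions, and multiplies by \<open>w\<close>. It is enough that
  each of the \<open>r\<close> wedges vanishes, which costs 20 linear equations apiece.
  \<open>A\<close> holds the directions, \<open>key\<close> names the coordinates, and coordinates
  named outside \<open>X\<close> are read as zero.\<close>

lemma koszul_kernel_rank:
  fixes A :: "nat \<Rightarrow> nat \<Rightarrow> complex" and key :: "nat \<Rightarrow> nat \<Rightarrow> nat \<Rightarrow> nat \<Rightarrow> 'x"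
  assumes "tensor_rank_le d1 d2 d3 t r" "finite X" "20 * r < card X"
  shows "\<exists>x. (\<Sum>\<kappa>\<in>X. cmod (x \<kappa>)) = 1 \<and> (\<forall>\<kappa>. \<kappa> \<notin> X \<longrightarrow> x \<kappa> = 0) \<and>
    (\<forall>a b c d k. a < b \<and> b < c \<and> c < d \<and> d < 7 \<and> k < d3 \<longrightarrow>
      (\<Sum>j<d2. wedge3 (\<lambda>a. \<Sum>i<d1. A a i * t i j k) (\<lambda>b c d. x (key b c d j)) a b c d) = 0)"
proof -
  obtain u v w where uvw: "\<And>i j k. i<d1 \<Longrightarrow> j<d2 \<Longrightarrow> k<d3 \<Longrightarrow> t i j k = (\<Sum>l<r. u l i * v l j * w l k)"
    using assms(1) unfolding tensor_rank_le_def by blast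
  define U where "U = (\<lambda>l a. \<Sum>i<d1. A a i * u l i)"
  \<comment> \<open>\<open>g l \<kappa>\<close> is the trivector with which the unknown
    \<open>\<kappa>\<close> enters the contraction of \<open>x\<close> with \<open>v l\<close>; the
    contraction itself is \<open>f l\<close> below.\<close>
  define g where "g = (\<lambda>l \<kappa> b c d. \<Sum>j<d2. if key b c d j = \<kappa> then v l j else 0)"
  \<comment> \<open>The pivot of \<open>U l\<close>. If all seven entries are zero the wedge
    vanishes anyway; the default 0 keeps the pivot below 7, so that every summand contributes
    exactly 20 equations.\<close>
  define i where "i = (\<lambda>l. if \<exists>a<7. U l a \<noteq> 0 then SOME a. a < 7 \<and> U l a \<noteq> 0 else 0)"
  have i: "i l < 7" "\<exists>a<7. U l a \<noteq> 0 \<Longrightarrow> U l (i l) \<noteq> 0" for l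
    unfolding i_def using someI_ex[of "\<lambda>a. a < 7 \<and> U l a \<noteq> 0"] by auto
  define E where "E = Sigma {..<r} (\<lambda>l. triples_avoiding (i l))"
  have E: "finite E" "card E = 20 * r"
    using i(1) card_triples_avoiding by (auto simp: E_def)
  define M where "M = (\<lambda>(l, b, c, d) \<kappa>. wedge3 (U l) (alt3 (g l \<kappa>)) (i l) b c d)"
  obtain y where y: "\<exists>\<kappa>\<in>X. y \<kappa> \<noteq> 0" "\<And>e. e \<in> E \<Longrightarrow> (\<Sum>\<kappa>\<in>X. M e \<kappa> * y \<kappa>) = 0"
    using underdetermined_system_nontrivial[of E X M] E assms by auto
  define N where "N = (\<Sum>\<kappa>\<in>X. cmod (y \<kappa>))"
  have "N > 0" using y(1) assms(2) unfolding N_def by (auto intro!: sum_pos2)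
  define x where "x = (\<lambda>\<kappa>. if \<kappa> \<in> X then y \<kappa> / N else 0)"
  have x1: "(\<Sum>\<kappa>\<in>X. cmod (x \<kappa>)) = 1"
  proof -
    have "(\<Sum>\<kappa>\<in>X. cmod (x \<kappa>)) = (\<Sum>\<kappa>\<in>X. cmod (y \<kappa>) / N)"
      using \<open>N > 0\<close> by (intro sum.cong) (auto simp: x_def norm_divide)
    also have "\<dots> = N / N" by (simp only: sum_divide_distrib[symmetric] N_def[symmetric])
    finally show ?thesis using \<open>N > 0\<close> by simp
  qed
  have xE: "(\<Sum>\<kappa>\<in>X. M e \<kappa> * x \<kappa>) = 0" if "e \<in> E" for e
    using y(2)[OF that] by (simp add: x_def flip: sum_divide_distrib)
  have xkey: "x (key b c d j) = (\<Sum>\<kappa>\<in>X. x \<kappa> * (if key b c d j = \<kappa> then 1 else 0))" for b c d j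
  proof -
    have "(\<Sum>\<kappa>\<in>X. x \<kappa> * (if key b c d j = \<kappa> then 1 else 0)) = (\<Sum>\<kappa>\<in>X. if key b c d j = \<kappa> then x \<kappa> else 0)"
      by (rule sum.cong) auto
    also have "\<dots> = (if key b c d j \<in> X then x (key b c d j) else 0)"
      using assms(2) by (rule sum.delta')
    finally show ?thesis by (simp add: x_def)
  qed
  define f where "f = (\<lambda>l b c d. \<Sum>\<kappa>\<in>X. x \<kappa> * g l \<kappa> b c d)"
  have f: "f l b c d = (\<Sum>j<d2. v l j * x (key b c d j))" for l b c d
  proof -
    have "f l b c d = (\<Sum>j<d2. \<Sum>\<kappa>\<in>X. v l j * (x \<kappa> * (if key b c d j = \<kappa> then 1 else 0)))"
      unfolding f_def g_def sum_distrib_left by (subst sum.swap) (intro sum.cong, auto)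
    then show ?thesis by (simp only: xkey sum_distrib_left)
  qed
  have W0: "wedge3 (U l) (f l) a b c d = 0" if l: "l < r" and abcd: "a < b" "b < c" "c < d" "d < 7" for l a b c d
  proof -
    have "wedge3 (U l) (alt3 (f l)) a b c d = 0"
    proof (cases "\<exists>a<7. U l a \<noteq> 0")
      case True
      have "wedge3 (U l) (alt3 (f l)) (i l) b c d = 0" if "(b,c,d) \<in> triples_avoiding (i l)" for b c d
        using xE[of "(l,b,c,d)"] l that unfolding f_def wedge3_linear by (simp add: E_def M_def)
      from wedge3_eq_0[OF i(2)[OF True] this abcd] show ?thesis by simp
    next
      case False
      then show ?thesis using abcd by (simp add: wedge3_def)
    qed
    then show ?thesis using abcd by (simp add: wedge3_def alt3_sorted)
  qed
  have "(\<Sum>j<d2. wedge3 (\<lambda>a. \<Sum>i<d1. A a i * t i j k) (\<lambda>b c d. x (key b c d j)) a b c d) = 0"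
    if abcd: "a < b" "b < c" "c < d" "d < 7" "k < d3" for a b c d k
  proof -
    have sl: "(\<Sum>i<d1. A a i * t i j k) = (\<Sum>l<r. U l a * v l j * w l k)" if "j < d2" for a j
    proof -
      have "(\<Sum>i<d1. A a i * t i j k) = (\<Sum>i<d1. \<Sum>l<r. A a i * u l i * v l j * w l k)"
        using uvw that \<open>k < d3\<close> by (intro sum.cong) (auto simp: sum_distrib_left mult_ac)
      also have "\<dots> = (\<Sum>l<r. U l a * v l j * w l k)"
        by (subst sum.swap) (simp add: U_def sum_distrib_right)
      finally show ?thesis .
    qed
    have "(\<Sum>j<d2. wedge3 (\<lambda>a. \<Sum>i<d1. A a i * t i j k) (\<lambda>b c d. x (key b c d j)) a b c d) =
      (\<Sum>j<d2. \<Sum>l<r. v l j * w l k * wedge3 (U l) (\<lambda>b c d. x (key b c d j)) a b c d)"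
    proof (rule sum.cong[OF refl])
      fix j assume "j \<in> {..<d2}"
      then have "wedge3 (\<lambda>a. \<Sum>i<d1. A a i * t i j k) (\<lambda>b c d. x (key b c d j)) a b c d =
        wedge3 (\<lambda>a. \<Sum>l<r. (v l j * w l k) * U l a) (\<lambda>b c d. x (key b c d j)) a b c d"
        by (simp add: wedge3_def sl mult_ac)
      then show "wedge3 (\<lambda>a. \<Sum>i<d1. A a i * t i j k) (\<lambda>b c d. x (key b c d j)) a b c d =
        (\<Sum>l<r. v l j * w l k * wedge3 (U l) (\<lambda>b c d. x (key b c d j)) a b c d)"
        by (simp only: wedge3_sum_left)
    qed
    also have "\<dots> = (\<Sum>l<r. w l k * (\<Sum>j<d2. v l j * wedge3 (U l) (\<lambda>b c d. x (key b c d j)) a b c d))"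
      by (subst sum.swap) (simp add: sum_distrib_left mult_ac)
    also have "\<dots> = (\<Sum>l<r. w l k * wedge3 (U l) (f l) a b c d)"
      by (simp only: wedge3_sum_right[symmetric] f[abs_def])
    also have "\<dots> = 0" using W0 abcd by simp
    finally show ?thesis .
  qed
  moreover have "\<forall>\<kappa>. \<kappa> \<notin> X \<longrightarrow> x \<kappa> = 0" by (simp add: x_def)
  ultimately show ?thesis using x1 by blast
qed

text \<open>Having a non-zero kernel vector is a closed condition: kernel vectors of norm one along
  the approximating sequence accumulate at a kernel vector of norm one for the limit, and the
  support in \<open>X\<close> is preserved.\<close>

lemma koszul_kernel:
  fixes A :: "nat \<Rightarrow> nat \<Rightarrow> complex" and key :: "nat \<Rightarrow> nat \<Rightarrow> nat \<Rightarrow> nat \<Rightarrow> 'x"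
  assumes "border_rank_le d1 d2 d3 t r" "finite X" "20 * r < card X"
  shows "\<exists>x. (\<exists>\<kappa>\<in>X. x \<kappa> \<noteq> 0) \<and> (\<forall>\<kappa>. \<kappa> \<notin> X \<longrightarrow> x \<kappa> = 0) \<and>
    (\<forall>a b c d k. a < b \<and> b < c \<and> c < d \<and> d < 7 \<and> k < d3 \<longrightarrow>
      (\<Sum>j<d2. wedge3 (\<lambda>a. \<Sum>i<d1. A a i * t i j k) (\<lambda>b c d. x (key b c d j)) a b c d) = 0)"
proof -
  obtain S where S: "\<And>m. tensor_rank_le d1 d2 d3 (S m) r"
    "\<And>i j k. i < d1 \<Longrightarrow> j < d2 \<Longrightarrow> k < d3 \<Longrightarrow> (\<lambda>m. S m i j k) \<longlonglongrightarrow> t i j k"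
    using assms(1) unfolding border_rank_le_def by blast
  define K where "K = (\<lambda>s x. \<forall>a b c d k. a < b \<and> b < c \<and> c < d \<and> d < 7 \<and> k < d3 \<longrightarrow>
      (\<Sum>j<d2. wedge3 (\<lambda>a. \<Sum>i<d1. A a i * s i j k) (\<lambda>b c d. x (key b c d j)) a b c d) = 0)"
  have "\<exists>x. (\<Sum>\<kappa>\<in>X. cmod (x \<kappa>)) = 1 \<and> (\<forall>\<kappa>. \<kappa> \<notin> X \<longrightarrow> x \<kappa> = 0) \<and> K (S m) x" for m
    unfolding K_def by (rule koszul_kernel_rank[OF S(1) assms(2,3)])
  then obtain x where x: "\<And>m. (\<Sum>\<kappa>\<in>X. cmod (x m \<kappa>)) = 1" "\<And>m \<kappa>. \<kappa> \<notin> X \<Longrightarrow> x m \<kappa> = 0"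
    "\<And>m. K (S m) (x m)" by metis
  have "norm (x m \<kappa>) \<le> 1" if "\<kappa> \<in> X" for m \<kappa>
    using member_le_sum[of \<kappa> X "\<lambda>\<kappa>. cmod (x m \<kappa>)"] that x(1)[of m] assms(2) by simp
  then have "bounded (range (\<lambda>m. x m \<kappa>))" if "\<kappa> \<in> X" for \<kappa>
    using that by (auto simp: bounded_iff intro!: exI[of _ 1])
  then obtain \<sigma> z where \<sigma>: "strict_mono (\<sigma>::nat \<Rightarrow> nat)" "\<And>\<kappa>. \<kappa> \<in> X \<Longrightarrow> (\<lambda>m. x (\<sigma> m) \<kappa>) \<longlonglongrightarrow> z \<kappa>"
    using bounded_family_convergent_subseq[of X x] assms(2) by blast
  define y where "y = (\<lambda>\<kappa>. if \<kappa> \<in> X then z \<kappa> else 0)"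
  have y: "(\<lambda>m. x (\<sigma> m) \<kappa>) \<longlonglongrightarrow> y \<kappa>" for \<kappa>
    using \<sigma>(2) x(2) by (simp add: y_def)
  have "(\<lambda>m. \<Sum>\<kappa>\<in>X. cmod (x (\<sigma> m) \<kappa>)) \<longlonglongrightarrow> (\<Sum>\<kappa>\<in>X. cmod (y \<kappa>))"
    by (intro tendsto_sum tendsto_norm y)
  then have "(\<Sum>\<kappa>\<in>X. cmod (y \<kappa>)) = 1" using x(1) by (simp add: LIMSEQ_const_iff)
  then have "\<exists>\<kappa>\<in>X. y \<kappa> \<noteq> 0" by (metis norm_zero sum.neutral zero_neq_one)
  moreover have "(\<Sum>j<d2. wedge3 (\<lambda>a. \<Sum>i<d1. A a i * t i j k) (\<lambda>b c d. y (key b c d j)) a b c d) = 0"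
    if abcd: "a < b" "b < c" "c < d" "d < 7" "k < d3" for a b c d k
  proof -
    have "(\<lambda>m. S (\<sigma> m) i j k) \<longlonglongrightarrow> t i j k" if "i < d1" "j < d2" for i j
      using LIMSEQ_subseq_LIMSEQ[OF S(2) \<sigma>(1)] that abcd by (simp add: o_def)
    then have "(\<lambda>m. \<Sum>j<d2. wedge3 (\<lambda>a. \<Sum>i<d1. A a i * S (\<sigma> m) i j k) (\<lambda>b c d. x (\<sigma> m) (key b c d j)) a b c d)
      \<longlonglongrightarrow> (\<Sum>j<d2. wedge3 (\<lambda>a. \<Sum>i<d1. A a i * t i j k) (\<lambda>b c d. y (key b c d j)) a b c d)"
      unfolding wedge3_def
      by (intro tendsto_sum tendsto_add tendsto_diff tendsto_mult tendsto_const y) auto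
    moreover have "(\<Sum>j<d2. wedge3 (\<lambda>a. \<Sum>i<d1. A a i * S m i j k) (\<lambda>b c d. x m (key b c d j)) a b c d) = 0" for m
      using x(3)[of m] abcd unfolding K_def by blast
    ultimately show ?thesis by (simp add: LIMSEQ_const_iff)
  qed
  moreover have "\<forall>\<kappa>. \<kappa> \<notin> X \<longrightarrow> y \<kappa> = 0" by (simp add: y_def)
  ultimately show ?thesis by blast
qed

section \<open>The invariant form on sl(4)\<close>

abbreviation basis_mat :: "nat \<Rightarrow> nat \<Rightarrow> nat \<Rightarrow> complex" where
  "basis_mat k \<equiv> sl_basis 4 ! k"

lemma sl_basis_4: "sl_basis 4 = [elem_mat 0 1, elem_mat 0 2, elem_mat 0 3, elem_mat 1 0,
    elem_mat 1 2, elem_mat 1 3, elem_mat 2 0, elem_mat 2 1, elem_mat 2 3, elem_mat 3 0,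
    elem_mat 3 1, elem_mat 3 2, (\<lambda>a b. elem_mat 0 0 a b - elem_mat 1 1 a b),
    (\<lambda>a b. elem_mat 1 1 a b - elem_mat 2 2 a b), (\<lambda>a b. elem_mat 2 2 a b - elem_mat 3 3 a b)]"
  by (simp add: sl_basis_def upt_rec numeral_2_eq_2[symmetric] numeral_3_eq_3[symmetric])

lemma sl_dim_4: "sl_dim 4 = 15"
  by (simp add: sl_dim_def sl_basis_4)

lemma lessThan_15: "{..<15::nat} = {0,1,2,3,4,5,6,7,8,9,10,11,12,13,14}"
  unfolding set_eq_iff lessThan_iff insert_iff empty_iff by presburger

lemma lessThan_4: "{..<4::nat} = {0,1,2,3}"
  by auto

text \<open>The coefficients along the differences of consecutive diagonal units are the partial
  sums of the diagonal.\<close>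

definition mat_coords :: "(nat \<Rightarrow> nat \<Rightarrow> complex) \<Rightarrow> nat \<Rightarrow> complex" where
  "mat_coords M k = (if k < 15 then [M 0 1, M 0 2, M 0 3, M 1 0, M 1 2, M 1 3, M 2 0, M 2 1, M 2 3,
     M 3 0, M 3 1, M 3 2, M 0 0, M 0 0 + M 1 1, M 0 0 + M 1 1 + M 2 2] ! k else 0)"

lemma mat_coords_expansion:
  assumes "M 0 0 + M 1 1 + M 2 2 + M 3 3 = 0" "a < 4" "b < 4"
  shows "(\<Sum>k<15. mat_coords M k * basis_mat k a b) = M a b"
proof -
  have "M 3 3 = - (M 0 0 + M 1 1 + M 2 2)"
    using assms(1) by (simp only: add_eq_0_iff)
  moreover have "a \<in> {0,1,2,3}" "b \<in> {0,1,2,3}" using assms by auto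
  ultimately show ?thesis
    unfolding sl_basis_4 lessThan_15 by (auto simp: mat_coords_def elem_mat_def)
qed

text \<open>The definite description in \<open>sl_coords\<close> has a witness only for traceless
  matrices; it is applied to brackets, which are traceless.\<close>

lemma sl_coords_4:
  assumes "M 0 0 + M 1 1 + M 2 2 + M 3 3 = 0"
  shows "sl_coords 4 M = mat_coords M"
  unfolding sl_coords_def sl_dim_4
proof (rule the_equality)
  show "(\<forall>k\<ge>15. mat_coords M k = 0) \<and> (\<forall>a<4. \<forall>b<4. M a b = (\<Sum>k<15. mat_coords M k * basis_mat k a b))"
    using mat_coords_expansion[of M, OF assms] by (simp add: mat_coords_def)
next
  fix c assume c: "(\<forall>k\<ge>15. c k = 0) \<and> (\<forall>a<4. \<forall>b<4. M a b = (\<Sum>k<15. c k * basis_mat k a b))"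
  then have e: "M a b = (\<Sum>k<15. c k * basis_mat k a b)" if "a < 4" "b < 4" for a b using that by blast
  show "c = mat_coords M"
  proof
    fix k
    show "c k = mat_coords M k"
    proof (cases "k < 15")
      case True
      then have "k \<in> {0,1,2,3,4,5,6,7,8,9,10,11,12,13,14}"
        using lessThan_15 lessThan_iff by blast
      moreover have "mat_coords M k = [M 0 1, M 0 2, M 0 3, M 1 0, M 1 2, M 1 3, M 2 0, M 2 1, M 2 3,
          M 3 0, M 3 1, M 3 2, M 0 0, M 0 0 + M 1 1, M 0 0 + M 1 1 + M 2 2] ! k"
        using True by (simp add: mat_coords_def)
      ultimately show ?thesis
        using e[of 0 1] e[of 0 2] e[of 0 3] e[of 1 0] e[of 1 2] e[of 1 3] e[of 2 0] e[of 2 1]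
          e[of 2 3] e[of 3 0] e[of 3 1] e[of 3 2] e[of 0 0] e[of 1 1] e[of 2 2]
        unfolding sl_basis_4 lessThan_15 by (auto simp: elem_mat_def)
    next
      case False
      then show ?thesis using c by (simp add: mat_coords_def)
    qed
  qed
qed

section \<open>The trilinear form, its cyclic symmetry and its conjugation invariance\<close>

definition mtrace :: "(nat \<Rightarrow> nat \<Rightarrow> complex) \<Rightarrow> complex" where
  "mtrace M = (\<Sum>i<4. M i i)"

definition trace_form :: "(nat \<Rightarrow> nat \<Rightarrow> complex) \<Rightarrow> (nat \<Rightarrow> nat \<Rightarrow> complex) \<Rightarrow> (nat \<Rightarrow> nat \<Rightarrow> complex) \<Rightarrow> complex" where
  "trace_form a b c = mtrace (mat_mult 4 (lie_bracket 4 a b) c)"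

lemma mtrace_4: "mtrace M = M 0 0 + M 1 1 + M 2 2 + M 3 3"
  by (simp add: mtrace_def lessThan_4 add.assoc)

lemma mat_mult_assoc: "mat_mult n (mat_mult n a b) c = mat_mult n a (mat_mult n b c)"
proof (intro ext)
  fix i j
  have "mat_mult n (mat_mult n a b) c i j = (\<Sum>l<n. \<Sum>k<n. a i k * b k l * c l j)"
    by (simp add: mat_mult_def sum_distrib_right)
  also have "\<dots> = (\<Sum>k<n. \<Sum>l<n. a i k * b k l * c l j)" by (rule sum.swap)
  also have "\<dots> = mat_mult n a (mat_mult n b c) i j"
    by (simp add: mat_mult_def sum_distrib_left mult.assoc)
  finally show "mat_mult n (mat_mult n a b) c i j = mat_mult n a (mat_mult n b c) i j" .
qed

lemma mtrace_mult_commute: "mtrace (mat_mult 4 a b) = mtrace (mat_mult 4 b a)"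
  unfolding mtrace_def mat_mult_def by (subst sum.swap) (simp add: mult.commute)

lemma mat_mult_diff_left: "mat_mult n (\<lambda>i j. a i j - b i j) c = (\<lambda>i j. mat_mult n a c i j - mat_mult n b c i j)"
  by (simp add: mat_mult_def sum_subtractf left_diff_distrib)

lemma trace_form_eq: "trace_form a b c = mtrace (mat_mult 4 a (mat_mult 4 b c)) - mtrace (mat_mult 4 b (mat_mult 4 a c))"
  unfolding trace_form_def lie_bracket_def mat_mult_diff_left mat_mult_assoc
  by (simp add: mtrace_def sum_subtractf)

lemma trace_form_rotate: "trace_form a b c = trace_form b c a"
  unfolding trace_form_eq
  using mtrace_mult_commute[of a "mat_mult 4 b c"] mtrace_mult_commute[of "mat_mult 4 b a" c]
  by (simp add: mat_mult_assoc)

lemma trace_form_sum_right: "trace_form a b (\<lambda>p q. \<Sum>k\<in>S. x k * M k p q) = (\<Sum>k\<in>S. x k * trace_form a b (M k))"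
  unfolding trace_form_def mtrace_def mat_mult_def
  by (simp add: sum_distrib_left sum.swap[of _ S "{..<4}"] mult.left_commute)

lemma trace_form_sum_left: "trace_form (\<lambda>p q. \<Sum>k\<in>S. x k * M k p q) a b = (\<Sum>k\<in>S. x k * trace_form (M k) a b)"
  using trace_form_sum_right[of a b] by (simp add: trace_form_rotate[of _ a b])

lemma trace_form_sum_middle: "trace_form b (\<lambda>p q. \<Sum>k\<in>S. x k * M k p q) a = (\<Sum>k\<in>S. x k * trace_form b (M k) a)"
  using trace_form_sum_left[where a = a and b = b and x = x and M = M and S = S] by (simp add: trace_form_rotate[of b _ a])

lemma trace_form_cong:
  assumes "\<And>i j. i < 4 \<Longrightarrow> j < 4 \<Longrightarrow> a i j = a' i j" "\<And>i j. i < 4 \<Longrightarrow> j < 4 \<Longrightarrow> b i j = b' i j"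
    "\<And>i j. i < 4 \<Longrightarrow> j < 4 \<Longrightarrow> c i j = c' i j"
  shows "trace_form a b c = trace_form a' b' c'"
  unfolding trace_form_def mtrace_def mat_mult_def lie_bracket_def using assms by simp

definition conj_by :: "(nat \<Rightarrow> nat \<Rightarrow> complex) \<Rightarrow> (nat \<Rightarrow> nat \<Rightarrow> complex) \<Rightarrow> (nat \<Rightarrow> nat \<Rightarrow> complex) \<Rightarrow> nat \<Rightarrow> nat \<Rightarrow> complex" where
  "conj_by g g' M = mat_mult 4 g (mat_mult 4 M g')"

text \<open>The inverse is passed as a separate matrix \<open>g'\<close>, with the identity required
  on indices below 4 only, because entries outside this range carry no meaning. Inside a product
  \<open>g' g\<close> cancels, and cyclicity of the trace removes the outer pair.\<close>

lemma trace_form_conj_by: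
  assumes inv: "\<And>i j. i < 4 \<Longrightarrow> j < 4 \<Longrightarrow> mat_mult 4 g' g i j = (if i = j then 1 else 0)"
  shows "mtrace (conj_by g g' a) = mtrace a"
    and "trace_form (conj_by g g' a) (conj_by g g' b) (conj_by g g' c) = trace_form a b c"
proof -
  have right: "mat_mult 4 x (mat_mult 4 (mat_mult 4 g' g) y) = mat_mult 4 x y" for x y
  proof (intro ext)
    fix i j
    have "mat_mult 4 (mat_mult 4 g' g) y l j = y l j" if "l < 4" for l
    proof -
      have "mat_mult 4 (mat_mult 4 g' g) y l j = (\<Sum>k<4. if k = l then y k j else 0)"
        unfolding mat_mult_def[of 4 "mat_mult 4 g' g"] using inv that by (intro sum.cong) auto
      then show ?thesis using that by simp
    qed
    then show "mat_mult 4 x (mat_mult 4 (mat_mult 4 g' g) y) i j = mat_mult 4 x y i j"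
      by (simp add: mat_mult_def[of 4 x])
  qed
  have mult: "mat_mult 4 (conj_by g g' x) (conj_by g g' y) = conj_by g g' (mat_mult 4 x y)" for x y
    using right[of x "mat_mult 4 y g'"] by (simp add: conj_by_def mat_mult_assoc)
  have tr: "mtrace (conj_by g g' x) = mtrace x" for x
  proof -
    have "mtrace (conj_by g g' x) = mtrace (mat_mult 4 x (mat_mult 4 g' g))"
      unfolding conj_by_def mtrace_mult_commute[of g] by (simp add: mat_mult_assoc)
    also have "\<dots> = mtrace x"
      unfolding mtrace_def
    proof (rule sum.cong[OF refl])
      fix i :: nat assume i: "i \<in> {..<4}"
      have "mat_mult 4 x (mat_mult 4 g' g) i i = (\<Sum>k<4. if k = i then x i k else 0)"
        unfolding mat_mult_def[of 4 x] using inv i by (intro sum.cong) auto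
      then show "mat_mult 4 x (mat_mult 4 g' g) i i = x i i" using i by simp
    qed
    finally show ?thesis .
  qed
  show "mtrace (conj_by g g' a) = mtrace a" by (rule tr)
  show "trace_form (conj_by g g' a) (conj_by g g' b) (conj_by g g' c) = trace_form a b c"
    unfolding trace_form_eq mult tr ..
qed

text \<open>\<open>L\<close> is the Gram matrix of the trace pairing. Contracting the third argument
  with it is a linear substitution, which does not raise border rank, and turns the
  \<open>sl(4)\<close> factor into a covector.\<close>

lemma border_rank_le_trace_form:
  assumes "border_rank_le 15 15 15 (sl_structure_tensor 4) r"
  shows "border_rank_le 15 15 15 (\<lambda>i j k. trace_form (basis_mat i) (basis_mat j) (basis_mat k)) r"
proof -
  define L where "L = (\<lambda>c k. \<Sum>a<4. \<Sum>b<4. basis_mat c a b * basis_mat k b a)"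
  have "border_rank_le 15 15 15 (\<lambda>i j k. \<Sum>c<15. L c k * sl_structure_tensor 4 i j c) r"
    by (rule border_rank_le_rotate[OF border_rank_le_subst[OF
          border_rank_le_rotate[OF border_rank_le_rotate[OF assms]]]])
  moreover have "(\<Sum>c<15. L c k * sl_structure_tensor 4 i j c) = trace_form (basis_mat i) (basis_mat j) (basis_mat k)" for i j k
  proof -
    let ?B = "lie_bracket 4 (basis_mat i) (basis_mat j)"
    have "mtrace ?B = 0"
      using mtrace_mult_commute[of "basis_mat i" "basis_mat j"] by (simp add: lie_bracket_def mtrace_def sum_subtractf)
    then have 0: "?B 0 0 + ?B 1 1 + ?B 2 2 + ?B 3 3 = 0" by (simp only: mtrace_4)
    have "(\<Sum>c<15. L c k * sl_structure_tensor 4 i j c) =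
        (\<Sum>c<15. \<Sum>a<4. \<Sum>b<4. (mat_coords ?B c * basis_mat c a b) * basis_mat k b a)"
      unfolding sl_structure_tensor_def sl_coords_4[of ?B, OF 0] L_def
      by (simp add: sum_distrib_left sum_distrib_right mult_ac)
    also have "\<dots> = (\<Sum>a<4. \<Sum>b<4. \<Sum>c<15. (mat_coords ?B c * basis_mat c a b) * basis_mat k b a)"
      by (simp only: sum.swap[of _ "{..<4}" "{..<15}"])
    also have "\<dots> = (\<Sum>a<4. \<Sum>b<4. ?B a b * basis_mat k b a)"
      by (intro sum.cong refl) (simp only: sum_distrib_right[symmetric] mat_coords_expansion[of ?B, OF 0] lessThan_iff)
    also have "\<dots> = trace_form (basis_mat i) (basis_mat j) (basis_mat k)"
      by (simp add: trace_form_def mtrace_def mat_mult_def[of 4 "lie_bracket 4 _ _"])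
    finally show ?thesis .
  qed
  ultimately show ?thesis by simp
qed

section \<open>Degeneration of the hyperplanes\<close>

text \<open>The conjugate of \<open>E_01\<close> is column 0 of this matrix times row 1 of its
  inverse, that is \<open>(1, s, s^6, s^7)\<close> times
  \<open>(- s - s^8 - s^11, 1, s^2, s^4)\<close>. The first entry of the row is forced, since row
  and column must pair to zero.\<close>

definition orbit_mat :: "complex \<Rightarrow> nat \<Rightarrow> nat \<Rightarrow> complex" where
  "orbit_mat s i j = [[1, 0, 0, 0], [s, 1, - (s^2), - (s^4)], [s^6, 0, 1, 0], [s^7, 0, 0, 1]] ! i ! j"

definition orbit_mat_inv :: "complex \<Rightarrow> nat \<Rightarrow> nat \<Rightarrow> complex" where
  "orbit_mat_inv s i j = [[1, 0, 0, 0], [- s - s^8 - s^11, 1, s^2, s^4], [- (s^6), 0, 1, 0], [- (s^7), 0, 0, 1]] ! i ! j"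

definition one_psg :: "complex \<Rightarrow> nat \<Rightarrow> complex" where
  "one_psg e i = [1, e^2, e, e] ! i"

text \<open>Conjugation by \<open>diag(1, e^2, e, e)\<close> scales \<open>E_kl\<close> by a power
  of \<open>e\<close> whose exponent is the difference of two weights among 0, 2, 1, 1. Only
  \<open>E_01\<close> attains the minimum -2; adding 2 gives the exponents listed here, zero for
  \<open>E_01\<close> and positive for all other basis vectors.\<close>

definition root_weight :: "nat \<Rightarrow> nat" where
  "root_weight i = [0, 1, 1, 4, 3, 3, 3, 1, 2, 3, 1, 2, 2, 2, 2] ! i"

text \<open>The dropped basis vector is replaced by zero instead of being deleted, so the tensor
  keeps its format and the basis its numbering.\<close>

definition reduced_mat :: "nat \<Rightarrow> nat \<Rightarrow> nat \<Rightarrow> complex" where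
  "reduced_mat i = (if i = 0 then (\<lambda>_ _. 0) else basis_mat i)"

lemma orbit_mat_inv_mult:
  assumes "e \<noteq> 0" "i < 4" "j < 4"
  shows "mat_mult 4 (\<lambda>l q. orbit_mat_inv s l q / one_psg e l) (\<lambda>p k. orbit_mat s p k * one_psg e k) i j = (if i = j then 1 else 0)"
proof -
  have "i \<in> {0,1,2,3}" "j \<in> {0,1,2,3}" using assms by auto
  then show ?thesis using assms(1)
    unfolding mat_mult_def lessThan_4
    by (auto simp: orbit_mat_def orbit_mat_inv_def one_psg_def power_add[symmetric] field_simps)
qed

lemma one_psg_basis_mat:
  assumes "e \<noteq> 0" "k < 4" "l < 4" "i < 15"
  shows "one_psg e k * basis_mat i k l / one_psg e l = e ^ root_weight i / e^2 * basis_mat i k l"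
proof -
  have "k \<in> {0,1,2,3}" "l \<in> {0,1,2,3}" using assms by auto
  moreover have "i \<in> {0,1,2,3,4,5,6,7,8,9,10,11,12,13,14}"
    using assms(4) lessThan_15 lessThan_iff by blast
  ultimately show ?thesis using assms(1)
    unfolding sl_basis_4 by (auto simp: one_psg_def root_weight_def elem_mat_def eval_nat_numeral)
qed

lemma conj_by_one_psg:
  assumes "e \<noteq> 0" "i < 15"
  shows "conj_by (\<lambda>p k. orbit_mat s p k * one_psg e k) (\<lambda>l q. orbit_mat_inv s l q / one_psg e l) (basis_mat i) p q =
    e ^ root_weight i / e^2 * conj_by (orbit_mat s) (orbit_mat_inv s) (basis_mat i) p q"
proof -
  have "conj_by (\<lambda>p k. orbit_mat s p k * one_psg e k) (\<lambda>l q. orbit_mat_inv s l q / one_psg e l) (basis_mat i) p q =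
    (\<Sum>k<4. \<Sum>l<4. orbit_mat s p k * (one_psg e k * basis_mat i k l / one_psg e l) * orbit_mat_inv s l q)"
    by (simp add: conj_by_def mat_mult_def sum_distrib_left mult_ac)
  also have "\<dots> = (\<Sum>k<4. \<Sum>l<4. orbit_mat s p k * (e ^ root_weight i / e^2 * basis_mat i k l) * orbit_mat_inv s l q)"
    using one_psg_basis_mat[OF assms(1) _ _ assms(2)] by (intro sum.cong refl) simp
  also have "\<dots> = e ^ root_weight i / e^2 * conj_by (orbit_mat s) (orbit_mat_inv s) (basis_mat i) p q"
    by (simp add: conj_by_def mat_mult_def sum_distrib_left mult_ac)
  finally show ?thesis .
qed

lemma mat_coords_scale: "mat_coords (\<lambda>p q. c * M p q) a = c * mat_coords M a"
proof (cases "a < 15")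
  case True
  then have "a \<in> {0,1,2,3,4,5,6,7,8,9,10,11,12,13,14}"
    using lessThan_15 lessThan_iff by blast
  then show ?thesis by (auto simp: mat_coords_def algebra_simps)
qed (simp add: mat_coords_def)

text \<open>The conjugates of the root vector \<open>E\<^sub>0\<^sub>1\<close> along the curve \<open>orbit_mat s\<close> span the whole algebra: in
  \<open>orbit_mat s \<cdot> E\<^sub>0\<^sub>1 \<cdot> (orbit_mat s)\<^sup>-\<^sup>1\<close> the exponents are chosen so that the 15 coordinates are linearly
  independent polynomials in \<open>s\<close>.\<close>

lemma functional_on_orbit_poly:
  assumes "\<exists>i<15. y i \<noteq> 0"
  shows "\<exists>p. p \<noteq> 0 \<and> (\<forall>s. (\<Sum>a<15. y a * mat_coords (conj_by (orbit_mat s) (orbit_mat_inv s) (basis_mat 0)) a) = poly p s)"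
proof (intro exI conjI allI)
  \<comment> \<open>The coefficients of \<open>s^12\<close>, \<open>s^14\<close>,
    \<open>s^15\<close> isolate \<open>y 3\<close>, \<open>y 6\<close>, \<open>y 9\<close>, that of
    \<open>s\<close> isolates \<open>y 12\<close>; then \<open>s^8\<close> gives
    \<open>y 13\<close>, \<open>s^11\<close> gives \<open>y 14\<close>, and each remaining
    \<open>y\<close> is read off from a coefficient of its own. Hence \<open>?p\<close> vanishes
    only with \<open>y\<close>.\<close>
  let ?p = "[: y 0, - y 12, y 1 - y 3, y 4, y 2, y 5, y 7, y 10 - y 6, - y 9 - y 12 - y 13, y 11 - y 3,
     y 8, - y 12 - y 13 - y 14, - y 3, 0, - y 6, - y 9, 0, - y 6, - y 9 :]"
  show "?p \<noteq> 0"
  proof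
    assume "?p = 0"
    then have "\<forall>i\<in>{..<15}. y i = 0" unfolding lessThan_15 by auto
    with assms show False by auto
  qed
  fix s
  have c: "conj_by (orbit_mat s) (orbit_mat_inv s) (basis_mat 0) p q = orbit_mat s p 0 * orbit_mat_inv s 1 q" for p q
    unfolding conj_by_def mat_mult_def sl_basis_4 lessThan_4 by (simp add: elem_mat_def)
  show "(\<Sum>a<15. y a * mat_coords (conj_by (orbit_mat s) (orbit_mat_inv s) (basis_mat 0)) a) = poly ?p s"
    unfolding lessThan_15 by (simp add: mat_coords_def c orbit_mat_def orbit_mat_inv_def) algebra
qed

lemma tendsto_trace_form:
  assumes "\<And>p q. (\<lambda>n. a n p q) \<longlonglongrightarrow> a' p q" "\<And>p q. (\<lambda>n. b n p q) \<longlonglongrightarrow> b' p q"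
    "\<And>p q. (\<lambda>n. c n p q) \<longlonglongrightarrow> c' p q"
  shows "(\<lambda>n. trace_form (a n) (b n) (c n)) \<longlonglongrightarrow> trace_form a' b' c'"
  unfolding trace_form_def mtrace_def mat_mult_def lie_bracket_def
  by (intro tendsto_sum tendsto_mult tendsto_diff assms)

text \<open>Conjugating by a suitable \<open>orbit_mat s\<close> and then by a one-parameter subgroup moves any three
  hyperplanes simultaneously to the hyperplane where the \<open>E\<^sub>0\<^sub>1\<close>-coordinate vanishes.\<close>

lemma border_rank_le_reduced:
  assumes "border_rank_le 15 15 15 (\<lambda>i j k. trace_form (basis_mat i) (basis_mat j) (basis_mat k)) (r + 3)"
  shows "border_rank_le 15 15 15 (\<lambda>i j k. trace_form (reduced_mat i) (reduced_mat j) (reduced_mat k)) r"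
proof -
  define t where "t = (\<lambda>i j k. trace_form (basis_mat i) (basis_mat j) (basis_mat k))"
  obtain y1 y2 y3 where y: "\<exists>i<15. y1 i \<noteq> 0" "\<exists>i<15. y2 i \<noteq> 0" "\<exists>i<15. y3 i \<noteq> 0"
    "\<forall>L1 L2 L3. (\<forall>i. (\<Sum>a<15. y1 a * L1 a i) = 0) \<and> (\<forall>i. (\<Sum>a<15. y2 a * L2 a i) = 0) \<and>
      (\<forall>i. (\<Sum>a<15. y3 a * L3 a i) = 0) \<longrightarrow>
      border_rank_le 15 15 15 (sub1 15 L1 (sub2 15 L2 (sub3 15 L3 t))) r"
    using border_substitution3[OF assms[folded t_def] zero_less_numeral] by blast
  \<comment> \<open>\<open>Y s y i\<close> is the functional \<open>y\<close> pulled back along the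
    conjugation and evaluated at the \<open>i\<close>-th basis vector. The degeneration requires
    \<open>Y s y 0\<close> to be non-zero.\<close>
  define Y where "Y = (\<lambda>s (y::nat\<Rightarrow>complex) i. \<Sum>a<15. y a * mat_coords (conj_by (orbit_mat s) (orbit_mat_inv s) (basis_mat i)) a)"
  have "\<exists>p. p \<noteq> 0 \<and> (\<forall>s. Y s y 0 = poly p s)" if "\<exists>i<15. y i \<noteq> 0" for y
    unfolding Y_def by (rule functional_on_orbit_poly[OF that])
  from this[OF y(1)] this[OF y(2)] this[OF y(3)]
  obtain p1 p2 p3 where p: "p1 \<noteq> 0" "\<forall>s. Y s y1 0 = poly p1 s" "p2 \<noteq> 0" "\<forall>s. Y s y2 0 = poly p2 s"
    "p3 \<noteq> 0" "\<forall>s. Y s y3 0 = poly p3 s"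
    by blast
  \<comment> \<open>A non-root of the product is generic for all three functionals at once, so one
    conjugation serves the three arguments.\<close>
  have "finite {s. poly (p1 * p2 * p3) s = 0}" by (rule poly_roots_finite) (use p in simp)
  then obtain s where "poly (p1 * p2 * p3) s \<noteq> 0"
    using ex_new_if_finite[OF infinite_UNIV_char_0] by blast
  then have Y0: "Y s y1 0 \<noteq> 0" "Y s y2 0 \<noteq> 0" "Y s y3 0 \<noteq> 0" using p by auto
  define cj where "cj = (\<lambda>e. conj_by (\<lambda>p k. orbit_mat s p k * one_psg e k) (\<lambda>l q. orbit_mat_inv s l q / one_psg e l))"
  \<comment> \<open>For \<open>e \<noteq> 0\<close> the pulled-back hyperplane is spanned by the
    vectors \<open>basis_mat i - \<eta> y e i * basis_mat 0\<close>. The quotient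
    \<open>\<eta>\<close> tends to 0 with \<open>e\<close> for \<open>i > 0\<close> and equals 1 for
    \<open>i = 0\<close>, where the vector itself is zero.\<close>
  define \<eta> where "\<eta> = (\<lambda>(y::nat\<Rightarrow>complex) e i. if i < 15 then e ^ root_weight i * Y s y i / Y s y 0 else 0)"
  \<comment> \<open>Column \<open>i\<close> contains the coordinates of the conjugate of the
    \<open>i\<close>-th spanning vector. Columns from 15 on are zero because the hyperplane
    condition is asked for every \<open>i\<close>.\<close>
  define L where "L = (\<lambda>(y::nat\<Rightarrow>complex) e a i. if i < 15 then
      mat_coords (cj e (basis_mat i)) a - \<eta> y e i * mat_coords (cj e (basis_mat 0)) a else 0)"
  define shifted where "shifted = (\<lambda>y e i p q. basis_mat i p q - \<eta> y e i * basis_mat 0 p q)"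
  have coords: "(\<Sum>a<15. y a * mat_coords (cj e (basis_mat i)) a) = e ^ root_weight i / e^2 * Y s y i"
    if "e \<noteq> 0" "i < 15" for y e i
  proof -
    have "mat_coords (cj e (basis_mat i)) a = e ^ root_weight i / e^2 * mat_coords (conj_by (orbit_mat s) (orbit_mat_inv s) (basis_mat i)) a" for a
      unfolding cj_def mat_coords_scale[symmetric] conj_by_one_psg[OF that] ..
    then show ?thesis by (simp add: Y_def sum_distrib_left mult_ac)
  qed
  have yL: "(\<Sum>a<15. y a * L y e a i) = 0" if "e \<noteq> 0" "Y s y 0 \<noteq> 0" for y e i
  proof (cases "i < 15")
    case True
    have "(\<Sum>a<15. y a * L y e a i) = (\<Sum>a<15. y a * mat_coords (cj e (basis_mat i)) a) -
        \<eta> y e i * (\<Sum>a<15. y a * mat_coords (cj e (basis_mat 0)) a)"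
      using True by (simp add: L_def sum_subtractf right_diff_distrib sum_distrib_left mult_ac)
    also have "\<dots> = 0"
      using that True by (simp add: coords \<eta>_def root_weight_def)
    finally show ?thesis .
  qed (simp add: L_def)
  have trace_basis_mat: "mtrace (basis_mat i) = 0" if "i < 15" for i
  proof -
    have "i \<in> {0,1,2,3,4,5,6,7,8,9,10,11,12,13,14}" using that lessThan_15 lessThan_iff by blast
    then show ?thesis unfolding mtrace_4 sl_basis_4 by (auto simp: elem_mat_def)
  qed
  have expand: "(\<Sum>a<15. L y e a i * basis_mat a p q) = cj e (shifted y e i) p q"
    if "e \<noteq> 0" "i < 15" "p < 4" "q < 4" for y e i p q
  proof -
    have "mtrace (cj e (basis_mat j)) = 0" if "j < 15" for j
      using trace_form_conj_by(1)[OF orbit_mat_inv_mult[OF \<open>e \<noteq> 0\<close>]] trace_basis_mat[OF that] by (simp add: cj_def)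
    then have E: "(\<Sum>a<15. mat_coords (cj e (basis_mat j)) a * basis_mat a p q) = cj e (basis_mat j) p q" if "j < 15" for j
      using mat_coords_expansion[of "cj e (basis_mat j)" p q] that \<open>p < 4\<close> \<open>q < 4\<close> by (simp only: mtrace_4)
    have "(\<Sum>a<15. L y e a i * basis_mat a p q) = cj e (basis_mat i) p q - \<eta> y e i * cj e (basis_mat 0) p q"
      using E[OF \<open>i < 15\<close>] E[of 0] \<open>i < 15\<close>
      by (simp add: L_def left_diff_distrib sum_subtractf mult.assoc flip: sum_distrib_left)
    also have "\<dots> = cj e (shifted y e i) p q"
      by (simp add: cj_def conj_by_def mat_mult_def shifted_def left_diff_distrib right_diff_distrib
          sum_subtractf sum_distrib_left mult_ac)
    finally show ?thesis .
  qed
  have subst_eq: "sub1 15 (L y1 e) (sub2 15 (L y2 e) (sub3 15 (L y3 e) t)) i j k =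
      trace_form (shifted y1 e i) (shifted y2 e j) (shifted y3 e k)"
    if "e \<noteq> 0" "i < 15" "j < 15" "k < 15" for e i j k
  proof -
    have "sub1 15 (L y1 e) (sub2 15 (L y2 e) (sub3 15 (L y3 e) t)) i j k =
      trace_form (\<lambda>p q. \<Sum>a<15. L y1 e a i * basis_mat a p q) (\<lambda>p q. \<Sum>a<15. L y2 e a j * basis_mat a p q)
        (\<lambda>p q. \<Sum>a<15. L y3 e a k * basis_mat a p q)"
      unfolding sub1_def sub2_def sub3_def t_def trace_form_sum_left trace_form_sum_middle trace_form_sum_right ..
    also have "\<dots> = trace_form (cj e (shifted y1 e i)) (cj e (shifted y2 e j)) (cj e (shifted y3 e k))"
      by (rule trace_form_cong) (use that expand in auto)
    \<comment> \<open>Invariance removes the conjugation, although it diverges as \<open>e\<close>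
      tends to 0; only the convergent vectors \<open>shifted\<close> remain.\<close>
    also have "\<dots> = trace_form (shifted y1 e i) (shifted y2 e j) (shifted y3 e k)"
      unfolding cj_def by (rule trace_form_conj_by(2)[OF orbit_mat_inv_mult[OF that(1)]])
    finally show ?thesis .
  qed
  define e where "e = (\<lambda>n::nat. complex_of_real (inverse (real (Suc n))))"
  have e0: "e n \<noteq> 0" for n by (simp add: e_def del: of_nat_Suc)
  have "e \<longlonglongrightarrow> of_real 0"
    unfolding e_def by (intro tendsto_of_real LIMSEQ_inverse_real_of_nat)
  then have elim: "e \<longlonglongrightarrow> 0" by simp
  have lim: "(\<lambda>n. shifted y (e n) i p q) \<longlonglongrightarrow> reduced_mat i p q" if "i < 15" "Y s y 0 \<noteq> 0" for y i p q
  proof (cases "i = 0")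
    case True
    then show ?thesis using that by (simp add: shifted_def reduced_mat_def \<eta>_def root_weight_def)
  next
    case False
    have "i \<in> {0,1,2,3,4,5,6,7,8,9,10,11,12,13,14}" using that(1) lessThan_15 lessThan_iff by blast
    with False have w: "root_weight i > 0" by (auto simp: root_weight_def)
    have "(\<lambda>n. e n ^ root_weight i) \<longlonglongrightarrow> 0"
      using tendsto_power[OF elim, of "root_weight i"] unfolding zero_power[OF w] .
    then have "(\<lambda>n. e n ^ root_weight i * (Y s y i / Y s y 0 * basis_mat 0 p q)) \<longlonglongrightarrow> 0"
      by (rule tendsto_mult_left_zero)
    then have "(\<lambda>n. basis_mat i p q - e n ^ root_weight i * (Y s y i / Y s y 0 * basis_mat 0 p q)) \<longlonglongrightarrow> basis_mat i p q - 0"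
      by (intro tendsto_diff tendsto_const)
    then show ?thesis using False that(1) by (simp add: shifted_def reduced_mat_def \<eta>_def mult.assoc)
  qed
  show ?thesis
  proof (rule border_rank_le_limit)
    show "border_rank_le 15 15 15 (sub1 15 (L y1 (e n)) (sub2 15 (L y2 (e n)) (sub3 15 (L y3 (e n)) t))) r" for n
      by (rule y(4)[rule_format]) (use yL e0 Y0 in auto)
    show "(\<lambda>n. sub1 15 (L y1 (e n)) (sub2 15 (L y2 (e n)) (sub3 15 (L y3 (e n)) t)) i j k)
        \<longlonglongrightarrow> trace_form (reduced_mat i) (reduced_mat j) (reduced_mat k)" if "i < 15" "j < 15" "k < 15" for i j k
      unfolding subst_eq[OF e0 that] using that Y0 by (intro tendsto_trace_form lim)
  qed
qed

section \<open>The rank of the flattening\<close>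

fun key_mem :: "int \<Rightarrow> int tree \<Rightarrow> bool" where
  "key_mem x \<langle>\<rangle> = False"
| "key_mem x \<langle>l, a, r\<rangle> = (if x < a then key_mem x l else if x = a then True else key_mem x r)"

fun key_ins :: "int \<Rightarrow> int tree \<Rightarrow> int tree" where
  "key_ins x \<langle>\<rangle> = \<langle>\<langle>\<rangle>, x, \<langle>\<rangle>\<rangle>"
| "key_ins x \<langle>l, a, r\<rangle> = (if x < a then \<langle>key_ins x l, a, r\<rangle> else \<langle>l, a, key_ins x r\<rangle>)"

lemma key_memD: "key_mem x t \<Longrightarrow> x \<in> set_tree t"
  by (induction x t rule: key_mem.induct) (auto split: if_splits)

lemma key_mem_bst: "bst t \<Longrightarrow> x \<in> set_tree t \<Longrightarrow> key_mem x t"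
  by (induction x t rule: key_mem.induct) fastforce+

lemma set_tree_key_ins: "set_tree (key_ins x t) = insert x (set_tree t)"
  by (induction x t rule: key_ins.induct) auto

text \<open>An equal key would be sent to the right and break the strict order, hence the freshness
  condition.\<close>

lemma bst_key_ins: "bst t \<Longrightarrow> x \<notin> set_tree t \<Longrightarrow> bst (key_ins x t)"
  by (induction x t rule: key_ins.induct) (auto simp: set_tree_key_ins)

text \<open>Unknowns of the flattening are coded by integers: \<open>trip_key b c d + j\<close> stands for the coordinate
  \<open>e\<^sub>b \<and> e\<^sub>c \<and> e\<^sub>d\<close> tensored with the \<open>j\<close>-th basis vector, so its decimal digits are \<open>b c d j j\<close>.\<close>

definition trip_key :: "int \<Rightarrow> int \<Rightarrow> int \<Rightarrow> int" where
  "trip_key b c d = 10000 * b + 1000 * c + 100 * d"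

fun add_term :: "int \<Rightarrow> int \<Rightarrow> (int \<times> int) tree \<Rightarrow> (int \<times> int) tree" where
  "add_term x v \<langle>\<rangle> = \<langle>\<langle>\<rangle>, (x, v), \<langle>\<rangle>\<rangle>"
| "add_term x v \<langle>l, (a, w), r\<rangle> =
    (if x < a then \<langle>add_term x v l, (a, w), r\<rangle>
     else if x = a then \<langle>l, (a, v + w), r\<rangle> else \<langle>l, (a, w), add_term x v r\<rangle>)"

fun add_block :: "int \<Rightarrow> int \<Rightarrow> (int \<times> int) list \<Rightarrow> (int \<times> int) tree \<Rightarrow> (int \<times> int) tree" where
  "add_block m q [] t = t"
| "add_block m q ((j, v) # g) t = add_block m q g (add_term (m + j) (q * v) t)"

text \<open>An in-order traversal with accumulator \<open>L\<close>, which drops cancelled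
  coefficients and the unknowns already known to vanish.\<close>

fun leftover :: "int tree \<Rightarrow> (int \<times> int) tree \<Rightarrow> (int \<times> int) list \<Rightarrow> (int \<times> int) list" where
  "leftover Z \<langle>\<rangle> L = L"
| "leftover Z \<langle>l, (a, w), r\<rangle> L = leftover Z l
    (if w = 0 then leftover Z r L else if key_mem a Z then leftover Z r L else (a, w) # leftover Z r L)"

type_synonym row_comb = "(int \<times> int \<times> int \<times> int \<times> int \<times> int) list"

text \<open>The four signed blocks are the four terms of \<open>wedge3\<close>; \<open>G a k\<close>
  is the sparse vector of the values of the form on the \<open>a\<close>-th direction, a running
  second argument and \<open>k\<close>.\<close>

fun combine :: "(int \<Rightarrow> int \<Rightarrow> (int \<times> int) list) \<Rightarrow> row_comb \<Rightarrow> (int \<times> int) tree" where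
  "combine G [] = \<langle>\<rangle>"
| "combine G ((q, a, b, c, d, k) # rs) =
    add_block (trip_key b c d) q (G a k) (add_block (trip_key a c d) (- q) (G b k)
     (add_block (trip_key a b d) q (G c k) (add_block (trip_key a b c) (- q) (G d k) (combine G rs))))"

text \<open>The index \<open>k = 0\<close> is left out because \<open>reduced_mat 0\<close> is zero
  and the corresponding rows are empty.\<close>

definition valid_row :: "int \<times> int \<times> int \<times> int \<times> int \<times> int \<Rightarrow> bool" where
  "valid_row = (\<lambda>(q, a, b, c, d, k). 0 \<le> a \<and> a < b \<and> b < c \<and> c < d \<and> d < 7 \<and> 0 < k \<and> k < 15)"

definition isolates :: "int \<Rightarrow> (int \<times> int) list \<Rightarrow> bool" where
  "isolates p L = (case L of [] \<Rightarrow> False | x # xs \<Rightarrow> fst x = p \<and> snd x \<noteq> 0 \<and> xs = [])"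

fun triangular :: "(int \<Rightarrow> int \<Rightarrow> (int \<times> int) list) \<Rightarrow> int tree \<Rightarrow> (int \<times> row_comb) list \<Rightarrow> bool" where
  "triangular G Z [] = True"
| "triangular G Z ((p, rs) # cs) =
    (list_all valid_row rs \<and> isolates p (leftover Z (combine G rs) []) \<and> triangular G (key_ins p Z) cs)"

section \<open>Soundness of the elimination for complex vectors\<close>

definition block_val :: "(int \<Rightarrow> complex) \<Rightarrow> int \<Rightarrow> (int \<times> int) list \<Rightarrow> complex" where
  "block_val z m g = (\<Sum>(j, v)\<leftarrow>g. of_int v * z (m + j))"

lemma block_val_simps [simp]:
  "block_val z m [] = 0" "block_val z m ((j, v) # g) = of_int v * z (m + j) + block_val z m g"
  by (simp_all add: block_val_def)

definition tree_val :: "(int \<Rightarrow> complex) \<Rightarrow> (int \<times> int) tree \<Rightarrow> complex" where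
  "tree_val z t = block_val z 0 (inorder t)"

lemma block_val_append: "block_val z m (g @ h) = block_val z m g + block_val z m h"
  by (simp add: block_val_def)

lemma tree_val_simps [simp]:
  "tree_val z \<langle>\<rangle> = 0"
  "tree_val z \<langle>l, (a, w), r\<rangle> = tree_val z l + of_int w * z a + tree_val z r"
  by (simp_all add: tree_val_def block_val_append)

lemma tree_val_add_term: "tree_val z (add_term x v t) = of_int v * z x + tree_val z t"
  by (induction x v t rule: add_term.induct) (auto simp: algebra_simps)

lemma tree_val_add_block: "tree_val z (add_block m q g t) = of_int q * block_val z m g + tree_val z t"
  by (induction m q g t rule: add_block.induct) (auto simp: tree_val_add_term algebra_simps)

lemma block_val_leftover:
  assumes "\<And>x. x \<in> set_tree Z \<Longrightarrow> z x = 0"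
  shows "block_val z 0 (leftover Z t L) = tree_val z t + block_val z 0 L"
  using assms by (induction Z t L rule: leftover.induct) (auto dest: key_memD)

lemma tree_val_combine:
  assumes rows: "\<And>a b c d k. 0 \<le> a \<Longrightarrow> a < b \<Longrightarrow> b < c \<Longrightarrow> c < d \<Longrightarrow> d < 7 \<Longrightarrow> 0 < k \<Longrightarrow> k < 15 \<Longrightarrow>
      block_val z (trip_key b c d) (G a k) - block_val z (trip_key a c d) (G b k)
      + block_val z (trip_key a b d) (G c k) - block_val z (trip_key a b c) (G d k) = 0"
    and "list_all valid_row rs"
  shows "tree_val z (combine G rs) = 0"
  using assms(2)
proof (induction rs)
  case (Cons r rs)
  obtain q a b c d k where r: "r = (q, a, b, c, d, k)" by (cases r) auto
  have "tree_val z (combine G (r # rs)) = of_int q *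
    (block_val z (trip_key b c d) (G a k) - block_val z (trip_key a c d) (G b k)
      + block_val z (trip_key a b d) (G c k) - block_val z (trip_key a b c) (G d k))"
    using Cons by (simp add: r tree_val_add_block algebra_simps)
  also have "\<dots> = 0" using Cons.prems rows[of a b c d k] by (simp add: r valid_row_def)
  finally show ?case .
qed simp

text \<open>Induction along the list: each combination of valid equations reduces, modulo the
  unknowns in \<open>Z\<close>, to a non-zero multiple of the single unknown \<open>p\<close>, which
  then joins \<open>Z\<close>.\<close>

lemma triangular_sound:
  assumes rows: "\<And>a b c d k. 0 \<le> a \<Longrightarrow> a < b \<Longrightarrow> b < c \<Longrightarrow> c < d \<Longrightarrow> d < 7 \<Longrightarrow> 0 < k \<Longrightarrow> k < 15 \<Longrightarrow>
      block_val z (trip_key b c d) (G a k) - block_val z (trip_key a c d) (G b k)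
      + block_val z (trip_key a b d) (G c k) - block_val z (trip_key a b c) (G d k) = 0"
    and "triangular G Z cs" and "\<And>\<kappa>. \<kappa> \<in> set_tree Z \<Longrightarrow> z \<kappa> = 0"
  shows "\<forall>\<kappa>\<in>set (map fst cs). z \<kappa> = 0"
  using assms(2,3)
proof (induction cs arbitrary: Z)
  case (Cons c cs)
  obtain p rs where c: "c = (p, rs)" by (cases c)
  have t: "list_all valid_row rs" "isolates p (leftover Z (combine G rs) [])" "triangular G (key_ins p Z) cs"
    using Cons.prems(1) by (auto simp: c)
  obtain v where v: "leftover Z (combine G rs) [] = [(p, v)]" "v \<noteq> 0"
    using t(2) by (auto simp: isolates_def split: list.splits)
  have "block_val z 0 [(p, v)] = 0"
    using tree_val_combine[OF rows t(1)] block_val_leftover[of Z z "combine G rs" "[]", OF Cons.prems(2)] v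
    by simp
  \<comment> \<open>Characteristic zero: a non-zero integer coefficient stays non-zero among the
    complex numbers, so an integer check decides.\<close>
  then have "z p = 0" using v(2) by simp
  with Cons.IH[OF t(3)] Cons.prems(2) show ?case by (auto simp: c set_tree_key_ins)
qed simp

lemma leftover_new: "set (leftover Z t L) \<subseteq> {(a, w). \<not> key_mem a Z} \<union> set L"
  by (induction Z t L rule: leftover.induct) (auto split: if_splits)

text \<open>An unknown of \<open>Z\<close> cannot survive in \<open>leftover\<close>, so every entry
  isolates a new one. Thus the length of the list counts unknowns, and none of them belongs to the
  initial tree.\<close>

lemma triangular_distinct:
  assumes "triangular G Z cs" "bst Z"
  shows "distinct (map fst cs)" "set (map fst cs) \<inter> set_tree Z = {}"
proof -
  have "distinct (map fst cs) \<and> set (map fst cs) \<inter> set_tree Z = {}"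
    using assms
  proof (induction cs arbitrary: Z)
    case (Cons c cs)
    obtain p rs where c: "c = (p, rs)" by (cases c)
    obtain v where "leftover Z (combine G rs) [] = [(p, v)]"
      using Cons.prems(1) by (auto simp: c isolates_def split: list.splits)
    then have "\<not> key_mem p Z" using leftover_new[of Z "combine G rs" "[]"] by auto
    then have p: "p \<notin> set_tree Z" using key_mem_bst Cons.prems(2) by blast
    have "triangular G (key_ins p Z) cs" using Cons.prems(1) by (simp add: c)
    from Cons.IH[OF this bst_key_ins[OF Cons.prems(2) p]] p show ?case
      by (auto simp: c set_tree_key_ins)
  qed simp
  then show "distinct (map fst cs)" "set (map fst cs) \<inter> set_tree Z = {}" by auto
qed

text \<open>\<open>form_table a k\<close> lists the pairs \<open>(j, v)\<close> with \<open>v \<noteq> 0\<close> the value of the reduced form on the \<open>a\<close>-th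
  chosen direction (see \<open>dir_coeffs\<close> below) and the basis vectors \<open>j\<close> and \<open>k\<close>.\<close>

definition form_table :: "int \<Rightarrow> int \<Rightarrow> (int \<times> int) list" where
  "form_table a k =
    (if a = 0 then (if k = 1 then [(7, 1)] else if k = 2 then [(10, 1)] else if k = 3 then [(10, 1)] else if k = 6 then [(11, 1)] else if k = 7 then [(1, - 1)] else if k = 9 then [(12, - 1), (14, - 1)] else if k = 10 then [(2, - 1), (3, - 1)] else if k = 11 then [(6, - 1)] else if k = 12 then [(9, 1)] else if k = 14 then [(9, 1)] else []) else
     if a = 1 then (if k = 3 then [(7, 1)] else if k = 6 then [(12, - 1), (13, - 1), (14, 1)] else if k = 7 then [(3, - 1)] else if k = 8 then [(9, - 1)] else if k = 9 then [(8, 1)] else if k = 12 then [(6, 1)] else if k = 13 then [(6, 1)] else if k = 14 then [(6, - 1)] else []) else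
     if a = 2 then (if k = 1 then [(9, 1)] else if k = 4 then [(10, 1)] else if k = 9 then [(1, - 1)] else if k = 10 then [(4, - 1)] else if k = 11 then [(13, 1), (14, - 2)] else if k = 13 then [(11, - 1)] else if k = 14 then [(11, 2)] else []) else
     if a = 3 then (if k = 2 then [(3, 1)] else if k = 3 then [(2, - 1)] else if k = 4 then [(8, - 1)] else if k = 5 then [(12, - 1), (13, 1), (14, 1)] else if k = 7 then [(12, 1), (13, - 2), (14, 1)] else if k = 8 then [(4, 1), (10, - 1)] else if k = 10 then [(8, 1)] else if k = 12 then [(5, 1), (7, - 1)] else if k = 13 then [(5, - 1), (7, 2)] else if k = 14 then [(5, - 1), (7, - 1)] else []) else
     if a = 4 then (if k = 1 then [(3, 1)] else if k = 2 then [(6, 1)] else if k = 3 then [(1, - 1)] else if k = 4 then [(12, - 1), (13, 2), (14, - 1)] else if k = 5 then [(7, 1), (11, - 1)] else if k = 6 then [(2, - 1)] else if k = 7 then [(5, - 1)] else if k = 8 then [(13, - 1), (14, 2)] else if k = 11 then [(5, 1)] else if k = 12 then [(4, 1)] else if k = 13 then [(4, - 2), (8, 1)] else if k = 14 then [(4, 1), (8, - 2)] else []) else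
     if a = 5 then (if k = 1 then [(6, - 1)] else if k = 4 then [(7, - 2)] else if k = 5 then [(10, - 1)] else if k = 6 then [(1, 1)] else if k = 7 then [(4, 2)] else if k = 8 then [(11, 1)] else if k = 10 then [(5, 1)] else if k = 11 then [(8, - 1)] else []) else
     (if k = 1 then [(8, - 1)] else if k = 2 then [(12, 1), (14, 1)] else if k = 7 then [(12, 1), (13, - 2), (14, 1)] else if k = 8 then [(1, 1), (10, - 1)] else if k = 10 then [(8, 1)] else if k = 12 then [(2, - 1), (7, - 1)] else if k = 13 then [(7, 2)] else if k = 14 then [(2, - 1), (7, - 1)] else []))"

text \<open>Each entry \<open>(p, rs)\<close> names an unknown \<open>p\<close> and a combination of rows; an element \<open>(q, a, b, c, d, k)\<close>
  of \<open>rs\<close> means \<open>q\<close> times the row for \<open>e\<^sub>a \<and> e\<^sub>b \<and> e\<^sub>c \<and> e\<^sub>d\<close> and the \<open>k\<close>-th basis vector. The combination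
  involves, besides \<open>p\<close>, only unknowns shown to vanish by earlier entries or belonging to \<open>free_keys\<close>.
  The list records a sparse Gaussian elimination over the rationals.\<close>

definition koszul_cert :: "(int \<times> row_comb) list" where
  "koszul_cert = [
   (12510, [(1, 0, 1, 2, 5, 2)]), (2507, [(1, 0, 1, 2, 5, 3)]), (1210, [(1, 0, 1, 2, 5, 5)]), (1610,
   [(1, 0, 1, 2, 6, 4)]), (1608, [(1, 0, 1, 3, 6, 4)]), (13606, [(1, 0, 1, 3, 6, 11)]), (1607, [(1,
   0, 1, 5, 6, 4)]), (1611, [(1, 0, 1, 4, 6, 5)]), (15606, [(1, 0, 1, 5, 6, 11)]), (23611, [(1, 0, 2,
   3, 6, 6)]), (25610, [(1, 0, 2, 5, 6, 3)]), (2610, [(1, 0, 2, 5, 6, 5)]), (5611, [(1, 0, 2, 5, 6,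
   13)]), (12503, [(1, 1, 2, 3, 5, 2)]), (12506, [(1, 1, 2, 4, 5, 2)]), (25607, [(1, 1, 2, 5, 6,
   3)]), (12610, [(1, 1, 2, 5, 6, 5)]), (2607, [(1, 0, 1, 2, 6, 3)]), (2611, [(1, 0, 2, 4, 6, 5)]),
   (5610, [(1, 0, 2, 5, 6, 4)]), (34508, [(1, 1, 3, 4, 5, 9)]), (34608, [(1, 1, 3, 4, 6, 9)]),
   (13605, [(1, 1, 3, 4, 6, 11)]), (13508, [(1, 1, 3, 5, 6, 1)]), (35608, [(1, 1, 3, 5, 6, 9)]),
   (15608, [(1, 1, 3, 5, 6, 10)]), (13607, [(1, 1, 3, 5, 6, 4)]), (1308, [(1, 0, 1, 3, 6, 1)]),
   (13506, [(1, 0, 1, 3, 5, 11)]), (14503, [(1, 1, 3, 4, 5, 2)]), (13608, [(1, 1, 3, 5, 6, 11)]),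
   (45608, [(1, 1, 4, 5, 6, 9)]), (34501, [(1, 2, 3, 4, 5, 9)]), (23602, [(1, 2, 3, 4, 6, 6)]),
   (34601, [(1, 2, 3, 4, 6, 9)]), (25602, [(1, 2, 3, 5, 6, 3)]), (23601, [(1, 2, 3, 5, 6, 6)]),
   (24602, [(1, 2, 3, 4, 6, 3)]), (35601, [(1, 2, 3, 5, 6, 9)]), (25601, [(1, 2, 4, 5, 6, 3)]),
   (24601, [(1, 2, 4, 5, 6, 6)]), (45601, [(1, 2, 4, 5, 6, 9)]), (45602, [(1, 3, 4, 5, 6, 3)]),
   (35602, [(1, 3, 4, 5, 6, 6)]), (34605, [(1, 3, 4, 5, 6, 10)]), (35605, [(1, 3, 4, 5, 6, 11)]),
   (24610, [(1, 0, 2, 5, 6, 6), (1, 0, 2, 4, 6, 3), (- 1, 2, 4, 5, 6, 5)]), (2606, [(1, 0, 1, 2, 6,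
   14), (- 1, 0, 1, 2, 6, 12)]), (1207, [(1, 0, 1, 2, 6, 13)]), (2505, [(1, 0, 2, 3, 5, 14), (- 1, 0,
   2, 3, 5, 12), (2, 0, 2, 3, 5, 13)]), (24509, [(1, 0, 2, 4, 5, 14), (2, 0, 2, 4, 5, 13), (3, 0, 2,
   4, 5, 12)]), (4508, [(1, 0, 1, 4, 5, 9), (- 1, 1, 4, 5, 6, 2)]), (23608, [(1, 1, 3, 5, 6, 6), (-
   1, 0, 3, 5, 6, 9), (- 1, 1, 2, 3, 6, 9), (1, 2, 3, 5, 6, 11)]), (5608, [(1, 0, 4, 5, 6, 14), (- 1,
   0, 4, 5, 6, 12)]), (15613, [(1, 1, 3, 5, 6, 5), (- 1, 1, 2, 3, 6, 4), (1, 0, 1, 5, 6, 9), (1, 1,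
   2, 5, 6, 11)]), (14607, [(1, 1, 4, 5, 6, 4), (1, 0, 1, 5, 6, 9)]), (1504, [(1, 0, 1, 4, 5, 14), (-
   1, 0, 1, 4, 5, 12), (2, 0, 1, 4, 5, 13)]), (1507, [(1, 0, 1, 5, 6, 14), (2, 0, 1, 5, 6, 13), (- 1,
   0, 1, 5, 6, 12)]), (13509, [(1, 0, 1, 3, 5, 14), (1, 0, 1, 3, 5, 12)]), (24506, [(1, 1, 2, 4, 5,
   14), (3, 1, 2, 4, 5, 12), (2, 1, 2, 4, 5, 13)]), (12311, [(1, 1, 2, 3, 5, 8), (1, 0, 2, 3, 5, 12),
   (- 1, 1, 2, 4, 5, 12)]), (1205, [(1, 0, 1, 2, 3, 14), (- 1, 0, 1, 2, 3, 12), (2, 0, 1, 2, 3,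
   13)]), (23507, [(1, 0, 1, 2, 5, 10), (- 1, 1, 2, 3, 5, 3)]), (2306, [(1, 0, 1, 3, 5, 8), (1, 0, 2,
   3, 5, 1), (1, 0, 1, 2, 5, 4), (- 1, 0, 1, 2, 3, 13)]), (25605, [(1, 2, 3, 5, 6, 14), (2, 2, 3, 5,
   6, 13), (- 1, 2, 3, 5, 6, 12)]), (24502, [(1, 2, 4, 5, 6, 14), (2, 2, 4, 5, 6, 13), (3, 2, 4, 5,
   6, 12)]), (14502, [(3, 1, 4, 5, 6, 14), (2, 1, 4, 5, 6, 13), (1, 1, 4, 5, 6, 12)]), (34509, [(1,
   0, 3, 4, 5, 14), (3, 0, 3, 4, 5, 12), (2, 0, 3, 4, 5, 13)]), (24507, [(2, 0, 1, 2, 4, 13), (2, 0,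
   1, 2, 5, 7), (- 2, 0, 2, 3, 5, 2), (- 2, 1, 2, 4, 5, 3), (1, 0, 1, 2, 4, 14), (- 1, 0, 1, 2, 4,
   12), (2, 2, 3, 5, 6, 8), (- 2, 2, 3, 4, 5, 3), (- 2, 2, 4, 5, 6, 12)]), (5607, [(2, 1, 2, 5, 6,
   8), (- 2, 1, 2, 4, 5, 3), (2, 1, 2, 4, 6, 5), (2, 0, 2, 5, 6, 12), (2, 0, 2, 3, 5, 3), (1, 1, 2,
   5, 6, 4), (1, 0, 1, 5, 6, 3), (- 2, 2, 3, 5, 6, 8), (2, 2, 3, 4, 5, 3), (2, 2, 4, 5, 6, 12)]),
   (3507, [(1, 0, 3, 5, 6, 14), (- 2, 0, 3, 5, 6, 13), (- 1, 0, 3, 5, 6, 12)]), (12307, [(1, 1, 2, 5,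
   6, 1), (- 1, 0, 1, 2, 6, 11), (1, 0, 1, 5, 6, 12), (- 1, 0, 1, 5, 6, 13), (1, 0, 1, 4, 6, 4), (-
   1, 0, 1, 3, 6, 5), (1, 1, 2, 3, 5, 4), (1, 0, 1, 3, 5, 3)]), (12605, [(1, 1, 2, 3, 6, 14), (2, 1,
   2, 5, 6, 4), (2, 0, 1, 5, 6, 3), (2, 1, 2, 3, 6, 13), (- 1, 1, 2, 3, 6, 12)]), (25606, [(1, 1, 2,
   5, 6, 14), (4, 1, 2, 3, 5, 3), (2, 1, 2, 5, 6, 13), (3, 1, 2, 5, 6, 12)]), (4607, [(1, 0, 3, 5, 6,
   5), (- 1, 0, 2, 3, 6, 4), (- 1, 0, 4, 5, 6, 4), (1, 0, 2, 5, 6, 11)]), (23406, [(1, 1, 2, 3, 4,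
   14), (3, 1, 2, 3, 4, 12), (2, 1, 2, 3, 4, 13)]), (2508, [(1, 0, 2, 5, 6, 1), (1, 0, 1, 5, 6, 8),
   (- 1, 0, 1, 2, 5, 4), (- 1, 0, 1, 2, 5, 9), (1, 1, 2, 5, 6, 2)]), (2408, [(1, 0, 3, 4, 6, 8), (1,
   0, 2, 3, 4, 9), (- 1, 0, 2, 3, 6, 11), (1, 0, 2, 4, 6, 10), (- 1, 2, 3, 4, 6, 2), (1, 0, 2, 3, 6,
   7), (1, 0, 2, 4, 6, 4), (1, 0, 2, 3, 4, 4)]), (1407, [(1, 0, 1, 3, 5, 5), (- 1, 0, 1, 2, 3, 4),
   (1, 0, 1, 2, 5, 11), (- 1, 0, 1, 4, 5, 4)]), (23508, [(1, 0, 1, 3, 5, 7), (- 1, 0, 3, 4, 5, 1),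
   (2, 1, 2, 3, 5, 9), (1, 1, 3, 4, 5, 3), (1, 0, 1, 3, 4, 13), (- 3, 0, 1, 4, 5, 10), (- 1, 0, 1, 3,
   4, 12), (1, 0, 1, 3, 4, 14), (1, 0, 1, 4, 5, 4)]), (35606, [(4, 1, 3, 4, 6, 6), (- 4, 0, 1, 3, 6,
   10), (- 4, 0, 3, 4, 6, 9), (4, 2, 3, 4, 6, 11), (- 4, 1, 3, 4, 6, 10), (- 4, 1, 3, 4, 6, 1), (4,
   1, 4, 5, 6, 11), (- 4, 2, 3, 5, 6, 10), (2, 1, 3, 5, 6, 14), (- 2, 1, 3, 5, 6, 12), (1, 3, 4, 5,
   6, 14), (- 2, 3, 4, 5, 6, 13), (- 1, 3, 4, 5, 6, 12), (- 4, 1, 3, 4, 5, 3), (- 4, 1, 2, 3, 5, 9),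
   (4, 1, 4, 5, 6, 3), (- 4, 1, 2, 5, 6, 9)]), (3604, [(1, 0, 3, 4, 6, 13), (1, 0, 3, 5, 6, 11), (-
   1, 3, 4, 5, 6, 2), (1, 0, 3, 4, 5, 9), (- 1, 0, 4, 5, 6, 10), (- 1, 0, 3, 5, 6, 7), (1, 0, 3, 4,
   5, 4), (- 1, 0, 4, 5, 6, 4)]), (12408, [(4, 0, 3, 5, 6, 2), (- 4, 2, 3, 5, 6, 4), (4, 1, 2, 5, 6,
   9), (4, 0, 1, 3, 5, 6), (4, 0, 2, 3, 5, 11), (2, 1, 2, 3, 5, 13), (5, 1, 2, 3, 5, 12), (3, 1, 2,
   3, 5, 14), (4, 1, 2, 5, 6, 12), (4, 1, 2, 3, 5, 3), (4, 0, 1, 2, 6, 10), (- 4, 1, 2, 3, 6, 3), (4,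
   1, 2, 4, 6, 1), (4, 0, 1, 5, 6, 7), (- 4, 0, 1, 4, 5, 4), (- 4, 0, 1, 3, 6, 8), (- 4, 0, 2, 3, 6,
   1), (4, 0, 1, 2, 3, 4)]), (24607, [(1, 0, 1, 4, 6, 8), (1, 0, 2, 4, 6, 1), (- 1, 0, 1, 2, 4, 9),
   (- 1, 0, 1, 2, 6, 7), (1, 1, 2, 4, 6, 3), (- 1, 0, 1, 2, 4, 4), (1, 1, 2, 4, 6, 2), (1, 0, 1, 2,
   6, 11)]), (25614, [(2, 0, 1, 4, 5, 6), (- 2, 0, 1, 2, 4, 9), (- 2, 1, 2, 4, 5, 13), (- 4, 1, 2, 4,
   5, 12), (2, 0, 2, 4, 5, 11), (- 2, 1, 2, 3, 5, 4), (- 2, 0, 1, 3, 5, 3), (2, 1, 2, 4, 6, 2), (2,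
   0, 1, 2, 6, 11), (- 2, 0, 1, 4, 6, 4), (2, 0, 1, 3, 6, 5), (2, 0, 4, 5, 6, 2), (- 2, 0, 1, 5, 6,
   13), (3, 0, 2, 5, 6, 9), (- 3, 0, 4, 5, 6, 3), (- 2, 1, 2, 5, 6, 6), (- 2, 1, 2, 4, 6, 3), (1, 2,
   4, 5, 6, 4)]), (24606, [(2, 0, 1, 4, 5, 7), (2, 0, 3, 4, 5, 2), (2, 1, 2, 4, 5, 9), (2, 0, 1, 3,
   5, 12), (- 4, 0, 1, 2, 4, 10), (- 4, 1, 2, 3, 4, 2), (- 4, 1, 2, 3, 5, 1), (- 2, 1, 2, 4, 6, 13),
   (- 3, 1, 2, 4, 6, 12), (- 1, 1, 2, 4, 6, 14), (- 2, 0, 3, 4, 5, 3), (- 2, 0, 2, 3, 5, 9), (2, 0,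
   4, 5, 6, 12), (1, 0, 4, 5, 6, 13), (- 2, 2, 4, 5, 6, 1), (2, 2, 3, 5, 6, 2)]), (23407, [(2, 0, 1,
   3, 4, 8), (2, 0, 1, 2, 3, 7), (2, 0, 2, 3, 4, 1), (2, 1, 2, 3, 4, 3), (2, 0, 1, 2, 4, 4), (- 2, 0,
   1, 2, 3, 11), (2, 0, 1, 2, 4, 10), (2, 1, 2, 3, 4, 2), (2, 1, 2, 4, 6, 13), (3, 1, 2, 4, 6, 12),
   (1, 1, 2, 4, 6, 14)]), (24508, [(2, 3, 4, 5, 6, 8), (2, 2, 4, 5, 6, 10), (- 2, 2, 3, 5, 6, 11), (-
   3, 0, 2, 5, 6, 9), (3, 0, 4, 5, 6, 3), (- 1, 2, 3, 4, 6, 14), (1, 2, 3, 4, 6, 12), (2, 1, 2, 5, 6,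
   6), (2, 1, 2, 4, 6, 3), (- 1, 2, 4, 5, 6, 4), (- 2, 0, 3, 4, 5, 3), (- 2, 0, 2, 3, 5, 9), (2, 0,
   4, 5, 6, 12), (1, 0, 4, 5, 6, 13), (- 2, 2, 4, 5, 6, 1), (2, 2, 3, 5, 6, 2)]), (13514, [(2, 1, 3,
   4, 5, 4), (14, 1, 4, 5, 6, 10), (4, 1, 2, 3, 5, 11), (2, 1, 3, 4, 6, 13), (- 8, 1, 3, 4, 6, 14),
   (8, 1, 3, 4, 6, 12), (- 10, 0, 3, 5, 6, 10), (10, 0, 3, 4, 6, 11), (8, 3, 4, 5, 6, 1), (11, 0, 1,
   3, 5, 9), (2, 1, 3, 5, 6, 7), (- 2, 0, 1, 5, 6, 9), (4, 1, 3, 4, 5, 8), (4, 1, 2, 4, 5, 10), (4,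
   1, 2, 3, 4, 13), (8, 1, 2, 3, 4, 12), (4, 0, 1, 2, 5, 9), (- 4, 0, 1, 4, 5, 3), (- 4, 1, 2, 5, 6,
   2), (- 2, 0, 3, 5, 6, 8), (- 2, 0, 2, 3, 5, 4), (- 2, 0, 2, 3, 5, 9), (- 2, 0, 2, 3, 6, 13), (- 2,
   0, 2, 3, 6, 14), (2, 0, 2, 3, 6, 12), (- 2, 0, 2, 5, 6, 10), (2, 2, 3, 5, 6, 2), (4, 0, 2, 3, 5,
   10), (4, 2, 3, 4, 5, 1), (4, 0, 3, 4, 5, 13), (4, 0, 3, 4, 5, 12), (4, 0, 2, 3, 4, 7), (- 4, 2, 3,
   4, 5, 6), (4, 0, 2, 4, 6, 7), (3, 0, 1, 5, 6, 10), (3, 1, 3, 5, 6, 3), (- 15, 1, 3, 5, 6, 2), (-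
   3, 0, 3, 5, 6, 1), (- 3, 0, 1, 3, 6, 13), (- 3, 0, 1, 3, 5, 4), (- 3, 0, 1, 3, 6, 14), (3, 0, 1,
   3, 6, 12), (12, 1, 4, 5, 6, 1), (- 12, 0, 1, 4, 6, 11)]), (13512, [(1, 0, 1, 5, 6, 10), (1, 1, 3,
   5, 6, 3), (- 5, 1, 3, 5, 6, 2), (- 1, 0, 3, 5, 6, 1), (1, 0, 1, 3, 5, 9), (- 1, 0, 1, 3, 6, 13),
   (- 1, 0, 1, 3, 5, 4), (- 1, 0, 1, 3, 6, 14), (1, 0, 1, 3, 6, 12), (4, 1, 4, 5, 6, 1), (- 4, 0, 1,
   4, 6, 11), (4, 1, 4, 5, 6, 10), (- 2, 1, 3, 4, 6, 14), (2, 1, 3, 4, 6, 12), (- 2, 0, 3, 5, 6, 10),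
   (2, 0, 3, 4, 6, 11), (2, 3, 4, 5, 6, 1)]), (23514, [(6, 0, 2, 3, 5, 10), (6, 2, 3, 4, 5, 1), (6,
   0, 3, 4, 5, 13), (6, 0, 3, 4, 5, 12), (6, 0, 1, 3, 5, 9), (6, 0, 2, 3, 4, 7), (- 6, 2, 3, 4, 5,
   6), (6, 0, 2, 4, 6, 7), (6, 0, 2, 5, 6, 10), (- 2, 0, 4, 5, 6, 13), (- 4, 2, 3, 5, 6, 2), (2, 2,
   3, 4, 5, 4), (- 2, 0, 3, 4, 5, 3), (- 2, 0, 2, 3, 5, 9), (2, 0, 4, 5, 6, 12), (- 2, 2, 4, 5, 6,
   1), (4, 1, 2, 3, 5, 6), (4, 1, 2, 3, 4, 3), (2, 1, 2, 4, 6, 13), (3, 1, 2, 4, 6, 12), (1, 1, 2, 4,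
   6, 14)]), (3414, [(12, 0, 3, 4, 6, 7), (12, 0, 3, 4, 6, 11), (12, 0, 2, 4, 6, 11), (12, 0, 3, 4,
   6, 5), (6, 0, 3, 5, 6, 4), (- 12, 0, 2, 3, 6, 14), (12, 0, 2, 3, 6, 12), (12, 0, 1, 3, 4, 6), (-
   3, 0, 1, 3, 6, 12), (- 12, 1, 2, 3, 6, 1), (- 6, 0, 1, 3, 6, 13), (- 9, 0, 1, 3, 6, 14), (36, 0,
   2, 3, 4, 7), (- 36, 2, 3, 4, 5, 6), (36, 0, 2, 3, 4, 11), (- 36, 2, 3, 5, 6, 12), (36, 0, 2, 4, 6,
   7), (- 6, 1, 2, 5, 6, 7), (- 6, 1, 2, 3, 5, 7), (- 6, 2, 3, 4, 5, 1), (- 12, 1, 2, 3, 4, 12), (10,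
   2, 3, 5, 6, 2), (- 12, 1, 2, 3, 4, 13), (- 8, 1, 2, 4, 6, 13), (- 4, 1, 2, 4, 6, 14), (- 6, 0, 2,
   5, 6, 10), (12, 1, 4, 5, 6, 1), (- 12, 0, 1, 4, 6, 11), (12, 1, 4, 5, 6, 10), (- 12, 1, 3, 5, 6,
   2), (- 6, 1, 3, 4, 6, 14), (6, 1, 3, 4, 6, 12), (- 6, 0, 3, 5, 6, 8), (- 6, 0, 2, 3, 5, 4), (- 4,
   0, 2, 3, 5, 9), (- 6, 0, 2, 3, 6, 13), (- 2, 2, 3, 4, 5, 4), (2, 0, 3, 4, 5, 3), (- 2, 0, 4, 5, 6,
   12), (- 1, 0, 4, 5, 6, 13), (2, 2, 4, 5, 6, 1), (- 4, 1, 2, 3, 5, 6), (- 4, 1, 2, 3, 4, 3)]),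
   (23512, [(2, 2, 3, 4, 5, 4), (- 2, 0, 3, 4, 5, 3), (- 2, 0, 2, 3, 5, 9), (2, 0, 4, 5, 6, 12), (1,
   0, 4, 5, 6, 13), (- 2, 2, 4, 5, 6, 1), (2, 2, 3, 5, 6, 2), (4, 1, 2, 3, 5, 6), (4, 1, 2, 3, 4, 3),
   (2, 1, 2, 4, 6, 13), (3, 1, 2, 4, 6, 12), (1, 1, 2, 4, 6, 14)]), (4507, [(1, 0, 3, 5, 6, 8), (1,
   0, 2, 3, 5, 4), (1, 0, 2, 3, 5, 9), (- 1, 0, 4, 5, 6, 13), (1, 0, 2, 3, 6, 13), (1, 0, 2, 3, 6,
   14), (- 1, 0, 2, 3, 6, 12), (3, 0, 2, 5, 6, 10), (- 3, 2, 3, 5, 6, 2)]), (23513, [(4, 1, 2, 3, 5,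
   6), (4, 1, 2, 3, 4, 3), (2, 1, 2, 4, 6, 13), (3, 1, 2, 4, 6, 12), (1, 1, 2, 4, 6, 14)]), (34510,
   [(2, 0, 3, 4, 5, 3), (2, 0, 2, 3, 5, 9), (- 2, 0, 4, 5, 6, 12), (- 1, 0, 4, 5, 6, 13), (2, 2, 4,
   5, 6, 1), (- 2, 2, 3, 5, 6, 2)]), (12308, [(1, 1, 3, 4, 5, 8), (1, 1, 2, 4, 5, 10), (- 1, 1, 2, 3,
   5, 11), (1, 1, 2, 3, 4, 13), (2, 1, 2, 3, 4, 12), (1, 0, 1, 2, 5, 9), (- 1, 0, 1, 4, 5, 3), (- 1,
   1, 2, 5, 6, 2)]), (13604, [(2, 1, 3, 5, 6, 7), (- 1, 3, 4, 5, 6, 1), (- 2, 0, 1, 5, 6, 9), (4, 1,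
   2, 3, 5, 11), (- 1, 0, 3, 5, 6, 10), (1, 0, 3, 4, 6, 11), (1, 0, 1, 3, 5, 9)]), (23604, [(2, 2, 3,
   5, 6, 7), (3, 2, 4, 5, 6, 4), (3, 0, 2, 5, 6, 9), (- 3, 0, 4, 5, 6, 3), (- 2, 1, 2, 5, 6, 6), (-
   2, 1, 2, 4, 6, 3)]), (25612, [(2, 1, 2, 5, 6, 6), (2, 1, 2, 4, 6, 3), (- 1, 2, 4, 5, 6, 4), (- 1,
   0, 2, 5, 6, 9), (1, 0, 4, 5, 6, 3)]), (4514, [(1, 0, 3, 4, 5, 5), (1, 0, 2, 3, 5, 13), (- 1, 0, 2,
   4, 5, 11), (1, 0, 2, 3, 6, 7), (1, 0, 2, 4, 6, 4), (- 1, 0, 4, 5, 6, 5), (1, 0, 2, 3, 4, 4), (1,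
   0, 4, 5, 6, 2), (- 1, 0, 1, 5, 6, 13), (1, 0, 2, 5, 6, 9), (- 1, 0, 4, 5, 6, 3)]), (4512, [(1, 0,
   4, 5, 6, 2), (- 1, 0, 1, 5, 6, 13), (1, 0, 2, 5, 6, 9), (- 1, 0, 4, 5, 6, 3)]), (12414, [(1, 0, 4,
   5, 6, 7), (- 2, 0, 2, 4, 6, 10), (- 1, 0, 3, 5, 6, 13), (2, 0, 2, 4, 5, 11), (2, 1, 2, 4, 6, 7),
   (- 4, 1, 2, 3, 4, 5), (2, 1, 2, 4, 6, 2), (2, 0, 1, 2, 6, 11), (- 2, 0, 1, 4, 6, 4), (2, 0, 1, 3,
   6, 5)]), (3408, [(12, 0, 3, 4, 5, 7), (12, 0, 3, 4, 5, 11), (24, 0, 2, 3, 4, 10), (6, 1, 3, 4, 5,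
   13), (21, 1, 3, 4, 5, 12), (15, 1, 3, 4, 5, 14), (24, 0, 2, 4, 5, 11), (- 24, 1, 2, 3, 4, 7), (-
   24, 1, 2, 3, 5, 10), (- 48, 1, 2, 3, 4, 5), (8, 1, 4, 5, 6, 13), (- 24, 1, 2, 5, 6, 10), (- 8, 1,
   4, 5, 6, 12), (24, 1, 2, 4, 6, 2), (24, 0, 1, 2, 6, 11), (- 24, 0, 1, 4, 6, 4), (24, 0, 1, 3, 6,
   5), (18, 2, 3, 4, 6, 12), (12, 2, 3, 4, 6, 13), (6, 2, 3, 4, 6, 14)]), (24605, [(2, 2, 3, 4, 6,
   13), (1, 2, 3, 4, 6, 14), (- 1, 2, 3, 4, 6, 12)]), (34611, [(1, 2, 3, 4, 6, 14), (- 1, 2, 3, 4, 6,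
   12)]), (23402, [(1, 2, 3, 4, 6, 12)]), (2314, [(6, 2, 3, 5, 6, 5), (6, 0, 2, 3, 6, 2), (4, 0, 1,
   2, 3, 6), (- 3, 2, 4, 5, 6, 4), (- 3, 0, 2, 5, 6, 9), (3, 0, 4, 5, 6, 3), (- 2, 0, 2, 3, 6, 7), (-
   2, 0, 2, 4, 6, 4), (2, 0, 4, 5, 6, 5)]), (12412, [(1, 1, 2, 4, 6, 2), (1, 0, 1, 2, 6, 11), (- 1,
   0, 1, 4, 6, 4), (1, 0, 1, 3, 6, 5)]), (34606, [(1, 0, 3, 5, 6, 10), (- 1, 0, 3, 4, 6, 11), (- 1,
   3, 4, 5, 6, 1), (- 1, 0, 1, 3, 5, 9)]), (1605, [(2, 1, 4, 5, 6, 1), (- 2, 0, 1, 4, 6, 11), (2, 1,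
   4, 5, 6, 10), (- 2, 1, 3, 5, 6, 2), (- 1, 1, 3, 4, 6, 14), (1, 1, 3, 4, 6, 12)]), (13410, [(4, 1,
   3, 4, 5, 5), (4, 1, 2, 4, 5, 11), (4, 1, 4, 5, 6, 7), (- 8, 1, 2, 4, 6, 10), (- 3, 1, 2, 3, 5,
   12), (2, 1, 2, 3, 5, 13), (- 1, 1, 2, 3, 5, 14), (2, 1, 3, 5, 6, 13), (- 3, 1, 3, 5, 6, 14), (3,
   1, 3, 5, 6, 12), (- 4, 1, 4, 5, 6, 5), (4, 1, 2, 5, 6, 13), (4, 3, 4, 5, 6, 2), (- 4, 0, 3, 4, 5,
   9)]), (23414, [(4, 2, 3, 4, 6, 7), (8, 1, 2, 3, 4, 6), (- 12, 2, 3, 4, 6, 2), (4, 2, 3, 4, 6, 5),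
   (4, 2, 3, 5, 6, 10), (4, 1, 2, 4, 6, 6), (10, 1, 2, 3, 6, 3), (4, 0, 4, 5, 6, 6), (- 4, 0, 3, 5,
   6, 3), (- 4, 0, 2, 4, 6, 9), (4, 2, 3, 5, 6, 4), (4, 2, 4, 5, 6, 13), (8, 2, 4, 5, 6, 12), (12, 1,
   2, 4, 6, 7), (- 24, 1, 2, 3, 4, 5), (12, 1, 2, 3, 6, 12), (- 6, 1, 2, 5, 6, 4), (- 6, 0, 1, 5, 6,
   3), (- 10, 0, 1, 3, 4, 14), (20, 0, 1, 2, 3, 10), (- 20, 1, 2, 3, 4, 1), (- 10, 0, 1, 3, 4, 12),
   (- 14, 0, 1, 2, 6, 10), (- 20, 1, 2, 4, 6, 1), (- 1, 3, 4, 5, 6, 14), (2, 3, 4, 5, 6, 13), (1, 3,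
   4, 5, 6, 12), (4, 1, 3, 4, 5, 3), (4, 1, 2, 3, 5, 9), (- 4, 1, 4, 5, 6, 3), (4, 1, 2, 5, 6, 9), (-
   5, 0, 1, 4, 6, 12), (- 12, 0, 1, 3, 4, 3), (- 2, 0, 1, 4, 6, 13), (6, 0, 3, 5, 6, 7), (- 6, 0, 3,
   4, 5, 4), (6, 0, 4, 5, 6, 4), (- 6, 0, 1, 3, 6, 8), (- 6, 0, 2, 3, 6, 1), (6, 0, 1, 2, 3, 4), (6,
   1, 2, 3, 6, 2), (- 6, 0, 1, 2, 3, 9), (- 7, 0, 1, 4, 6, 14)]), (2308, [(3, 0, 1, 4, 6, 14), (4, 0,
   1, 3, 4, 3), (2, 0, 1, 4, 6, 13), (1, 0, 1, 4, 6, 12), (- 2, 0, 3, 5, 6, 7), (2, 0, 3, 4, 5, 4),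
   (- 2, 0, 4, 5, 6, 4), (- 4, 1, 2, 3, 6, 2), (4, 1, 2, 4, 6, 1), (4, 0, 1, 2, 3, 9)]), (34609, [(1,
   1, 3, 4, 6, 8), (- 1, 1, 2, 3, 6, 11), (1, 1, 2, 3, 4, 9), (1, 1, 2, 4, 6, 10), (- 1, 2, 3, 4, 6,
   1), (- 1, 1, 2, 3, 6, 7), (- 1, 1, 2, 4, 6, 4), (- 1, 1, 2, 3, 4, 4)]), (2608, [(1, 1, 2, 3, 6,
   7), (- 1, 0, 2, 3, 6, 10), (1, 1, 2, 4, 6, 4), (1, 1, 2, 3, 4, 4)]), (1301, [(1, 1, 2, 3, 6, 2),
   (- 1, 1, 2, 4, 6, 1), (- 1, 0, 1, 2, 3, 9)]), (12313, [(1, 1, 2, 3, 4, 4), (1, 0, 1, 2, 3, 9)]),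
   (1208, [(1, 0, 1, 3, 6, 8), (1, 0, 2, 3, 6, 1), (- 1, 0, 1, 2, 3, 4), (1, 0, 1, 2, 6, 10), (- 1,
   1, 2, 3, 6, 3), (1, 1, 2, 4, 6, 1)]), (3407, [(1, 0, 3, 5, 6, 7), (- 1, 0, 3, 4, 5, 4), (1, 0, 4,
   5, 6, 4)]), (1604, [(1, 0, 1, 4, 6, 12), (1, 0, 1, 3, 4, 3), (- 1, 0, 1, 4, 6, 13)]), (25608, [(1,
   0, 1, 5, 6, 7), (2, 1, 2, 5, 6, 9), (1, 0, 4, 5, 6, 1), (- 1, 1, 4, 5, 6, 3), (- 1, 0, 1, 4, 6,
   13), (- 1, 0, 1, 4, 5, 4)]), (3402, [(1, 0, 3, 4, 6, 12), (1, 3, 4, 5, 6, 2), (- 1, 0, 3, 4, 5,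
   9), (1, 0, 4, 5, 6, 10)]), (35604, [(1, 3, 4, 5, 6, 14), (- 2, 3, 4, 5, 6, 13), (- 1, 3, 4, 5, 6,
   12), (- 4, 1, 3, 4, 5, 3), (- 4, 1, 2, 3, 5, 9), (4, 1, 4, 5, 6, 3), (- 4, 1, 2, 5, 6, 9)]),
   (1514, [(1, 0, 1, 4, 5, 4), (- 2, 0, 1, 2, 5, 11), (- 1, 0, 1, 5, 6, 2), (1, 0, 1, 5, 6, 3)]),
   (2605, [(2, 0, 2, 5, 6, 10), (- 1, 0, 4, 5, 6, 13), (- 2, 2, 3, 5, 6, 2)]), (13411, [(2, 1, 2, 5,
   6, 7), (- 1, 1, 2, 4, 6, 12), (2, 1, 2, 3, 5, 7), (2, 2, 3, 4, 5, 1), (4, 1, 2, 3, 4, 12), (- 2,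
   2, 3, 5, 6, 2), (4, 1, 2, 3, 4, 13), (2, 1, 2, 4, 6, 13), (1, 1, 2, 4, 6, 14)]), (12402, [(2, 1,
   2, 4, 6, 13), (3, 1, 2, 4, 6, 12), (1, 1, 2, 4, 6, 14)]), (4614, [(2, 0, 1, 4, 6, 6), (- 2, 0, 1,
   3, 6, 3), (- 2, 1, 2, 3, 6, 4), (4, 0, 2, 4, 6, 11), (- 2, 0, 3, 4, 6, 5), (1, 0, 2, 3, 6, 14), (-
   1, 0, 2, 3, 6, 12), (1, 1, 2, 4, 6, 14), (- 1, 1, 2, 4, 6, 12)]), (14611, [(1, 1, 2, 4, 6, 14),
   (2, 1, 2, 3, 6, 10), (- 1, 1, 2, 4, 6, 12)]), (3413, [(1, 0, 2, 3, 4, 7), (- 1, 2, 3, 4, 5, 6),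
   (1, 0, 2, 3, 4, 11), (- 1, 2, 3, 5, 6, 12), (1, 0, 2, 4, 6, 7)]), (3412, [(4, 0, 1, 3, 4, 6), (-
   1, 0, 1, 3, 6, 12), (- 4, 1, 2, 3, 6, 1), (- 2, 0, 1, 3, 6, 13), (- 3, 0, 1, 3, 6, 14)]), (23607,
   [(1, 0, 1, 2, 6, 10), (- 1, 1, 2, 3, 6, 3), (1, 1, 2, 4, 6, 1)]), (2513, [(1, 0, 4, 5, 6, 8), (1,
   0, 2, 4, 5, 9), (1, 0, 2, 4, 6, 14), (- 1, 0, 2, 4, 6, 12), (1, 0, 2, 4, 5, 4), (- 2, 0, 2, 5, 6,
   2), (1, 0, 2, 5, 6, 11), (- 1, 2, 4, 5, 6, 2), (1, 0, 2, 4, 6, 13), (1, 0, 2, 5, 6, 7)]), (2407,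
   [(2, 0, 2, 4, 6, 13), (1, 0, 2, 4, 6, 14), (- 1, 0, 2, 4, 6, 12), (2, 0, 2, 5, 6, 7), (- 2, 0, 2,
   5, 6, 2)]), (23410, [(4, 1, 2, 4, 6, 8), (4, 0, 2, 4, 6, 12), (6, 0, 2, 3, 4, 2), (- 6, 0, 1, 2,
   4, 7), (- 3, 0, 2, 5, 6, 7), (3, 0, 2, 5, 6, 2), (4, 1, 2, 4, 6, 4), (- 4, 1, 2, 3, 6, 5), (- 2,
   0, 1, 2, 5, 6), (- 2, 0, 1, 2, 4, 3), (- 2, 1, 2, 4, 5, 5), (- 2, 0, 2, 3, 5, 5), (2, 0, 2, 3, 6,
   8), (4, 0, 2, 3, 4, 3), (2, 1, 2, 5, 6, 12), (4, 2, 3, 4, 6, 8), (- 4, 2, 3, 4, 5, 6), (- 4, 2, 3,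
   5, 6, 12), (2, 2, 4, 5, 6, 7), (4, 0, 2, 3, 6, 9), (- 4, 0, 3, 5, 6, 6), (- 4, 1, 2, 3, 6, 6), (-
   4, 2, 3, 5, 6, 13), (- 2, 2, 4, 5, 6, 2), (2, 2, 3, 4, 5, 5), (2, 0, 2, 3, 5, 6), (2, 1, 2, 4, 5,
   6)]), (2402, [(2, 2, 3, 4, 6, 8), (- 2, 2, 3, 4, 5, 6), (- 2, 2, 3, 5, 6, 12), (1, 2, 4, 5, 6, 7),
   (2, 0, 2, 3, 6, 9), (- 2, 0, 3, 5, 6, 6), (- 2, 1, 2, 3, 6, 6), (- 2, 2, 3, 5, 6, 13), (- 1, 2, 4,
   5, 6, 2), (1, 2, 3, 4, 5, 5), (1, 0, 2, 3, 5, 6), (1, 0, 2, 3, 4, 3), (1, 1, 2, 4, 5, 6), (- 1, 1,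
   2, 3, 5, 3), (1, 0, 2, 3, 4, 2), (- 1, 0, 1, 2, 4, 7)]), (4605, [(1, 3, 4, 5, 6, 2), (- 1, 0, 3,
   4, 5, 9), (1, 0, 4, 5, 6, 10)]), (23614, [(4, 0, 3, 4, 6, 2), (- 4, 2, 3, 4, 6, 4), (- 8, 1, 2, 3,
   6, 6), (12, 0, 2, 3, 6, 9), (- 12, 0, 3, 5, 6, 6), (- 12, 2, 3, 5, 6, 13), (4, 0, 1, 4, 6, 7), (4,
   1, 2, 4, 6, 9), (- 4, 0, 1, 3, 4, 5), (4, 0, 1, 3, 5, 4), (- 4, 0, 1, 2, 3, 13), (- 4, 0, 1, 2, 4,
   11), (- 4, 1, 2, 4, 5, 1), (4, 0, 1, 4, 5, 13), (- 4, 0, 1, 4, 5, 12), (6, 0, 1, 3, 6, 13), (1, 0,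
   1, 3, 6, 14), (- 1, 0, 1, 3, 6, 12)]), (3606, [(1, 0, 1, 3, 6, 14), (- 1, 0, 1, 3, 6, 12)]),
   (1302, [(2, 0, 1, 3, 6, 12), (2, 1, 2, 3, 6, 1), (1, 0, 1, 3, 6, 13)]), (1508, [(1, 0, 1, 3, 6,
   13), (1, 0, 1, 3, 5, 4)]), (3410, [(1, 0, 2, 3, 6, 7), (1, 0, 2, 4, 6, 4), (- 1, 0, 4, 5, 6, 5),
   (1, 0, 2, 3, 4, 4)]), (14510, [(1, 0, 1, 2, 5, 9), (- 1, 0, 1, 4, 5, 3), (- 1, 1, 2, 5, 6, 2)]),
   (12405, [(1, 1, 2, 3, 4, 13), (2, 1, 2, 3, 4, 12)]), (12410, [(2, 0, 1, 2, 5, 6), (2, 0, 1, 2, 4,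
   3), (2, 1, 2, 4, 5, 5), (- 1, 0, 2, 5, 6, 2), (2, 0, 2, 3, 5, 5), (- 2, 0, 2, 3, 6, 8), (- 2, 0,
   2, 3, 4, 3), (1, 0, 2, 5, 6, 7), (- 2, 1, 2, 5, 6, 12), (- 2, 1, 2, 3, 5, 3)]), (4612, [(2, 0, 3,
   4, 6, 5), (1, 0, 3, 5, 6, 4), (- 1, 0, 2, 3, 6, 14), (1, 0, 2, 3, 6, 12), (- 2, 0, 2, 4, 6, 11)]),
   (12302, [(1, 0, 1, 3, 4, 14), (- 2, 0, 1, 2, 3, 10), (2, 1, 2, 3, 4, 1), (1, 0, 1, 3, 4, 12)]),
   (3406, [(1, 0, 1, 3, 4, 12), (1, 0, 1, 4, 5, 10), (- 1, 0, 1, 2, 3, 10), (1, 1, 2, 3, 4, 1)]),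
   (24608, [(1, 1, 4, 5, 6, 6), (- 1, 1, 2, 4, 6, 9), (- 1, 1, 3, 5, 6, 3), (- 1, 0, 4, 5, 6, 9), (1,
   2, 4, 5, 6, 11), (1, 0, 3, 5, 6, 1), (1, 0, 1, 3, 5, 9)]), (4603, [(2, 0, 1, 4, 6, 7), (2, 1, 2,
   4, 6, 9), (- 2, 0, 1, 3, 4, 5), (- 1, 0, 1, 3, 5, 4), (- 2, 0, 1, 2, 3, 13), (- 2, 0, 1, 2, 4,
   11), (- 2, 1, 2, 4, 5, 1), (2, 0, 1, 4, 5, 13), (- 2, 0, 1, 4, 5, 12)]), (3513, [(4, 0, 1, 3, 5,
   6), (4, 0, 3, 4, 5, 4), (4, 0, 2, 3, 5, 11), (2, 1, 2, 3, 5, 13), (5, 1, 2, 3, 5, 12), (3, 1, 2,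
   3, 5, 14), (4, 1, 2, 5, 6, 12), (4, 1, 2, 3, 5, 3)]), (5614, [(1, 0, 1, 5, 6, 6), (1, 0, 1, 4, 6,
   3), (- 1, 1, 2, 5, 6, 13), (- 1, 0, 4, 5, 6, 4), (3, 0, 2, 5, 6, 11), (- 2, 1, 2, 5, 6, 12), (- 2,
   1, 2, 3, 5, 3)]), (12507, [(1, 1, 2, 5, 6, 12), (1, 1, 2, 3, 5, 3)]), (1414, [(2, 0, 1, 4, 6, 2),
   (2, 0, 1, 5, 6, 1), (2, 1, 4, 5, 6, 5), (- 2, 1, 2, 5, 6, 13), (- 2, 0, 1, 3, 4, 5), (- 1, 0, 1,
   3, 5, 4), (- 2, 0, 1, 2, 3, 13), (2, 0, 1, 2, 4, 11), (2, 1, 2, 4, 5, 1), (- 2, 0, 1, 4, 5, 13),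
   (2, 0, 1, 4, 5, 12)]), (1413, [(1, 0, 1, 2, 4, 11), (1, 1, 2, 4, 5, 1), (- 1, 0, 1, 4, 5, 13), (1,
   0, 1, 4, 5, 12)]), (25613, [(1, 2, 4, 5, 6, 4), (1, 0, 2, 5, 6, 9), (- 1, 0, 4, 5, 6, 3)]),
   (23403, [(6, 1, 2, 3, 4, 7), (6, 1, 2, 3, 5, 10), (- 3, 1, 3, 4, 5, 14), (- 3, 1, 3, 4, 5, 12),
   (12, 1, 2, 3, 4, 5), (- 2, 1, 4, 5, 6, 13), (6, 1, 2, 5, 6, 10), (2, 1, 4, 5, 6, 12)]), (23606,
   [(2, 1, 2, 3, 6, 12), (- 1, 1, 2, 5, 6, 4), (- 1, 0, 1, 5, 6, 3)]), (12508, [(1, 1, 3, 5, 6, 8),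
   (- 2, 0, 1, 5, 6, 3), (1, 1, 2, 3, 5, 9), (1, 1, 2, 5, 6, 10), (1, 2, 3, 5, 6, 1), (1, 1, 2, 3, 5,
   4), (- 1, 1, 2, 3, 6, 13), (- 1, 1, 2, 5, 6, 4)]), (13611, [(1, 1, 2, 3, 6, 13), (1, 1, 2, 5, 6,
   4), (1, 0, 1, 5, 6, 3)]), (24603, [(1, 1, 2, 4, 6, 7), (- 2, 1, 2, 3, 4, 5)]), (1502, [(1, 1, 2,
   3, 5, 4), (1, 0, 1, 3, 5, 3)]), (1512, [(1, 0, 1, 5, 6, 2), (- 1, 0, 1, 5, 6, 3)]), (1513, [(1, 0,
   1, 2, 5, 11)]), (3502, [(1, 0, 3, 5, 6, 12), (- 1, 2, 3, 5, 6, 1), (1, 0, 3, 5, 6, 13)]), (2406,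
   [(2, 0, 2, 4, 5, 1), (2, 0, 1, 4, 5, 8), (- 2, 0, 2, 3, 5, 2), (1, 0, 1, 2, 4, 14), (- 1, 0, 1, 2,
   4, 12), (2, 2, 3, 5, 6, 8), (- 2, 2, 3, 4, 5, 3), (- 2, 2, 4, 5, 6, 12)]), (23510, [(1, 2, 3, 5,
   6, 8), (- 1, 2, 3, 4, 5, 3), (- 1, 2, 4, 5, 6, 12)]), (1412, [(2, 0, 1, 3, 4, 5), (1, 0, 1, 3, 5,
   4), (2, 0, 1, 2, 3, 13)]), (12607, [(1, 1, 2, 5, 6, 4), (1, 0, 1, 5, 6, 3)]), (12614, [(1, 0, 1,
   2, 6, 9), (- 1, 0, 1, 4, 6, 3), (- 2, 1, 2, 3, 6, 5), (1, 1, 2, 4, 6, 4)]), (12613, [(1, 1, 2, 4,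
   6, 4), (- 1, 1, 2, 3, 6, 5)]), (45610, [(1, 0, 2, 5, 6, 9), (- 1, 0, 4, 5, 6, 3)]), (24513, [(1,
   2, 3, 4, 5, 5), (1, 0, 2, 3, 5, 6), (1, 0, 2, 3, 4, 3), (1, 1, 2, 4, 5, 6), (- 1, 1, 2, 3, 5, 3),
   (1, 0, 2, 3, 4, 2), (- 1, 0, 1, 2, 4, 7)]), (24514, [(1, 1, 2, 4, 5, 6), (- 1, 1, 2, 3, 5, 3), (1,
   0, 2, 3, 4, 2), (- 1, 0, 1, 2, 4, 7), (- 1, 2, 4, 5, 6, 2)]), (24512, [(1, 2, 4, 5, 6, 2)]),
   (25603, [(1, 2, 3, 5, 6, 2)]), (15607, [(1, 1, 4, 5, 6, 5), (- 1, 1, 2, 5, 6, 13)]), (15605, [(1,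
   1, 3, 5, 6, 14), (- 1, 1, 3, 5, 6, 12)]), (13502, [(2, 1, 3, 5, 6, 12), (1, 1, 3, 5, 6, 13)]),
   (13507, [(1, 1, 3, 5, 6, 13)]), (14605, [(1, 1, 3, 4, 6, 14), (- 1, 1, 3, 4, 6, 12)]), (13402,
   [(2, 1, 3, 4, 6, 12), (1, 1, 3, 4, 6, 13)]), (13407, [(1, 1, 3, 4, 6, 13)]), (12407, [(1, 1, 2, 3,
   5, 7), (1, 2, 3, 4, 5, 1), (1, 1, 2, 4, 5, 4), (- 2, 1, 2, 3, 4, 12)]), (12604, [(1, 1, 2, 4, 6,
   12)]), (12608, [(1, 1, 2, 3, 6, 10)]), (13511, [(1, 1, 2, 3, 5, 14), (1, 1, 2, 3, 5, 12)]),
   (23506, [(1, 1, 2, 3, 5, 13), (1, 1, 2, 3, 5, 12)]), (12314, [(4, 1, 2, 3, 4, 8), (2, 1, 2, 4, 5,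
   7), (- 2, 2, 3, 4, 5, 2), (3, 0, 2, 3, 4, 12), (2, 0, 2, 3, 4, 13), (1, 0, 2, 3, 4, 14), (2, 1, 2,
   3, 5, 12)]), (12505, [(1, 1, 2, 3, 5, 12)]), (12304, [(1, 1, 2, 3, 4, 12)]), (5613, [(1, 0, 2, 5,
   6, 11)]), (5612, [(1, 0, 4, 5, 6, 4)]), (3514, [(1, 0, 2, 3, 5, 11)]), (3512, [(1, 0, 3, 4, 5,
   4)]), (4613, [(1, 0, 2, 4, 6, 11)]), (4513, [(1, 0, 2, 4, 5, 11)]), (4606, [(1, 0, 1, 4, 6, 13)]),
   (3508, [(1, 0, 1, 3, 5, 9)]), (12312, [(1, 0, 1, 2, 3, 9)]), (24614, [(2, 0, 4, 5, 6, 6), (- 2, 0,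
   3, 5, 6, 3), (- 2, 0, 2, 4, 6, 9), (2, 2, 3, 5, 6, 4), (2, 2, 4, 5, 6, 13), (4, 2, 4, 5, 6, 12),
   (1, 1, 2, 4, 6, 6), (- 1, 1, 2, 3, 6, 3), (- 1, 2, 3, 4, 6, 5)]), (23613, [(1, 0, 2, 3, 6, 9), (-
   1, 0, 3, 5, 6, 6), (- 1, 1, 2, 3, 6, 6), (- 1, 2, 3, 5, 6, 13)]), (24612, [(1, 1, 2, 4, 6, 6), (-
   1, 1, 2, 3, 6, 3), (- 1, 2, 3, 4, 6, 5)]), (3504, [(1, 0, 3, 4, 5, 13), (1, 0, 3, 4, 5, 12)]),
   (2312, [(1, 0, 2, 3, 4, 4), (2, 0, 1, 2, 3, 6)]), (1304, [(1, 0, 1, 3, 4, 13), (- 1, 0, 1, 4, 5,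
   10)]), (13409, [(1, 0, 1, 2, 3, 10), (- 1, 1, 2, 3, 4, 1)]), (12513, [(1, 1, 2, 4, 5, 4), (- 1, 1,
   2, 5, 6, 2)]), (3611, [(1, 0, 2, 3, 6, 14), (- 1, 0, 2, 3, 6, 12)]), (1410, [(1, 0, 1, 2, 6, 7),
   (- 1, 1, 2, 4, 6, 3), (1, 0, 1, 2, 4, 4)]), (2414, [(2, 0, 2, 3, 4, 5), (2, 0, 2, 3, 5, 8), (- 2,
   0, 2, 4, 5, 12), (- 2, 0, 2, 4, 5, 3), (2, 0, 2, 4, 5, 2), (2, 0, 2, 5, 6, 8), (- 2, 0, 1, 4, 5,
   5), (2, 0, 1, 2, 5, 13), (- 1, 0, 2, 4, 6, 2), (- 1, 0, 2, 3, 6, 13), (- 1, 0, 2, 4, 6, 7)]),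
   (12514, [(2, 0, 1, 2, 4, 6), (- 2, 0, 1, 2, 3, 3), (2, 1, 2, 4, 5, 8), (2, 1, 2, 3, 5, 5), (3, 0,
   2, 4, 6, 2), (1, 0, 2, 3, 6, 13), (- 1, 0, 2, 4, 6, 7), (- 2, 1, 2, 5, 6, 2)]), (12512, [(1, 1, 2,
   5, 6, 2)]), (5605, [(1, 0, 3, 5, 6, 13)]), (3614, [(3, 0, 3, 4, 6, 4), (3, 0, 4, 5, 6, 11), (3, 0,
   1, 3, 6, 6), (9, 0, 2, 3, 6, 11), (2, 1, 4, 5, 6, 12), (1, 1, 4, 5, 6, 13)]), (45606, [(2, 1, 4,
   5, 6, 12), (1, 1, 4, 5, 6, 13)]), (45607, [(1, 1, 4, 5, 6, 3), (- 1, 1, 2, 5, 6, 9)]), (2514, [(2,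
   0, 2, 3, 5, 5), (- 2, 0, 2, 3, 6, 8), (- 2, 0, 2, 3, 4, 3), (- 3, 0, 2, 5, 6, 2), (1, 0, 2, 5, 6,
   7)]), (2604, [(1, 0, 2, 5, 6, 7), (- 1, 0, 2, 5, 6, 2)]), (2413, [(1, 0, 2, 4, 6, 7), (- 1, 0, 2,
   4, 6, 2)]), (1613, [(1, 0, 1, 4, 6, 4), (- 1, 0, 1, 3, 6, 5)]), (4510, [(1, 0, 2, 4, 5, 4), (- 1,
   0, 2, 5, 6, 2)]), (2512, [(1, 0, 2, 5, 6, 2)]), (2304, [(1, 0, 2, 3, 5, 7), (- 1, 2, 3, 4, 5,
   3)]), (25604, [(1, 2, 4, 5, 6, 12)]), (35609, [(1, 2, 3, 5, 6, 1)]), (15604, [(1, 1, 2, 5, 6,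
   10)]), (14507, [(1, 1, 4, 5, 6, 13)]), (15611, [(1, 1, 2, 5, 6, 13)]), (12612, [(1, 1, 2, 3, 6,
   5)]), (13513, [(1, 1, 2, 3, 5, 11)]), (2307, [(1, 0, 2, 3, 6, 13)]), (2613, [(1, 0, 1, 2, 6, 6),
   (1, 1, 2, 4, 6, 5), (1, 0, 2, 3, 6, 5)]), (2614, [(1, 0, 2, 4, 6, 4), (- 1, 0, 4, 5, 6, 5), (- 1,
   0, 2, 3, 6, 5)]), (2612, [(1, 0, 2, 3, 6, 5)]), (35607, [(1, 0, 3, 5, 6, 1)]), (34610, [(1, 2, 3,
   4, 6, 4), (- 1, 1, 2, 3, 6, 6)]), (24604, [(1, 2, 4, 5, 6, 7)]), (45614, [(1, 3, 4, 5, 6, 5), (-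
   1, 0, 4, 5, 6, 9), (- 1, 2, 4, 5, 6, 11), (1, 2, 3, 5, 6, 13)]), (23502, [(1, 2, 3, 5, 6, 12)]),
   (12401, [(1, 0, 2, 3, 4, 2), (- 1, 0, 1, 2, 4, 7)]), (35611, [(1, 2, 3, 5, 6, 13)]), (1311, [(1,
   0, 1, 2, 3, 13)]), (1404, [(1, 0, 1, 2, 4, 10), (1, 1, 2, 3, 4, 2), (1, 1, 2, 3, 5, 1)]), (34507,
   [(1, 1, 3, 4, 5, 3), (1, 1, 2, 3, 5, 9)]), (12413, [(1, 1, 2, 3, 4, 5)]), (14511, [(1, 1, 2, 4, 5,
   13), (2, 1, 2, 4, 5, 12)]), (2405, [(2, 0, 2, 3, 4, 13), (1, 0, 2, 3, 4, 14), (- 1, 0, 2, 3, 4,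
   12)]), (3411, [(1, 0, 2, 3, 4, 14), (- 1, 0, 2, 3, 4, 12)]), (3506, [(1, 0, 1, 3, 5, 12), (1, 0,
   1, 3, 5, 13)]), (1505, [(1, 0, 1, 3, 5, 13)]), (15609, [(1, 0, 1, 5, 6, 12), (- 1, 0, 1, 5, 6,
   13)]), (14509, [(1, 0, 1, 4, 5, 13), (- 1, 0, 1, 4, 5, 12)]), (1411, [(1, 0, 1, 2, 4, 14), (- 1,
   0, 1, 2, 4, 12)]), (34502, [(1, 3, 4, 5, 6, 12), (1, 3, 4, 5, 6, 13)]), (45605, [(1, 3, 4, 5, 6,
   13)]), (45611, [(1, 2, 4, 5, 6, 13)]), (45613, [(1, 2, 4, 5, 6, 11)]), (45609, [(1, 2, 4, 5, 6,
   1)]), (23605, [(1, 2, 3, 5, 6, 10)]), (24613, [(1, 2, 3, 4, 6, 5)]), (23412, [(1, 2, 3, 4, 6,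
   2)]), (13504, [(1, 1, 3, 4, 5, 14), (1, 1, 3, 4, 5, 12)]), (34506, [(1, 1, 3, 4, 5, 13), (1, 1, 3,
   4, 5, 12)]), (14505, [(1, 1, 3, 4, 5, 12)]), (12502, [(1, 1, 2, 3, 5, 3)]), (15614, [(1, 1, 2, 5,
   6, 11)]), (5604, [(1, 0, 4, 5, 6, 13)]), (15612, [(1, 0, 1, 5, 6, 9)]), (4502, [(1, 0, 4, 5, 6,
   12)]), (4505, [(1, 0, 3, 4, 5, 12)]), (4611, [(1, 0, 2, 4, 6, 14), (- 1, 0, 2, 4, 6, 12)]),
   (24609, [(1, 0, 2, 4, 6, 12)]), (2412, [(1, 0, 2, 4, 6, 2)]), (23603, [(1, 0, 2, 3, 6, 10)]),
   (23409, [(1, 0, 2, 3, 4, 12)]), (2305, [(1, 0, 2, 3, 4, 11)]), (1307, [(1, 0, 1, 3, 5, 4)]),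
   (1408, [(1, 0, 1, 3, 6, 7), (- 1, 0, 3, 4, 6, 1), (1, 0, 1, 3, 6, 5), (2, 1, 2, 3, 6, 9), (1, 1,
   3, 4, 6, 3), (1, 0, 1, 4, 6, 10), (- 1, 1, 3, 4, 6, 2), (1, 0, 1, 3, 4, 9), (1, 0, 1, 3, 4, 4)]),
   (1313, [(1, 0, 1, 3, 6, 2), (- 1, 0, 1, 4, 6, 1), (1, 1, 2, 3, 6, 4), (1, 0, 1, 3, 4, 4)]), (1314,
   [(1, 0, 1, 2, 3, 11), (1, 1, 2, 3, 5, 1)]), (1312, [(1, 0, 1, 3, 4, 4)]), (1402, [(1, 0, 1, 3, 4,
   3)]), (3409, [(1, 0, 1, 2, 3, 7), (1, 0, 2, 3, 4, 1), (1, 1, 2, 3, 4, 3), (1, 0, 1, 2, 4, 4)]),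
   (1213, [(1, 0, 1, 2, 4, 4), (1, 0, 1, 2, 6, 2)]), (1214, [(1, 0, 1, 2, 3, 5), (1, 0, 1, 2, 6,
   2)]), (1212, [(1, 0, 1, 2, 6, 2)]), (1401, [(1, 0, 1, 2, 4, 9)]), (2313, [(1, 0, 1, 2, 3, 6)]),
   (34607, [(1, 1, 3, 4, 6, 3), (1, 0, 1, 4, 6, 10), (- 1, 1, 3, 4, 6, 2), (1, 0, 1, 3, 4, 9), (1, 1,
   2, 3, 6, 9)]), (2510, [(1, 0, 2, 4, 5, 3), (- 1, 0, 2, 4, 5, 2), (- 1, 0, 2, 5, 6, 8), (1, 0, 1,
   4, 5, 5), (- 1, 0, 1, 2, 5, 13)]), (14513, [(1, 1, 4, 5, 6, 7), (- 2, 1, 2, 4, 6, 10), (- 1, 0, 4,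
   5, 6, 10), (- 1, 1, 4, 5, 6, 2)]), (25609, [(1, 0, 2, 5, 6, 12), (1, 0, 2, 3, 5, 3)]), (35613,
   [(1, 3, 4, 5, 6, 4), (1, 0, 3, 5, 6, 9)]), (35614, [(1, 2, 3, 5, 6, 11)]), (35610, [(1, 2, 3, 5,
   6, 4)]), (34511, [(1, 0, 3, 4, 5, 6), (1, 0, 2, 3, 4, 9)]), (24505, [(1, 2, 3, 4, 5, 13), (2, 2,
   3, 4, 5, 12)]), (23504, [(1, 2, 3, 4, 5, 12)]), (23503, [(1, 2, 3, 4, 5, 1)]), (5603, [(1, 0, 4,
   5, 6, 1)]), (14514, [(1, 1, 2, 4, 5, 11)]), (14512, [(1, 1, 4, 5, 6, 2)]), (15603, [(1, 1, 3, 5,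
   6, 2)]), (12504, [(1, 1, 2, 4, 5, 12)]), (13601, [(1, 1, 2, 3, 6, 9)]), (23612, [(1, 1, 2, 3, 6,
   6)]), (13610, [(1, 1, 2, 3, 6, 4)]), (13501, [(1, 1, 2, 3, 5, 9)]), (12301, [(1, 1, 2, 3, 4, 3)]),
   (45603, [(1, 0, 4, 5, 6, 10)]), (23408, [(1, 2, 3, 4, 6, 1)]), (34513, [(1, 3, 4, 5, 6, 7), (2, 2,
   3, 4, 6, 10), (- 1, 0, 3, 4, 5, 9), (1, 0, 4, 5, 6, 9)]), (45612, [(1, 0, 4, 5, 6, 9)]), (34514,
   [(1, 1, 3, 4, 5, 6), (1, 1, 2, 3, 4, 9), (- 1, 0, 3, 4, 5, 9)]), (34512, [(1, 0, 3, 4, 5, 9)]),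
   (4604, [(1, 0, 2, 4, 6, 10)]), (3613, [(1, 0, 2, 3, 6, 11)]), (3501, [(1, 0, 2, 3, 5, 9)]), (3401,
   [(1, 0, 2, 3, 4, 9)]), (2301, [(1, 0, 2, 3, 4, 3)]), (5606, [(1, 0, 1, 5, 6, 13)]), (15610, [(1,
   0, 1, 5, 6, 3)]), (1601, [(1, 0, 1, 4, 6, 3)]), (4506, [(1, 0, 1, 4, 5, 12)]), (1405, [(1, 0, 1,
   4, 5, 10)]), (1501, [(1, 0, 1, 4, 5, 3)]), (1612, [(1, 0, 1, 3, 6, 5)]), (13510, [(1, 0, 1, 3, 5,
   3)]), (12606, [(1, 0, 1, 2, 6, 11)]), (13603, [(1, 1, 3, 4, 6, 10), (1, 1, 3, 4, 6, 1), (- 1, 1,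
   4, 5, 6, 11)]), (2506, [(1, 0, 1, 4, 5, 5), (- 1, 0, 1, 2, 5, 13)]), (35603, [(1, 3, 4, 5, 6,
   1)]), (23401, [(1, 2, 3, 4, 5, 6)]), (23501, [(1, 2, 3, 4, 5, 3)]), (24503, [(1, 2, 3, 4, 5, 2)]),
   (14508, [(1, 1, 4, 5, 6, 10)]), (15602, [(1, 1, 3, 5, 6, 3)]), (15601, [(1, 1, 2, 5, 6, 9)]),
   (14604, [(1, 1, 2, 4, 6, 10)]), (14601, [(1, 1, 2, 4, 6, 9)]), (12611, [(1, 1, 2, 4, 6, 5)]),
   (12601, [(1, 1, 2, 4, 6, 3)]), (12603, [(1, 1, 2, 4, 6, 1)]), (14501, [(1, 1, 2, 4, 5, 9)]),
   (12501, [(1, 1, 2, 4, 5, 3)]), (12602, [(1, 1, 2, 3, 6, 3)]), (13609, [(1, 1, 2, 3, 6, 1)]),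
   (12310, [(1, 1, 2, 3, 5, 5)]), (12306, [(1, 1, 2, 3, 5, 1)]), (13401, [(1, 1, 2, 3, 4, 9)]),
   (23413, [(1, 1, 2, 3, 4, 6)]), (4610, [(1, 0, 4, 5, 6, 5)]), (3608, [(1, 0, 3, 5, 6, 11)]),
   (35612, [(1, 0, 3, 5, 6, 9)]), (3607, [(1, 0, 3, 5, 6, 4)]), (3605, [(1, 0, 3, 4, 6, 11)]), (4609,
   [(1, 0, 2, 4, 6, 1)]), (12411, [(1, 1, 2, 4, 5, 8)]), (2504, [(1, 0, 2, 4, 5, 12)]), (4504, [(1,
   0, 2, 4, 5, 10)]), (23609, [(1, 1, 2, 3, 6, 8)]), (2302, [(1, 0, 2, 3, 6, 12)]), (23610, [(1, 0,
   2, 3, 6, 2)]), (3511, [(1, 0, 2, 3, 5, 13)]), (23509, [(1, 0, 2, 3, 5, 12)]), (2502, [(1, 0, 2, 3,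
   5, 3)]), (2503, [(1, 0, 2, 3, 5, 2)]), (3404, [(1, 0, 2, 3, 4, 10)]), (4509, [(1, 0, 1, 4, 5,
   8)]), (3612, [(1, 0, 1, 3, 6, 6)]), (1202, [(1, 0, 1, 2, 3, 3)]), (12609, [(1, 0, 1, 2, 6, 12)]),
   (1511, [(1, 0, 1, 2, 5, 13)]), (1510, [(1, 0, 1, 2, 5, 4)]), (12309, [(1, 0, 1, 2, 3, 12)]),
   (1310, [(1, 0, 1, 2, 3, 4)]), (14603, [(1, 1, 3, 4, 6, 2), (- 1, 0, 1, 3, 4, 9)]), (45604, [(1, 2,
   4, 5, 6, 10)]), (34613, [(1, 2, 3, 4, 6, 11)]), (34604, [(1, 2, 3, 4, 6, 10)]), (4608, [(1, 0, 4,
   5, 6, 11)]), (14614, [(1, 1, 3, 4, 6, 5), (1, 0, 1, 4, 6, 9), (- 1, 1, 2, 4, 6, 11)]), (14613,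
   [(1, 1, 2, 4, 6, 11)]), (12404, [(1, 1, 2, 4, 5, 7)]), (12511, [(1, 1, 2, 4, 5, 5)]), (12305, [(1,
   1, 2, 3, 5, 10)]), (3603, [(1, 0, 3, 4, 6, 1)]), (3505, [(1, 0, 3, 4, 5, 11)]), (4503, [(1, 0, 3,
   4, 5, 2)]), (3503, [(1, 0, 3, 4, 5, 1)]), (4601, [(1, 0, 2, 4, 6, 9)]), (4511, [(1, 0, 2, 4, 5,
   13)]), (4501, [(1, 0, 2, 4, 5, 9)]), (2310, [(1, 0, 2, 3, 6, 8)]), (3609, [(1, 0, 2, 3, 6, 1)]),
   (2311, [(1, 0, 2, 3, 5, 8)]), (3510, [(1, 0, 2, 3, 5, 4)]), (3509, [(1, 0, 2, 3, 5, 1)]), (2303,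
   [(1, 0, 2, 3, 4, 1)]), (5609, [(1, 0, 1, 5, 6, 8)]), (1606, [(1, 0, 1, 5, 6, 1)]), (14602, [(1, 0,
   1, 4, 6, 10)]), (14612, [(1, 0, 1, 4, 6, 9)]), (1603, [(1, 0, 1, 4, 6, 1)]), (14608, [(1, 1, 4, 5,
   6, 11)]), (13613, [(1, 1, 3, 4, 6, 4), (- 1, 0, 1, 3, 6, 9)]), (13614, [(1, 1, 2, 3, 6, 11)]),
   (13612, [(1, 0, 1, 3, 6, 9)]), (1602, [(1, 0, 1, 3, 6, 3)]), (13412, [(1, 0, 1, 3, 4, 9)]), (1204,
   [(1, 0, 1, 2, 5, 7)]), (12409, [(1, 0, 1, 2, 4, 12)]), (2403, [(1, 0, 1, 2, 4, 7)]), (1201, [(1,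
   0, 1, 2, 4, 3)]), (25611, [(1, 2, 4, 5, 6, 5)]), (13408, [(1, 1, 3, 4, 6, 1)]), (13503, [(1, 0, 1,
   3, 5, 10), (- 1, 0, 1, 3, 4, 11), (- 1, 1, 3, 4, 5, 1)]), (13406, [(1, 1, 3, 4, 5, 1)]), (14504,
   [(1, 1, 2, 4, 5, 10)]), (12406, [(1, 1, 2, 4, 5, 1)]), (12403, [(1, 1, 2, 3, 4, 2)]), (12303, [(1,
   1, 2, 3, 4, 1)]), (5601, [(1, 0, 4, 5, 6, 3)]), (3601, [(1, 0, 3, 5, 6, 6)]), (5602, [(1, 0, 3, 5,
   6, 3)]), (34612, [(1, 0, 3, 4, 6, 9)]), (2501, [(1, 0, 2, 5, 6, 8)]), (2601, [(1, 0, 2, 4, 6,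
   3)]), (24510, [(1, 0, 2, 4, 5, 2)]), (3610, [(1, 0, 2, 3, 6, 4)]), (23511, [(1, 0, 2, 3, 5, 6)]),
   (14606, [(1, 0, 1, 4, 6, 11)]), (13602, [(1, 0, 1, 3, 6, 10)]), (1305, [(1, 0, 1, 3, 4, 11)]),
   (12509, [(1, 0, 1, 2, 5, 12)]), (34504, [(1, 2, 3, 4, 5, 10)]), (23411, [(1, 0, 2, 3, 4, 6)]),
   (24504, [(1, 2, 3, 4, 5, 8)]), (23505, [(1, 2, 3, 4, 5, 11)]), (23404, [(1, 2, 3, 4, 5, 7)]),
   (13405, [(1, 1, 3, 4, 5, 10)]), (13505, [(1, 1, 3, 4, 5, 11)]), (13413, [(1, 1, 2, 3, 4, 11)]),
   (13404, [(1, 1, 2, 3, 4, 10)]), (34603, [(1, 1, 3, 4, 6, 7)]), (34602, [(1, 0, 3, 4, 6, 10)]),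
   (3602, [(1, 0, 3, 4, 6, 6)]), (4602, [(1, 0, 3, 4, 6, 3)]), (34503, [(1, 1, 3, 4, 5, 7)]), (3405,
   [(1, 0, 3, 4, 5, 10)]), (2602, [(1, 0, 2, 3, 6, 3)]), (24611, [(1, 0, 2, 4, 6, 6)]), (2411, [(1,
   0, 2, 4, 5, 8)]), (24501, [(1, 2, 4, 5, 6, 8)]), (2404, [(1, 0, 2, 4, 5, 7)]), (2410, [(1, 0, 2,
   3, 4, 8)]), (2401, [(1, 0, 2, 4, 6, 8)]), (24511, [(1, 0, 2, 4, 5, 6)]), (2511, [(1, 0, 2, 4, 5,
   5)]), (14506, [(1, 0, 1, 4, 5, 11)]), (1506, [(1, 0, 1, 4, 5, 2)]), (1503, [(1, 0, 1, 3, 5, 2)]),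
   (1406, [(1, 0, 1, 4, 5, 1)]), (13403, [(1, 0, 1, 3, 4, 10)]), (3403, [(1, 0, 1, 3, 4, 7)]), (1306,
   [(1, 0, 1, 3, 5, 1)]), (1403, [(1, 0, 1, 3, 4, 2)]), (1303, [(1, 0, 1, 3, 4, 1)]), (2609, [(1, 0,
   1, 2, 6, 8)]), (1609, [(1, 0, 1, 2, 6, 1)]), (1211, [(1, 0, 1, 2, 4, 5)]), (2509, [(1, 0, 1, 2, 5,
   8)]), (1206, [(1, 0, 1, 2, 4, 2)]), (1509, [(1, 0, 1, 2, 5, 1)]), (2409, [(1, 0, 1, 2, 4, 8)]),
   (1203, [(1, 0, 1, 2, 3, 2)]), (1409, [(1, 0, 1, 2, 4, 1)]), (2309, [(1, 0, 1, 2, 3, 8)]), (1309,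
   [(1, 0, 1, 2, 3, 1)])]"

text \<open>The nine unknowns that remain of the 490 = 35 * 14 coordinates with non-zero last index
  once the 481 of \<open>koszul_cert\<close> are taken away. They are not solved for; they vanish
  because the kernel vector is supported on the other unknowns.\<close>

definition free_keys :: "int tree" where
  "free_keys = \<langle>\<langle>\<langle>\<langle>\<langle>\<rangle>, 1209, \<langle>\<rangle>\<rangle>, 1614, \<langle>\<rangle>\<rangle>, 2603, \<langle>\<langle>\<rangle>,
    13414, \<langle>\<rangle>\<rangle>\<rangle>, 14609, \<langle>\<langle>\<langle>\<langle>\<rangle>, 14610, \<langle>\<rangle>\<rangle>, 23405, \<langle>\<rangle>\<rangle>, 34505, \<langle>\<langle>\<rangle>, 34614, \<langle>\<rangle>\<rangle>\<rangle>\<rangle>"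

text \<open>The search for pivots has been done beforehand; only integer arithmetic and table
  look-ups are evaluated here.\<close>

lemma triangular_koszul_cert: "triangular form_table free_keys koszul_cert"
  by code_simp

text \<open>The seven directions \<open>E\<^sub>0\<^sub>3 - E\<^sub>1\<^sub>0\<close>, \<open>E\<^sub>0\<^sub>2\<close>, \<open>E\<^sub>2\<^sub>3\<close>, \<open>E\<^sub>1\<^sub>2 + E\<^sub>3\<^sub>1\<close>, \<open>E\<^sub>2\<^sub>1 + E\<^sub>3\<^sub>2\<close>, \<open>E\<^sub>1\<^sub>1 - E\<^sub>2\<^sub>2\<close>,
  \<open>E\<^sub>1\<^sub>2 + E\<^sub>3\<^sub>0\<close> were found by a computer search for a sparse flattening of rank at least 481 (a generic
  choice has the full rank 490).\<close>

definition dir_coeffs :: "nat \<Rightarrow> (int \<times> nat) list" where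
  "dir_coeffs a = [[(1, 2), (- 1, 3)], [(1, 1)], [(1, 8)], [(1, 4), (1, 10)], [(1, 7), (1, 11)],
     [(1, 13)], [(1, 4), (1, 9)]] ! a"

section \<open>An integer model of the reduced form and its agreement with the table\<close>

definition reduced_terms :: "nat \<Rightarrow> (int \<times> nat \<times> nat) list" where
  "reduced_terms i = [[], [(1, 0, 2)], [(1, 0, 3)], [(1, 1, 0)], [(1, 1, 2)], [(1, 1, 3)],
     [(1, 2, 0)], [(1, 2, 1)], [(1, 2, 3)], [(1, 3, 0)], [(1, 3, 1)], [(1, 3, 2)],
     [(1, 0, 0), (- 1, 1, 1)], [(1, 1, 1), (- 1, 2, 2)], [(1, 2, 2), (- 1, 3, 3)]] ! i"

text \<open>The trace of a product of three matrix units is 1 if their indices chain up cyclically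
  and 0 otherwise; the bracket gives the difference over the two orders of the first two.\<close>

definition elem_form :: "nat \<times> nat \<Rightarrow> nat \<times> nat \<Rightarrow> nat \<times> nat \<Rightarrow> int" where
  "elem_form = (\<lambda>(p1, q1) (p2, q2) (p3, q3). (if q1 = p2 \<and> q2 = p3 \<and> q3 = p1 then 1 else 0)
     - (if q2 = p1 \<and> q1 = p3 \<and> q3 = p2 then 1 else 0))"

definition int_form :: "nat \<Rightarrow> nat \<Rightarrow> nat \<Rightarrow> int" where
  "int_form i j k = (\<Sum>(s1, e1)\<leftarrow>reduced_terms i. s1 * (\<Sum>(s2, e2)\<leftarrow>reduced_terms j. s2 *
     (\<Sum>(s3, e3)\<leftarrow>reduced_terms k. s3 * elem_form e1 e2 e3)))"

definition dir_form :: "nat \<Rightarrow> nat \<Rightarrow> nat \<Rightarrow> int" where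
  "dir_form a j k = (\<Sum>(v, i)\<leftarrow>dir_coeffs a. v * int_form i j k)"

definition direction :: "nat \<Rightarrow> nat \<Rightarrow> complex" where
  "direction a i = (\<Sum>(v, i')\<leftarrow>dir_coeffs a. if i' = i then of_int v else 0)"

text \<open>This ties the literal table, from which the elimination reads its coefficients, to the
  form itself, including the order and completeness of the listed pairs.\<close>

lemma form_table_dir_form:
  "\<forall>a\<in>set [0..<7]. \<forall>k\<in>set [1..<15]. form_table (int a) (int k) =
    filter (\<lambda>(j, v). v \<noteq> 0) (map (\<lambda>j. (int j, dir_form a j k)) [0..<15])"
  by code_simp

lemma trace_form_elem_mat:
  assumes "p1 < 4" "q1 < 4" "p2 < 4" "q2 < 4" "p3 < 4" "q3 < 4"
  shows "trace_form (elem_mat p1 q1) (elem_mat p2 q2) (elem_mat p3 q3) = of_int (elem_form (p1, q1) (p2, q2) (p3, q3))"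
proof -
  have mult: "mat_mult 4 (elem_mat p q) (elem_mat p' q') = (if q = p' then elem_mat p q' else (\<lambda>_ _. 0))"
    if "q < 4" for p q p' q'
  proof (intro ext)
    fix a b
    have "mat_mult 4 (elem_mat p q) (elem_mat p' q') a b =
        (\<Sum>l<4. if l = q then (if a = p \<and> q = p' \<and> b = q' then 1 else 0) else 0)"
      unfolding mat_mult_def by (intro sum.cong) (auto simp: elem_mat_def)
    then show "mat_mult 4 (elem_mat p q) (elem_mat p' q') a b = (if q = p' then elem_mat p q' else (\<lambda>_ _. 0)) a b"
      using that by (simp add: elem_mat_def)
  qed
  have zero: "mat_mult 4 M (\<lambda>_ _. 0) = (\<lambda>_ _. 0)" for M
    by (simp add: mat_mult_def)
  have trace: "mtrace (elem_mat p q) = (if p = q then 1 else 0)" if "p < 4" for p q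
  proof -
    have "mtrace (elem_mat p q) = (\<Sum>i<4. if i = p then (if p = q then 1 else 0) else 0)"
      unfolding mtrace_def by (intro sum.cong) (auto simp: elem_mat_def)
    then show ?thesis using that by simp
  qed
  have trace0: "mtrace (\<lambda>_ _. 0) = 0" by (simp add: mtrace_def)
  have "mtrace (mat_mult 4 (elem_mat p q) (mat_mult 4 (elem_mat p' q') (elem_mat p'' q''))) =
      (if q = p' \<and> q' = p'' \<and> q'' = p then 1 else 0)" if "p < 4" "q < 4" "q' < 4" for p q p' q' p'' q''
    unfolding mult[OF that(3)]
    by (cases "q' = p''"; cases "q = p'") (use that in \<open>auto simp: mult zero trace trace0\<close>)
  note * = this
  have 1: "trace_form (elem_mat p1 q1) (elem_mat p2 q2) (elem_mat p3 q3) =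
     (if q1 = p2 \<and> q2 = p3 \<and> q3 = p1 then 1 else 0) - (if q2 = p1 \<and> q1 = p3 \<and> q3 = p2 then 1 else 0)"
    by (simp only: trace_form_eq *[OF assms(1,2,4)] *[OF assms(3,4,2)])
  have 2: "elem_form (p1, q1) (p2, q2) (p3, q3) =
     (if q1 = p2 \<and> q2 = p3 \<and> q3 = p1 then 1 else 0) - (if q2 = p1 \<and> q1 = p3 \<and> q3 = p2 then 1 else 0)"
    by (simp only: elem_form_def prod.case)
  show ?thesis unfolding 1 2 of_int_diff if_distrib[of of_int] of_int_1 of_int_0 ..
qed

lemma trace_form_sum_list:
  "trace_form (\<lambda>p q. \<Sum>(s, e)\<leftarrow>xs. of_int s * elem_mat (fst e) (snd e) p q) b c =
    (\<Sum>(s, e)\<leftarrow>xs. of_int s * trace_form (elem_mat (fst e) (snd e)) b c)"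
proof -
  have *: "(\<Sum>(s, e)\<leftarrow>xs. of_int s * f e) = (\<Sum>n<length xs. of_int (fst (xs ! n)) * f (snd (xs ! n)))"
    for f :: "nat \<times> nat \<Rightarrow> complex"
    by (simp add: sum_list_sum_nth case_prod_beta atLeast0LessThan)
  show ?thesis unfolding * by (rule trace_form_sum_left)
qed

lemma reduced_mat_terms:
  assumes "i < 15"
  shows "reduced_mat i = (\<lambda>p q. \<Sum>(s, e)\<leftarrow>reduced_terms i. of_int s * elem_mat (fst e) (snd e) p q)"
    and "\<forall>(s, e)\<in>set (reduced_terms i). fst e < 4 \<and> snd e < 4"
proof -
  have "i \<in> {0,1,2,3,4,5,6,7,8,9,10,11,12,13,14}"
    using assms lessThan_15 lessThan_iff by blast
  then show "reduced_mat i = (\<lambda>p q. \<Sum>(s, e)\<leftarrow>reduced_terms i. of_int s * elem_mat (fst e) (snd e) p q)"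
    "\<forall>(s, e)\<in>set (reduced_terms i). fst e < 4 \<and> snd e < 4"
    unfolding reduced_mat_def sl_basis_4 by (auto simp: reduced_terms_def)
qed

text \<open>Linearity over coefficient lists is available in the first argument only, so each
  argument is rotated to the front, expanded into matrix units and rotated back.\<close>

lemma trace_form_reduced_mat:
  assumes "i < 15" "j < 15" "k < 15"
  shows "trace_form (reduced_mat i) (reduced_mat j) (reduced_mat k) = of_int (int_form i j k)"
proof -
  have of_int_sum_list: "of_int (\<Sum>(s, e)\<leftarrow>xs. s * f e) = (\<Sum>(s, e)\<leftarrow>xs. of_int s * (of_int (f e) :: complex))"
    for xs and f :: "nat \<times> nat \<Rightarrow> int"
    by (induction xs) auto
  have cong: "(\<Sum>(s, e)\<leftarrow>xs. of_int s * f e) = (\<Sum>(s, e)\<leftarrow>xs. of_int s * g e)"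
    if "\<And>e. e \<in> snd ` set xs \<Longrightarrow> f e = g e" for xs :: "(int \<times> nat \<times> nat) list" and f g :: "nat \<times> nat \<Rightarrow> complex"
    using that by (intro arg_cong[of _ _ sum_list] map_cong) force+
  have 4: "fst e < 4" "snd e < 4" if "e \<in> snd ` set (reduced_terms n)" "n < 15" for e n
    using reduced_mat_terms(2)[OF that(2)] that(1) by auto
  let ?E = "\<lambda>e :: nat \<times> nat. elem_mat (fst e) (snd e)"
  have k: "trace_form (?E e1) (?E e2) (reduced_mat k) = of_int (\<Sum>(s3, e3)\<leftarrow>reduced_terms k. s3 * elem_form e1 e2 e3)"
    if "fst e1 < 4" "snd e1 < 4" "fst e2 < 4" "snd e2 < 4" for e1 e2
  proof -
    have "trace_form (?E e1) (?E e2) (reduced_mat k) = trace_form (reduced_mat k) (?E e1) (?E e2)"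
      by (rule trace_form_rotate[symmetric])
    also have "\<dots> = (\<Sum>(s3, e3)\<leftarrow>reduced_terms k. of_int s3 * trace_form (?E e3) (?E e1) (?E e2))"
      unfolding reduced_mat_terms(1)[OF assms(3)] trace_form_sum_list ..
    also have "\<dots> = (\<Sum>(s3, e3)\<leftarrow>reduced_terms k. of_int s3 * of_int (elem_form e1 e2 e3))"
    proof (rule cong)
      fix e3 assume "e3 \<in> snd ` set (reduced_terms k)"
      then show "trace_form (?E e3) (?E e1) (?E e2) = of_int (elem_form e1 e2 e3)"
        using trace_form_elem_mat[OF that] 4[OF _ assms(3)] unfolding trace_form_rotate[of "?E e3"] by simp
    qed
    finally show ?thesis unfolding of_int_sum_list .
  qed
  have j: "trace_form (?E e1) (reduced_mat j) (reduced_mat k) =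
      of_int (\<Sum>(s2, e2)\<leftarrow>reduced_terms j. s2 * (\<Sum>(s3, e3)\<leftarrow>reduced_terms k. s3 * elem_form e1 e2 e3))"
    if "fst e1 < 4" "snd e1 < 4" for e1
  proof -
    have "trace_form (?E e1) (reduced_mat j) (reduced_mat k) = trace_form (reduced_mat j) (reduced_mat k) (?E e1)"
      by (rule trace_form_rotate)
    also have "\<dots> = (\<Sum>(s2, e2)\<leftarrow>reduced_terms j. of_int s2 * trace_form (?E e2) (reduced_mat k) (?E e1))"
      unfolding reduced_mat_terms(1)[OF assms(2)] trace_form_sum_list ..
    also have "\<dots> = (\<Sum>(s2, e2)\<leftarrow>reduced_terms j. of_int s2 *
        of_int (\<Sum>(s3, e3)\<leftarrow>reduced_terms k. s3 * elem_form e1 e2 e3))"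
    proof (rule cong)
      fix e2 assume e2: "e2 \<in> snd ` set (reduced_terms j)"
      have "trace_form (?E e2) (reduced_mat k) (?E e1) = trace_form (?E e1) (?E e2) (reduced_mat k)"
        by (rule trace_form_rotate[symmetric])
      then show "trace_form (?E e2) (reduced_mat k) (?E e1) = of_int (\<Sum>(s3, e3)\<leftarrow>reduced_terms k. s3 * elem_form e1 e2 e3)"
        using k[OF that 4[OF e2 assms(2)]] by (rule trans)
    qed
    finally show ?thesis unfolding of_int_sum_list .
  qed
  show ?thesis
    unfolding of_int_sum_list int_form_def reduced_mat_terms(1)[OF assms(1)] trace_form_sum_list
    using 4 assms(1) by (intro cong) (simp add: j of_int_sum_list)
qed

lemma sum_direction:
  assumes "a < 7" and jk: "j < 15" "k < 15"
  shows "(\<Sum>i<15. direction a i * trace_form (reduced_mat i) (reduced_mat j) (reduced_mat k)) = of_int (dir_form a j k)"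
proof -
  have *: "(\<Sum>i<15. (\<Sum>(v, i')\<leftarrow>xs. if i' = i then of_int v else 0) * f i) = (\<Sum>(v, i)\<leftarrow>xs. of_int v * f i)"
    if "\<forall>(v, i)\<in>set xs. i < 15" for xs :: "(int \<times> nat) list" and f :: "nat \<Rightarrow> complex"
    using that
  proof (induction xs)
    case (Cons x xs)
    obtain v i' where x: "x = (v, i')" by (cases x)
    have "(\<Sum>i<15. (if i' = i then of_int v else 0) * f i) = (\<Sum>i<15. if i' = i then of_int v * f i else 0)"
      by (intro sum.cong) auto
    also have "\<dots> = of_int v * f i'" using Cons.prems by (simp add: x)
    finally show ?case using Cons by (simp add: x distrib_right sum.distrib)
  qed simp
  have "a \<in> {0,1,2,3,4,5,6}" using assms(1) by auto
  then have d: "\<forall>(v, i)\<in>set (dir_coeffs a). i < 15" by (auto simp: dir_coeffs_def)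
  have "of_int (\<Sum>(v, i)\<leftarrow>xs. v * int_form i j k) =
      (\<Sum>(v, i)\<leftarrow>xs. of_int v * (of_int (int_form i j k) :: complex))" for xs
    by (induction xs) auto
  then have "of_int (dir_form a j k) = (\<Sum>(v, i)\<leftarrow>dir_coeffs a. of_int v * (of_int (int_form i j k) :: complex))"
    unfolding dir_form_def .
  also have "\<dots> = (\<Sum>i<15. direction a i * of_int (int_form i j k))"
    unfolding direction_def by (rule *[OF d, symmetric])
  also have "\<dots> = (\<Sum>i<15. direction a i * trace_form (reduced_mat i) (reduced_mat j) (reduced_mat k))"
    using jk by (intro sum.cong) (auto simp: trace_form_reduced_mat)
  finally show ?thesis ..
qed

lemma block_val_form_table:
  assumes "a < 7" "0 < k" "k < 15"
  shows "block_val z m (form_table (int a) (int k)) =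
    (\<Sum>j<15. (\<Sum>i<15. direction a i * trace_form (reduced_mat i) (reduced_mat j) (reduced_mat k)) * z (m + int j))"
proof -
  have f: "block_val z m (filter (\<lambda>(j, v). v \<noteq> 0) L) = block_val z m L" for L
    by (induction L) auto
  have "a \<in> set [0..<7]" "k \<in> set [1..<15]" using assms by auto
  then have "form_table (int a) (int k) =
      filter (\<lambda>(j, v). v \<noteq> 0) (map (\<lambda>j. (int j, dir_form a j k)) [0..<15])"
    using form_table_dir_form by blast
  then have "block_val z m (form_table (int a) (int k)) = (\<Sum>j\<leftarrow>[0..<15]. of_int (dir_form a j k) * z (m + int j))"
    by (simp only: f) (simp add: block_val_def o_def)
  also have "\<dots> = (\<Sum>j<15. of_int (dir_form a j k) * z (m + int j))"
    by (simp only: interv_sum_list_conv_sum_set_nat set_upt atLeast0LessThan)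
  also have "\<dots> = (\<Sum>j<15. (\<Sum>i<15. direction a i * trace_form (reduced_mat i) (reduced_mat j) (reduced_mat k)) * z (m + int j))"
    using sum_direction[OF assms(1) _ assms(3)] by simp
  finally show ?thesis .
qed

text \<open>Two statements about vectors supported on the certified unknowns collide: border rank 24
  provides a non-zero one in the kernel of the flattening, and elimination shows that every such
  vector is zero.\<close>

lemma not_border_rank_le_reduced:
  "\<not> border_rank_le 15 15 15 (\<lambda>i j k. trace_form (reduced_mat i) (reduced_mat j) (reduced_mat k)) 24"
proof
  assume br: "border_rank_le 15 15 15 (\<lambda>i j k. trace_form (reduced_mat i) (reduced_mat j) (reduced_mat k)) 24"
  define X where "X = set (map fst koszul_cert)"
  have "bst free_keys" by (simp add: free_keys_def)
  note dist = triangular_distinct[OF triangular_koszul_cert this]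
  \<comment> \<open>481 is the least number above 20 * 24, so the elimination may stop nine short of
    the full 490.\<close>
  have "length koszul_cert = 481" by (simp add: koszul_cert_def)
  then have "card X = 481" using distinct_card[OF dist(1)] by (simp add: X_def)
  then have X: "finite X" "20 * 24 < card X" by (simp_all add: X_def)
  obtain z where z: "\<exists>\<kappa>\<in>X. z \<kappa> \<noteq> 0" "\<forall>\<kappa>. \<kappa> \<notin> X \<longrightarrow> z \<kappa> = 0"
    "\<forall>a b c d k. a < b \<and> b < c \<and> c < d \<and> d < 7 \<and> k < 15 \<longrightarrow>
      (\<Sum>j<15. wedge3 (\<lambda>a. \<Sum>i<15. direction a i * trace_form (reduced_mat i) (reduced_mat j) (reduced_mat k))
        (\<lambda>b c d. z (trip_key (int b) (int c) (int d) + int j)) a b c d) = 0"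
    using koszul_kernel[OF br X, of direction "\<lambda>b c d j. trip_key (int b) (int c) (int d) + int j"] by blast
  have "block_val z (trip_key b c d) (form_table a k) - block_val z (trip_key a c d) (form_table b k)
      + block_val z (trip_key a b d) (form_table c k) - block_val z (trip_key a b c) (form_table d k) = 0"
    if "0 \<le> a" "a < b" "b < c" "c < d" "d < 7" "0 < k" "k < 15" for a b c d k
  proof -
    define a' b' c' d' k' where nat: "a' = nat a" "b' = nat b" "c' = nat c" "d' = nat d" "k' = nat k"
    have n: "a = int a'" "b = int b'" "c = int c'" "d = int d'" "k = int k'"
      using that by (simp_all add: nat)
    then have "a' < b'" "b' < c'" "c' < d'" "d' < 7" "0 < k'" "k' < 15" using that by auto
    then show ?thesis
      using z(3)[rule_format, of a' b' c' d' k']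
      by (simp add: n block_val_form_table wedge3_def sum.distrib sum_subtractf)
  qed
  \<comment> \<open>The initial tree is disjoint from \<open>X\<close>, and \<open>z\<close>
    vanishes off \<open>X\<close>; this starts the induction of
    \<open>triangular_sound\<close>.\<close>
  moreover have "z \<kappa> = 0" if "\<kappa> \<in> set_tree free_keys" for \<kappa>
    using z(2) dist(2) that by (auto simp: X_def)
  ultimately have "\<forall>\<kappa>\<in>X. z \<kappa> = 0"
    unfolding X_def by (rule triangular_sound[OF _ triangular_koszul_cert])
  with z(1) show False by blast
qed

theorem theorem3:
  shows "border_rank (sl_dim 4) (sl_dim 4) (sl_dim 4) (sl_structure_tensor 4) \<ge> 28"
proof (rule ccontr)
  assume "\<not> ?thesis"
  then have "border_rank_le 15 15 15 (sl_structure_tensor 4) 27"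
    using border_rank_le_mono[OF border_rank_le_border_rank] by (auto simp: sl_dim_4)
  then have "border_rank_le 15 15 15 (\<lambda>i j k. trace_form (basis_mat i) (basis_mat j) (basis_mat k)) (24 + 3)"
    by (auto dest: border_rank_le_trace_form)
  from border_rank_le_reduced[OF this] not_border_rank_le_reduced show False by simp
qed

end
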